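(* Let $(\mathbb M,\theta,g)$ be a $(2n+1)$-dimensional contact Riemannian manifold with $(\mathbb M,g)$ complete. For every $f\in C^\infty(\mathbb M)$ and every local orthonormal frame $X_1,\dots,X_{2n}$ of $\mathcal H(\mathbb M)$ with structure coefficients $[X_i,X_j]=\sum_k w_{ij}^kX_k+\gamma_{ij}Z$, $[X_i,Z]=\sum_j\delta_i^jX_j$ and $\delta_i^i=0$ for all $i$, one has on the domain of the frame $$\Gamma_2^Z(f)=\sum_{i=1}^{2n}(X_iZf)^2+\frac12\sum_{i,l=1}^{2n}(\delta_i^l+\delta_l^i)(X_iX_lf+X_lX_if)\,Zf+\sum_{l=1}^{2n}\Big(\sum_{i=1}^{2n}X_i\delta_i^l-\sum_{i,k=1}^{2n}w_{ik}^k\delta_i^l+\sum_{k=1}^{2n}Zw_{lk}^k\Big)X_lf\,Zf.$$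
   Context: Contact Riemannian manifold: $\mathbb M$ is a smooth $(2n+1)$-dimensional manifold with contact form $\theta$, Reeb field $Z$ ($\theta(Z)=1$, $\mathcal L_Z\theta=0$), a Riemannian metric $g=\langle\cdot,\cdot\rangle$ and a $(1,1)$-tensor $J$ with $g(X,Z)=\theta(X)$, $J^2=-I+\theta\otimes Z$, $g(X,JY)=d\theta(X,Y)$. $\mathcal H(\mathbb M)=\ker\theta$; $\nabla_{\mathcal H}f$ is the orthogonal projection of the Riemannian gradient on $\mathcal H(\mathbb M)$. The sub-Laplacian $L$ is determined by $\int (Lf)h\,d\mu=-\int\langle\nabla_{\mathcal H}f,\nabla_{\mathcal H}h\rangle d\mu$, where $\mu$ is the measure given by $\theta\wedge(d\theta)^n$; in a local frame as in the claim, $L=\sum_{i}X_i^2-\sum_{i,k}w_{ik}^kX_i$. $\Gamma^Z(f,h)=(Zf)(Zh)$ and $\Gamma_2^Z(f)=\frac12\big(L\Gamma^Z(f,f)-2\Gamma^Z(f,Lf)\big)$. *)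

theory Defs
  imports "HOL-Analysis.Analysis"
begin

section \<open>Smooth maps between Euclidean spaces\<close>

text \<open>Only meaningful on open sets, where \<^term>\<open>frechet_derivative f (at x)\<close> is determined by
  the values of \<^term>\<open>f\<close> on the set.\<close>

primrec Ck_on ::
    "nat \<Rightarrow> 'e::euclidean_space set \<Rightarrow> ('e \<Rightarrow> 'f::real_normed_vector) \<Rightarrow> bool" where
  "Ck_on 0 S f \<longleftrightarrow> continuous_on S f"
| "Ck_on (Suc k) S f \<longleftrightarrow>
     (\<forall>x\<in>S. f differentiable (at x)) \<and> (\<forall>v. Ck_on k S (\<lambda>x. frechet_derivative f (at x) v))"

definition Cinf_on :: "'e::euclidean_space set \<Rightarrow> ('e \<Rightarrow> 'f::real_normed_vector) \<Rightarrow> bool" where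
  "Cinf_on S f \<longleftrightarrow> (\<forall>k. Ck_on k S f)"


section \<open>Smooth manifolds\<close>

text \<open>The manifold is the whole type \<^typ>\<open>'m\<close> (Hausdorff, second countable). A chart is a pair
  \<open>(U, \<phi>)\<close> of an open domain and a coordinate map, whose values outside \<open>U\<close> are irrelevant; the
  inverse chart is \<^term>\<open>inv_into U \<phi>\<close>. An atlas need not be maximal.\<close>

type_synonym ('m, 'e) chart = "'m set \<times> ('m \<Rightarrow> 'e)"

definition smooth_atlas ::
    "('m::{t2_space, second_countable_topology}, 'e::euclidean_space) chart set \<Rightarrow> bool" where
  "smooth_atlas A \<longleftrightarrow>
     (\<Union>(U, \<phi>)\<in>A. U) = UNIV \<and>
     (\<forall>(U, \<phi>)\<in>A. open U \<and> open (\<phi> ` U) \<and> homeomorphism U (\<phi> ` U) \<phi> (inv_into U \<phi>)) \<and>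
     (\<forall>(U, \<phi>)\<in>A. \<forall>(V, \<psi>)\<in>A. Cinf_on (\<phi> ` (U \<inter> V)) (\<psi> \<circ> inv_into U \<phi>))"

definition smooth_fun_on ::
    "('m::topological_space, 'e::euclidean_space) chart set \<Rightarrow> 'm set \<Rightarrow> ('m \<Rightarrow> real) \<Rightarrow> bool" where
  "smooth_fun_on A W f \<longleftrightarrow>
     open W \<and> (\<forall>(U, \<phi>)\<in>A. Cinf_on (\<phi> ` (U \<inter> W)) (f \<circ> inv_into U \<phi>))"

definition smooth_near ::
    "('m::topological_space, 'e::euclidean_space) chart set \<Rightarrow> 'm \<Rightarrow> ('m \<Rightarrow> real) \<Rightarrow> bool" where
  "smooth_near A p f \<longleftrightarrow> (\<exists>W. p \<in> W \<and> smooth_fun_on A W f)"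


section \<open>Tangent vectors and vector fields\<close>

text \<open>A tangent vector at \<open>p\<close> is a functional acting on the functions that are smooth near \<open>p\<close>, as
  a directional derivative in some chart; it is normalised to \<open>0\<close> on all other functions, so that
  equality of functionals is equality of tangent vectors. Linear combinations are pointwise.\<close>

type_synonym 'm tvec = "('m \<Rightarrow> real) \<Rightarrow> real"
type_synonym 'm vfield = "'m \<Rightarrow> 'm tvec"

definition coord_vec ::
    "('m::topological_space, 'e::euclidean_space) chart set \<Rightarrow> ('m, 'e) chart \<Rightarrow> 'e \<Rightarrow> 'm vfield" where
  "coord_vec A c \<xi> p =
     (\<lambda>f. if smooth_near A p f
          then frechet_derivative (f \<circ> inv_into (fst c) (snd c)) (at (snd c p)) \<xi>
          else 0)"

definition tangent_space ::
    "('m::topological_space, 'e::euclidean_space) chart set \<Rightarrow> 'm \<Rightarrow> 'm tvec set" where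
  "tangent_space A p = {coord_vec A c \<xi> p | c \<xi>. c \<in> A \<and> p \<in> fst c}"

definition smooth_vfield_on ::
    "('m::topological_space, 'e::euclidean_space) chart set \<Rightarrow> 'm set \<Rightarrow> 'm vfield \<Rightarrow> bool" where
  "smooth_vfield_on A U X \<longleftrightarrow>
     open U \<and> (\<forall>p\<in>U. X p \<in> tangent_space A p) \<and>
     (\<forall>V f. V \<subseteq> U \<and> smooth_fun_on A V f \<longrightarrow> smooth_fun_on A V (\<lambda>p. X p f))"

definition vapp :: "'m vfield \<Rightarrow> ('m \<Rightarrow> real) \<Rightarrow> 'm \<Rightarrow> real" where
  "vapp X f = (\<lambda>p. X p f)"

definition lie_bracket ::
    "('m::topological_space, 'e::euclidean_space) chart set \<Rightarrow> 'm vfield \<Rightarrow> 'm vfield \<Rightarrow> 'm vfield" where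
  "lie_bracket A X Y p =
     (\<lambda>f. if smooth_near A p f then X p (vapp Y f) - Y p (vapp X f) else 0)"


section \<open>Tensor fields\<close>

definition linear_on_tangent ::
    "('m::topological_space, 'e::euclidean_space) chart set \<Rightarrow> 'm \<Rightarrow> ('m tvec \<Rightarrow> real) \<Rightarrow> bool" where
  "linear_on_tangent A p \<alpha> \<longleftrightarrow>
     (\<forall>u\<in>tangent_space A p. \<forall>v\<in>tangent_space A p. \<forall>a b.
        \<alpha> (\<lambda>f. a * u f + b * v f) = a * \<alpha> u + b * \<alpha> v)"

definition smooth_one_form ::
    "('m::topological_space, 'e::euclidean_space) chart set \<Rightarrow> ('m \<Rightarrow> 'm tvec \<Rightarrow> real) \<Rightarrow> bool" where
  "smooth_one_form A \<theta> \<longleftrightarrow>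
     (\<forall>p. linear_on_tangent A p (\<theta> p)) \<and>
     (\<forall>U X. smooth_vfield_on A U X \<longrightarrow> smooth_fun_on A U (\<lambda>p. \<theta> p (X p)))"

definition smooth_endomorphism ::
    "('m::topological_space, 'e::euclidean_space) chart set \<Rightarrow> ('m \<Rightarrow> 'm tvec \<Rightarrow> 'm tvec) \<Rightarrow> bool" where
  "smooth_endomorphism A J \<longleftrightarrow>
     (\<forall>p. \<forall>u\<in>tangent_space A p. J p u \<in> tangent_space A p) \<and>
     (\<forall>p. \<forall>u\<in>tangent_space A p. \<forall>v\<in>tangent_space A p. \<forall>a b.
        J p (\<lambda>f. a * u f + b * v f) = (\<lambda>f. a * J p u f + b * J p v f)) \<and>
     (\<forall>U X. smooth_vfield_on A U X \<longrightarrow> smooth_vfield_on A U (\<lambda>p. J p (X p)))"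

definition riemannian_metric ::
    "('m::topological_space, 'e::euclidean_space) chart set \<Rightarrow> ('m \<Rightarrow> 'm tvec \<Rightarrow> 'm tvec \<Rightarrow> real) \<Rightarrow> bool"
  where
  "riemannian_metric A g \<longleftrightarrow>
     (\<forall>p. \<forall>u\<in>tangent_space A p. linear_on_tangent A p (g p u)) \<and>
     (\<forall>p. \<forall>u\<in>tangent_space A p. \<forall>v\<in>tangent_space A p. g p u v = g p v u) \<and>
     (\<forall>p. \<forall>u\<in>tangent_space A p. u \<noteq> (\<lambda>f. 0) \<longrightarrow> 0 < g p u u) \<and>
     (\<forall>U X Y. smooth_vfield_on A U X \<and> smooth_vfield_on A U Y \<longrightarrow>
        smooth_fun_on A U (\<lambda>p. g p (X p) (Y p)))"

text \<open>Exterior derivative of a 1-form, with the convention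
  \<open>d\<theta>(X, Y) = X \<theta>(Y) - Y \<theta>(X) - \<theta>([X, Y])\<close>.\<close>

definition ext_deriv ::
    "('m::topological_space, 'e::euclidean_space) chart set \<Rightarrow> ('m \<Rightarrow> 'm tvec \<Rightarrow> real) \<Rightarrow>
      'm vfield \<Rightarrow> 'm vfield \<Rightarrow> 'm \<Rightarrow> real" where
  "ext_deriv A \<theta> X Y p =
     X p (\<lambda>q. \<theta> q (Y q)) - Y p (\<lambda>q. \<theta> q (X q)) - \<theta> p (lie_bracket A X Y p)"

definition lie_deriv_form ::
    "('m::topological_space, 'e::euclidean_space) chart set \<Rightarrow> 'm vfield \<Rightarrow> ('m \<Rightarrow> 'm tvec \<Rightarrow> real) \<Rightarrow>
      'm vfield \<Rightarrow> 'm \<Rightarrow> real" where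
  "lie_deriv_form A Z \<theta> X p = Z p (\<lambda>q. \<theta> q (X q)) - \<theta> p (lie_bracket A Z X p)"

text \<open>The \<open>(2n+1)\<close>-form \<open>\<theta> \<and> (d\<theta>)\<^sup>n\<close> evaluated on \<open>V 0, \<dots>, V (2n)\<close>. The wedge of one 1-form and
  \<open>n\<close> 2-forms is the signed sum over all permutations divided by \<open>1! (2!)\<^sup>n\<close>.\<close>

definition contact_volume_form ::
    "('m::topological_space, 'e::euclidean_space) chart set \<Rightarrow> nat \<Rightarrow> ('m \<Rightarrow> 'm tvec \<Rightarrow> real) \<Rightarrow>
      (nat \<Rightarrow> 'm vfield) \<Rightarrow> 'm \<Rightarrow> real" where
  "contact_volume_form A n \<theta> V p =
     (1 / 2 ^ n) * (\<Sum>\<sigma> | \<sigma> permutes {0..2 * n}.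
        of_int (sign \<sigma>) * \<theta> p (V (\<sigma> 0) p) *
        (\<Prod>k = 1..n. ext_deriv A \<theta> (V (\<sigma> (2 * k - 1))) (V (\<sigma> (2 * k))) p))"


section \<open>Contact Riemannian manifolds\<close>

definition contact_form ::
    "('m::topological_space, 'e::euclidean_space) chart set \<Rightarrow> nat \<Rightarrow> ('m \<Rightarrow> 'm tvec \<Rightarrow> real) \<Rightarrow> bool" where
  "contact_form A n \<theta> \<longleftrightarrow>
     smooth_one_form A \<theta> \<and>
     (\<forall>p. \<exists>U V. p \<in> U \<and> (\<forall>i\<le>2 * n. smooth_vfield_on A U (V i)) \<and>
        contact_volume_form A n \<theta> V p \<noteq> 0)"

definition reeb_field ::
    "('m::topological_space, 'e::euclidean_space) chart set \<Rightarrow> ('m \<Rightarrow> 'm tvec \<Rightarrow> real) \<Rightarrow>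
      'm vfield \<Rightarrow> bool" where
  "reeb_field A \<theta> Z \<longleftrightarrow>
     smooth_vfield_on A UNIV Z \<and>
     (\<forall>p. \<theta> p (Z p) = 1) \<and>
     (\<forall>U X. smooth_vfield_on A U X \<longrightarrow> (\<forall>p\<in>U. lie_deriv_form A Z \<theta> X p = 0))"

definition contact_riemannian_manifold ::
    "('m::{t2_space, second_countable_topology}, 'e::euclidean_space) chart set \<Rightarrow> nat \<Rightarrow>
      ('m \<Rightarrow> 'm tvec \<Rightarrow> real) \<Rightarrow> 'm vfield \<Rightarrow> ('m \<Rightarrow> 'm tvec \<Rightarrow> 'm tvec \<Rightarrow> real) \<Rightarrow>
      ('m \<Rightarrow> 'm tvec \<Rightarrow> 'm tvec) \<Rightarrow> bool" where
  "contact_riemannian_manifold A n \<theta> Z g J \<longleftrightarrow>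
     smooth_atlas A \<and> DIM('e) = 2 * n + 1 \<and>
     contact_form A n \<theta> \<and> reeb_field A \<theta> Z \<and> riemannian_metric A g \<and> smooth_endomorphism A J \<and>
     (\<forall>p. \<forall>u\<in>tangent_space A p. g p u (Z p) = \<theta> p u) \<and>
     (\<forall>p. \<forall>u\<in>tangent_space A p. J p (J p u) = (\<lambda>f. - u f + \<theta> p u * Z p f)) \<and>
     (\<forall>U X Y. smooth_vfield_on A U X \<and> smooth_vfield_on A U Y \<longrightarrow>
        (\<forall>p\<in>U. g p (X p) (J p (Y p)) = ext_deriv A \<theta> X Y p))"


section \<open>Completeness for the Riemannian distance\<close>

definition piecewise_C1_curve ::
    "('m::topological_space, 'e::euclidean_space) chart set \<Rightarrow> (real \<Rightarrow> 'm) \<Rightarrow> bool" where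
  "piecewise_C1_curve A \<gamma> \<longleftrightarrow>
     continuous_on {0..1} \<gamma> \<and>
     (\<exists>S. finite S \<and> (\<forall>(U, \<phi>)\<in>A. (\<phi> \<circ> \<gamma>) C1_differentiable_on (({0<..<1} - S) \<inter> \<gamma> -` U)))"

definition velocity ::
    "('m::topological_space, 'e::euclidean_space) chart set \<Rightarrow> (real \<Rightarrow> 'm) \<Rightarrow> real \<Rightarrow> 'm tvec" where
  "velocity A \<gamma> t = (\<lambda>f. if smooth_near A (\<gamma> t) f then deriv (f \<circ> \<gamma>) t else 0)"

definition curve_length ::
    "('m::topological_space, 'e::euclidean_space) chart set \<Rightarrow> ('m \<Rightarrow> 'm tvec \<Rightarrow> 'm tvec \<Rightarrow> real) \<Rightarrow>
      (real \<Rightarrow> 'm) \<Rightarrow> ennreal" where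
  "curve_length A g \<gamma> =
     (\<integral>\<^sup>+ t\<in>{0..1}. ennreal (sqrt (g (\<gamma> t) (velocity A \<gamma> t) (velocity A \<gamma> t))) \<partial>lborel)"

text \<open>The distance is \<open>\<infinity>\<close> between points in different connected components.\<close>

definition riemannian_dist ::
    "('m::topological_space, 'e::euclidean_space) chart set \<Rightarrow> ('m \<Rightarrow> 'm tvec \<Rightarrow> 'm tvec \<Rightarrow> real) \<Rightarrow>
      'm \<Rightarrow> 'm \<Rightarrow> ennreal" where
  "riemannian_dist A g p q =
     (INF \<gamma>\<in>{\<gamma>. piecewise_C1_curve A \<gamma> \<and> \<gamma> 0 = p \<and> \<gamma> 1 = q}. curve_length A g \<gamma>)"

definition complete_riemannian ::
    "('m::topological_space, 'e::euclidean_space) chart set \<Rightarrow> ('m \<Rightarrow> 'm tvec \<Rightarrow> 'm tvec \<Rightarrow> real) \<Rightarrow> bool"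
  where
  "complete_riemannian A g \<longleftrightarrow>
     (\<forall>x :: nat \<Rightarrow> 'm.
        (\<forall>\<epsilon>>0. \<exists>N. \<forall>j\<ge>N. \<forall>k\<ge>N. riemannian_dist A g (x j) (x k) < \<epsilon>) \<longrightarrow>
        (\<exists>p. (\<lambda>k. riemannian_dist A g (x k) p) \<longlonglongrightarrow> 0))"


section \<open>Sub-Laplacian\<close>

definition horizontal_space ::
    "('m::topological_space, 'e::euclidean_space) chart set \<Rightarrow> ('m \<Rightarrow> 'm tvec \<Rightarrow> real) \<Rightarrow> 'm \<Rightarrow>
      'm tvec set" where
  "horizontal_space A \<theta> p = {u \<in> tangent_space A p. \<theta> p u = 0}"

definition riemannian_gradient ::
    "('m::topological_space, 'e::euclidean_space) chart set \<Rightarrow> ('m \<Rightarrow> 'm tvec \<Rightarrow> 'm tvec \<Rightarrow> real) \<Rightarrow>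
      ('m \<Rightarrow> real) \<Rightarrow> 'm vfield" where
  "riemannian_gradient A g f p =
     (THE v. v \<in> tangent_space A p \<and> (\<forall>u\<in>tangent_space A p. g p v u = u f))"

definition horizontal_gradient ::
    "('m::topological_space, 'e::euclidean_space) chart set \<Rightarrow> ('m \<Rightarrow> 'm tvec \<Rightarrow> real) \<Rightarrow>
      ('m \<Rightarrow> 'm tvec \<Rightarrow> 'm tvec \<Rightarrow> real) \<Rightarrow> ('m \<Rightarrow> real) \<Rightarrow> 'm vfield" where
  "horizontal_gradient A \<theta> g f p =
     (THE v. v \<in> horizontal_space A \<theta> p \<and>
        (\<forall>u\<in>horizontal_space A \<theta> p. g p (\<lambda>h. riemannian_gradient A g f p h - v h) u = 0))"

text \<open>The Borel measure with density \<open>\<bar>\<theta> \<and> (d\<theta>)\<^sup>n (\<partial>\<^sub>0, \<dots>, \<partial>\<^sub>2\<^sub>n)\<bar>\<close> with respect to Lebesgue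
  measure in every chart of the atlas; the enumeration \<open>e\<close> of the coordinate directions affects only
  the sign of the form.\<close>

definition contact_measure ::
    "('m::topological_space, 'e::euclidean_space) chart set \<Rightarrow> nat \<Rightarrow> ('m \<Rightarrow> 'm tvec \<Rightarrow> real) \<Rightarrow>
      'm measure \<Rightarrow> bool" where
  "contact_measure A n \<theta> \<mu> \<longleftrightarrow>
     sets \<mu> = sets borel \<and>
     (\<forall>c\<in>A. \<forall>e B. bij_betw e {0..2 * n} (Basis :: 'e set) \<and> B \<in> sets borel \<and> B \<subseteq> fst c \<longrightarrow>
        emeasure \<mu> B =
          (\<integral>\<^sup>+ x\<in>snd c ` B.
             ennreal \<bar>contact_volume_form A n \<theta> (\<lambda>i. coord_vec A c (e i))
               (inv_into (fst c) (snd c) x)\<bar> \<partial>lborel))"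

definition test_function ::
    "('m::topological_space, 'e::euclidean_space) chart set \<Rightarrow> ('m \<Rightarrow> real) \<Rightarrow> bool" where
  "test_function A h \<longleftrightarrow> smooth_fun_on A UNIV h \<and> compact (closure {p. h p \<noteq> 0})"

definition sub_laplacian ::
    "('m::topological_space, 'e::euclidean_space) chart set \<Rightarrow> ('m \<Rightarrow> 'm tvec \<Rightarrow> real) \<Rightarrow>
      ('m \<Rightarrow> 'm tvec \<Rightarrow> 'm tvec \<Rightarrow> real) \<Rightarrow> 'm measure \<Rightarrow> (('m \<Rightarrow> real) \<Rightarrow> 'm \<Rightarrow> real) \<Rightarrow> bool" where
  "sub_laplacian A \<theta> g \<mu> L \<longleftrightarrow>
     (\<forall>f. smooth_fun_on A UNIV f \<longrightarrow>
        smooth_fun_on A UNIV (L f) \<and>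
        (\<forall>h. test_function A h \<longrightarrow>
           (\<integral>p. L f p * h p \<partial>\<mu>) =
           - (\<integral>p. g p (horizontal_gradient A \<theta> g f p) (horizontal_gradient A \<theta> g h p) \<partial>\<mu>)))"

definition Gamma_Z :: "'m vfield \<Rightarrow> ('m \<Rightarrow> real) \<Rightarrow> ('m \<Rightarrow> real) \<Rightarrow> 'm \<Rightarrow> real" where
  "Gamma_Z Z f h = (\<lambda>p. vapp Z f p * vapp Z h p)"

definition Gamma2_Z ::
    "(('m \<Rightarrow> real) \<Rightarrow> 'm \<Rightarrow> real) \<Rightarrow> 'm vfield \<Rightarrow> ('m \<Rightarrow> real) \<Rightarrow> 'm \<Rightarrow> real" where
  "Gamma2_Z L Z f = (\<lambda>p. 1 / 2 * (L (Gamma_Z Z f f) p - 2 * Gamma_Z Z f (L f) p))"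


section \<open>Horizontal frames\<close>

definition horizontal_orthonormal_frame ::
    "('m::topological_space, 'e::euclidean_space) chart set \<Rightarrow> nat \<Rightarrow> ('m \<Rightarrow> 'm tvec \<Rightarrow> real) \<Rightarrow>
      ('m \<Rightarrow> 'm tvec \<Rightarrow> 'm tvec \<Rightarrow> real) \<Rightarrow> 'm set \<Rightarrow> (nat \<Rightarrow> 'm vfield) \<Rightarrow> bool" where
  "horizontal_orthonormal_frame A n \<theta> g U X \<longleftrightarrow>
     open U \<and>
     (\<forall>i\<in>{1..2 * n}. smooth_vfield_on A U (X i)) \<and>
     (\<forall>p\<in>U. \<forall>i\<in>{1..2 * n}. X i p \<in> horizontal_space A \<theta> p) \<and>
     (\<forall>p\<in>U. \<forall>u\<in>horizontal_space A \<theta> p. \<exists>c. u = (\<lambda>f. \<Sum>i = 1..2 * n. c i * X i p f)) \<and>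
     (\<forall>p\<in>U. \<forall>i\<in>{1..2 * n}. \<forall>j\<in>{1..2 * n}. g p (X i p) (X j p) = (if i = j then 1 else 0))"

end

theory Submission
  imports Defs
begin

text \<open>The point is the formula \<open>L = \<Sum>\<^sub>i X\<^sub>i\<^sup>2 - \<Sum>\<^sub>i\<^sub>k w\<^sub>i\<^sub>k\<^sup>k X\<^sub>i\<close> on the domain of the frame; given it, the claim
  follows from \<open>L(u\<^sup>2) = 2 u L u + 2 \<Sum>\<^sub>i (X\<^sub>i u)\<^sup>2\<close> with \<open>u = Z f\<close> and from expanding \<open>[L, Z]\<close> with
  \<open>[X\<^sub>i, Z] = \<Sum>\<^sub>j \<delta>\<^sub>i\<^sup>j X\<^sub>j\<close>. The formula for \<open>L\<close> says that \<open>X\<^sub>i\<close> has divergence \<open>- \<Sum>\<^sub>k w\<^sub>i\<^sub>k\<^sup>k\<close> with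
  respect to \<open>\<theta> \<and> (d\<theta>)\<^sup>n\<close>. In the orthonormal frame \<open>Z, X\<^sub>1, \<dots>, X\<^sub>2\<^sub>n\<close> the form \<open>d\<theta> = g(\<cdot>, J \<cdot>)\<close> is a
  skew matrix with square \<open>-1\<close> on the horizontal space, so its infinitesimal changes are generated by
  traceless matrices, and only the brackets of \<open>X\<^sub>i\<close> with the frame contribute to the divergence.\<close>

section \<open>Calculus of smooth maps on Euclidean spaces\<close>

text \<open>\<open>L\<close> is known only through an integral identity tested against global
  functions, while the frame lives on \<open>U\<close>. The pointwise formula has to be won back
  from that identity, by integrating by parts in one chart against a bump function supported inside
  \<open>U\<close>. This is why flat functions, translation invariance of Lebesgue measure and the
  transfer of \<open>\<mu>\<close> to a chart appear. The derivative of the chart density along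
  \<open>X i\<close> is found as the trace of a matrix \<open>K\<close> describing how
  \<open>\<theta>\<close> and \<open>d\<theta>\<close> change in the coordinate frame. As the
  density has no zeros, every such matrix has the same trace; the one built from the traceless
  correction \<open>S\<close> is chosen because its trace can be read off. A tangent vector is
  normalised to 0 on functions that are not smooth near its base point, so additivity and the
  product rule hold only for functions smooth there; hence the \<open>smooth_near\<close> side
  conditions throughout. The structure functions \<open>w\<close> and \<open>\<delta>\<close> are
  given as bare functions, and their smoothness is recovered by pairing brackets with the
  frame.\<close>

lemma Ck_on_SucD:
  assumes "Ck_on (Suc k) S f" "x \<in> S"
  shows "(f has_derivative frechet_derivative f (at x)) (at x)"
  using assms frechet_derivative_works by auto

text \<open>Openness of \<open>S\<close> matters: equality on \<open>S\<close> passes to derivatives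
  because each point of \<open>S\<close> has a whole neighbourhood in \<open>S\<close>.\<close>

lemma Ck_on_cong:
  assumes S: "open S" and "\<And>x. x \<in> S \<Longrightarrow> f x = g x" and "Ck_on k S f"
  shows "Ck_on k S g"
  using assms(2,3)
proof (induction k arbitrary: f g)
  case 0
  then show ?case by (simp cong: continuous_on_cong)
next
  case (Suc k)
  have D: "(g has_derivative frechet_derivative f (at x)) (at x)" if "x \<in> S" for x
    using has_derivative_transform_within_open[OF Ck_on_SucD[OF Suc.prems(2) that] S that]
      Suc.prems(1) by blast
  have "frechet_derivative g (at x) = frechet_derivative f (at x)" if "x \<in> S" for x
    using D[OF that] frechet_derivative_at by metis
  then have "Ck_on k S (\<lambda>x. frechet_derivative g (at x) v)" for v
    using Suc.IH[of "\<lambda>x. frechet_derivative f (at x) v" "\<lambda>x. frechet_derivative g (at x) v"]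
      Suc.prems(2) by simp
  then show ?case
    using D by (auto simp: differentiable_def)
qed

text \<open>By uniqueness of derivatives, an explicit \<open>f'\<close> may stand in for the
  choice-based \<open>frechet_derivative\<close>.\<close>

lemma Ck_on_SucI:
  assumes S: "open S" and D: "\<And>x. x \<in> S \<Longrightarrow> (f has_derivative f' x) (at x)"
    and C: "\<And>v. Ck_on k S (\<lambda>x. f' x v)"
  shows "Ck_on (Suc k) S f"
proof -
  have "frechet_derivative f (at x) = f' x" if "x \<in> S" for x
    using D[OF that] frechet_derivative_at by metis
  then have "Ck_on k S (\<lambda>x. frechet_derivative f (at x) v)" for v
    using Ck_on_cong[OF S _ C[of v]] by simp
  then show ?thesis using D by (auto simp: differentiable_def)
qed

lemma Ck_on_subset: "Ck_on k S f \<Longrightarrow> T \<subseteq> S \<Longrightarrow> Ck_on k T f"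
  by (induction k arbitrary: f) (auto intro: continuous_on_subset)

lemma Ck_on_Suc_imp: "Ck_on (Suc k) S f \<Longrightarrow> Ck_on k S f"
proof (induction k arbitrary: f)
  case 0
  then show ?case
    by (auto intro!: continuous_at_imp_continuous_on differentiable_imp_continuous_within)
next
  case (Suc k)
  then show ?case by (metis Ck_on.simps(2))
qed

lemma Ck_on_local:
  assumes "\<And>x. x \<in> S \<Longrightarrow> \<exists>T. open T \<and> x \<in> T \<and> Ck_on k T f"
  shows "Ck_on k S f"
  using assms
proof (induction k arbitrary: f)
  case 0
  have "isCont f x" if x: "x \<in> S" for x
    using 0[OF x] by (auto simp: continuous_on_eq_continuous_at)
  then show ?case by (simp add: continuous_at_imp_continuous_on)
next
  case (Suc k)
  have "f differentiable (at x)" if "x \<in> S" for x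
    using Suc.prems[OF that] by auto
  moreover have "Ck_on k S (\<lambda>x. frechet_derivative f (at x) v)" for v
    using Suc.prems by (intro Suc.IH) fastforce
  ultimately show ?case by simp
qed

lemma Ck_on_const: "Ck_on k S (\<lambda>x. c)"
proof (induction k arbitrary: c)
  case (Suc k)
  then show ?case by simp
qed simp

lemma Ck_on_bounded_linear_compose:
  assumes S: "open S" and L: "bounded_linear L" and "Ck_on k S f"
  shows "Ck_on k S (\<lambda>x. L (f x))"
  using assms(3)
proof (induction k arbitrary: f)
  case 0
  then show ?case using L by (simp add: bounded_linear.continuous_on)
next
  case (Suc k)
  show ?case
    by (rule Ck_on_SucI[OF S bounded_linear.has_derivative[OF L Ck_on_SucD[OF Suc.prems]]])
      (use Suc in auto)
qed

lemma Ck_on_bounded_linear: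
  assumes S: "open S" and L: "bounded_linear L"
  shows "Ck_on k S L"
proof (cases k)
  case 0
  then show ?thesis using L by (simp add: linear_continuous_on)
next
  case (Suc j)
  show ?thesis unfolding Suc
    by (rule Ck_on_SucI[OF S, where f'="\<lambda>x. L"])
      (use L Ck_on_const bounded_linear_imp_has_derivative in auto)
qed

lemma Ck_on_add:
  assumes S: "open S" and "Ck_on k S f" "Ck_on k S g"
  shows "Ck_on k S (\<lambda>x. f x + g x)"
  using assms(2,3)
proof (induction k arbitrary: f g)
  case 0
  then show ?case by (simp add: continuous_on_add)
next
  case (Suc k)
  show ?case
    by (rule Ck_on_SucI[OF S has_derivative_add[OF Ck_on_SucD[OF Suc.prems(1)]
            Ck_on_SucD[OF Suc.prems(2)]]])
      (use Suc in auto)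
qed

lemma Ck_on_mult:
  fixes f g :: "'e::euclidean_space \<Rightarrow> real"
  assumes S: "open S" and "Ck_on k S f" "Ck_on k S g"
  shows "Ck_on k S (\<lambda>x. f x * g x)"
  using assms(2,3)
proof (induction k arbitrary: f g)
  case 0
  then show ?case by (simp add: continuous_on_mult)
next
  case (Suc k)
  show ?case
  proof (rule Ck_on_SucI[OF S])
    fix x assume x: "x \<in> S"
    show "((\<lambda>x. f x * g x) has_derivative
      (\<lambda>v. f x * frechet_derivative g (at x) v + frechet_derivative f (at x) v * g x)) (at x)"
      by (rule has_derivative_mult) (use x Suc.prems Ck_on_SucD in blast)+
  next
    fix v
    show "Ck_on k S (\<lambda>x. f x * frechet_derivative g (at x) v + frechet_derivative f (at x) v * g x)"
      using Suc.prems Suc.prems[THEN Ck_on_Suc_imp]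
      by (intro Ck_on_add[OF S] Suc.IH) auto
  qed
qed

lemma Ck_on_sum:
  assumes S: "open S" and "\<And>i. i \<in> I \<Longrightarrow> Ck_on k S (f i)"
  shows "Ck_on k S (\<lambda>x. \<Sum>i\<in>I. f i x)"
  using assms(2)
  by (induction I rule: infinite_finite_induct) (auto intro: Ck_on_const Ck_on_add[OF S])

lemma linear_on_basis_expansion:
  fixes L :: "'e::euclidean_space \<Rightarrow> real"
  assumes "linear L"
  shows "L v = (\<Sum>b\<in>Basis. (v \<bullet> b) * L b)"
proof -
  have "L v = L (\<Sum>b\<in>Basis. (v \<bullet> b) *\<^sub>R b)" by (simp add: euclidean_representation)
  then show ?thesis using assms by (simp add: linear_sum linear_scale)
qed

text \<open>The inner map is smooth to all orders so that the induction on the order of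
  \<open>f\<close> can keep it fixed.\<close>

lemma Ck_on_compose:
  fixes f :: "'f::euclidean_space \<Rightarrow> real" and \<phi> :: "'e::euclidean_space \<Rightarrow> 'f"
  assumes S: "open S" and "Cinf_on S \<phi>" and "\<phi> ` S \<subseteq> T" and "Ck_on k T f"
  shows "Ck_on k S (\<lambda>x. f (\<phi> x))"
  using assms(4)
proof (induction k arbitrary: f)
  case 0
  have "continuous_on S \<phi>" using assms(2) Ck_on.simps(1) unfolding Cinf_on_def by blast
  with 0 show ?case by (simp add: continuous_on_compose2[OF _ _ assms(3)])
next
  case (Suc k)
  have \<phi>: "Ck_on (Suc j) S \<phi>" for j using assms(2) by (auto simp: Cinf_on_def)
  let ?D = "\<lambda>x v. frechet_derivative f (at (\<phi> x)) (frechet_derivative \<phi> (at x) v)"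
  have D: "((\<lambda>x. f (\<phi> x)) has_derivative ?D x) (at x)" if "x \<in> S" for x
    using diff_chain_at[OF Ck_on_SucD[OF \<phi> that] Ck_on_SucD[OF Suc.prems]] that assms(3)
    by (auto simp: o_def)
  show ?case
  proof (rule Ck_on_SucI[OF S D])
    fix v
    \<comment> \<open>In the chain rule both the linear map and its argument depend on
      \<open>x\<close>; a basis expansion separates them into a sum of products, to which the
      induction hypothesis applies factor by factor.\<close>
    have "Ck_on k S (\<lambda>x. \<Sum>b\<in>Basis. (frechet_derivative \<phi> (at x) v \<bullet> b)
        * frechet_derivative f (at (\<phi> x)) b)"
    proof (intro Ck_on_sum[OF S] Ck_on_mult[OF S] Suc.IH)
      fix b :: 'f
      show "Ck_on k S (\<lambda>x. frechet_derivative \<phi> (at x) v \<bullet> b)"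
        using \<phi>[of k] by (intro Ck_on_bounded_linear_compose[OF S bounded_linear_inner_left]) simp
      show "Ck_on k T (\<lambda>y. frechet_derivative f (at y) b)" using Suc.prems by simp
    qed
    then show "Ck_on k S (\<lambda>x. ?D x v)"
    proof (rule Ck_on_cong[OF S, rotated])
      fix x assume "x \<in> S"
      then have "linear (frechet_derivative f (at (\<phi> x)))"
        using Ck_on_SucD[OF Suc.prems] assms(3) has_derivative_linear by blast
      then show "(\<Sum>b\<in>Basis. (frechet_derivative \<phi> (at x) v \<bullet> b)
          * frechet_derivative f (at (\<phi> x)) b) = ?D x v"
        by (rule linear_on_basis_expansion[symmetric])
    qed
  qed
qed

lemma Cinf_on_cong:
  "open S \<Longrightarrow> (\<And>x. x \<in> S \<Longrightarrow> f x = g x) \<Longrightarrow> Cinf_on S f \<Longrightarrow> Cinf_on S g"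
  unfolding Cinf_on_def using Ck_on_cong by blast

lemma Cinf_on_subset: "Cinf_on S f \<Longrightarrow> T \<subseteq> S \<Longrightarrow> Cinf_on T f"
  unfolding Cinf_on_def using Ck_on_subset by blast

lemma Cinf_on_local:
  assumes "\<And>x. x \<in> S \<Longrightarrow> \<exists>T. open T \<and> x \<in> T \<and> Cinf_on T f"
  shows "Cinf_on S f"
  unfolding Cinf_on_def
proof
  fix k show "Ck_on k S f" by (rule Ck_on_local) (use assms Cinf_on_def in blast)
qed

lemma Cinf_on_const: "Cinf_on S (\<lambda>x. c)"
  unfolding Cinf_on_def using Ck_on_const by blast

lemma Cinf_on_bounded_linear: "open S \<Longrightarrow> bounded_linear L \<Longrightarrow> Cinf_on S L"
  unfolding Cinf_on_def using Ck_on_bounded_linear by blast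

lemma Cinf_on_add: "open S \<Longrightarrow> Cinf_on S f \<Longrightarrow> Cinf_on S g \<Longrightarrow> Cinf_on S (\<lambda>x. f x + g x)"
  unfolding Cinf_on_def using Ck_on_add by blast

lemma Cinf_on_mult:
  fixes f g :: "'e::euclidean_space \<Rightarrow> real"
  shows "open S \<Longrightarrow> Cinf_on S f \<Longrightarrow> Cinf_on S g \<Longrightarrow> Cinf_on S (\<lambda>x. f x * g x)"
  unfolding Cinf_on_def using Ck_on_mult by blast

lemma Cinf_on_sum:
  "open S \<Longrightarrow> (\<And>i. i \<in> I \<Longrightarrow> Cinf_on S (f i)) \<Longrightarrow> Cinf_on S (\<lambda>x. \<Sum>i\<in>I. f i x)"
  by (simp add: Cinf_on_def Ck_on_sum)

lemma Cinf_on_compose: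
  fixes f :: "'f::euclidean_space \<Rightarrow> real" and \<phi> :: "'e::euclidean_space \<Rightarrow> 'f"
  shows "open S \<Longrightarrow> Cinf_on S \<phi> \<Longrightarrow> \<phi> ` S \<subseteq> T \<Longrightarrow> Cinf_on T f \<Longrightarrow> Cinf_on S (\<lambda>x. f (\<phi> x))"
  by (simp add: Cinf_on_def[of T] Cinf_on_def[of S "\<lambda>x. f (\<phi> x)"] Ck_on_compose)

lemma Cinf_on_has_derivative:
  assumes "Cinf_on S f" "x \<in> S"
  shows "(f has_derivative frechet_derivative f (at x)) (at x)"
  using Ck_on_SucD[of 0 S f x] assms unfolding Cinf_on_def by blast

lemma Cinf_on_frechet_derivative:
  "Cinf_on S f \<Longrightarrow> Cinf_on S (\<lambda>x. frechet_derivative f (at x) v)"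
  unfolding Cinf_on_def using Ck_on.simps(2)[of _ S f] by blast

lemma Cinf_on_continuous_on: "Cinf_on S f \<Longrightarrow> continuous_on S f"
  unfolding Cinf_on_def using Ck_on.simps(1)[of S f] by blast

text \<open>The extension is \<open>f\<close> on the open set \<open>S\<close> and 0 on the open
  complement of \<open>K\<close>, and these two sets cover the space.\<close>

lemma Cinf_on_extend_by_zero:
  fixes f :: "'e::euclidean_space \<Rightarrow> 'f::real_normed_vector"
  assumes S: "open S" and f: "Cinf_on S f" and K: "closed K" "K \<subseteq> S"
    and 0: "\<And>x. x \<in> S - K \<Longrightarrow> f x = 0"
  shows "Cinf_on UNIV (\<lambda>x. if x \<in> S then f x else 0)" (is "Cinf_on _ ?g")
proof (rule Cinf_on_local)
  fix x :: 'e
  have "Cinf_on S ?g" by (rule Cinf_on_cong[OF S _ f]) simp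
  moreover have "Cinf_on (- K) ?g"
    by (rule Cinf_on_cong[OF _ _ Cinf_on_const[of _ 0]]) (use K 0 in auto)
  ultimately show "\<exists>T. open T \<and> x \<in> T \<and> Cinf_on T ?g"
    using S K by (metis ComplI Compl_iff open_Compl subsetD)
qed

subsection \<open>A bump function\<close>

text \<open>The polynomial parameter makes the family closed under differentiation, so that
  smoothness of all members follows by one induction.\<close>

definition flat_fun :: "real poly \<Rightarrow> real \<Rightarrow> real" where
  "flat_fun P t = (if t > 0 then poly P (inverse t) * exp (- inverse t) else 0)"

text \<open>With \<open>x = 1/t\<close> this is the fact that the exponential outgrows every power
  at infinity.\<close>

lemma flat_fun_tendsto_0: "((\<lambda>t. poly P (inverse t) * exp (- inverse t)) \<longlongrightarrow> 0) (at_right (0::real))"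
proof -
  have "((\<lambda>x. \<Sum>i\<le>degree P. coeff P i * (x ^ i / exp x)) \<longlongrightarrow> (\<Sum>i\<le>degree P. coeff P i * 0)) at_top"
    by (intro tendsto_intros tendsto_power_div_exp_0)
  then have "((\<lambda>x. poly P x * exp (- x)) \<longlongrightarrow> 0) at_top"
    by (simp add: poly_altdef sum_distrib_right sum_divide_distrib exp_minus field_simps)
  from filterlim_compose[OF this filterlim_inverse_at_top_right] show ?thesis .
qed

text \<open>For \<open>t > 0\<close> the derivative of \<open>P(1/t) exp(-1/t)\<close> is
  \<open>(1/t)^2 (P - P')(1/t) exp(-1/t)\<close>; the polynomial \<open>[:0,0,1:]\<close> is the
  square of the variable.\<close>

lemma flat_fun_has_derivative:
  "(flat_fun P has_real_derivative flat_fun ([:0,0,1:] * (P - pderiv P)) t) (at t)"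
proof (cases "t = 0")
  case True
  \<comment> \<open>Dividing by \<open>t\<close> multiplies the polynomial by its variable, so the
    difference quotient at 0 is again of the flat form, for \<open>pCons 0 P\<close>.\<close>
  have 1: "((\<lambda>y. (flat_fun P y - flat_fun P 0) / (y - 0)) \<longlongrightarrow> 0) (at_right 0)"
  proof (rule Lim_transform_eventually[OF flat_fun_tendsto_0[of "pCons 0 P"]])
    show "\<forall>\<^sub>F t in at_right 0. poly (pCons 0 P) (inverse t) * exp (- inverse t) =
        (flat_fun P t - flat_fun P 0) / (t - 0)"
      using eventually_at_right_less[of "0::real"]
      by eventually_elim (simp add: flat_fun_def field_simps)
  qed
  have 2: "((\<lambda>y. (flat_fun P y - flat_fun P 0) / (y - 0)) \<longlongrightarrow> 0) (at_left 0)"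
    by (rule Lim_transform_eventually[OF tendsto_const])
      (auto simp: eventually_at_filter flat_fun_def)
  show ?thesis
    using filterlim_split_at[OF 2 1] True unfolding has_field_derivative_iff
    by (simp add: flat_fun_def)
next
  case False
  then consider "t > 0" | "t < 0" by linarith
  then show ?thesis
  proof cases
    case 1
    have "((\<lambda>t. poly P (inverse t) * exp (- inverse t)) has_real_derivative
        flat_fun ([:0,0,1:] * (P - pderiv P)) t) (at t)"
      using 1 by (auto intro!: derivative_eq_intros DERIV_chain2[OF poly_DERIV]
          simp: flat_fun_def algebra_simps power2_eq_square)
    then show ?thesis
      by (rule has_field_derivative_transform_within_open[where S="{0<..}"])
        (use 1 in \<open>auto simp: flat_fun_def\<close>)
  next
    case 2
    have "((\<lambda>t. 0) has_real_derivative flat_fun ([:0,0,1:] * (P - pderiv P)) t) (at t)"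
      using 2 by (auto simp: flat_fun_def)
    then show ?thesis
      by (rule has_field_derivative_transform_within_open[where S="{..<0}"])
        (use 2 in \<open>auto simp: flat_fun_def\<close>)
  qed
qed

lemma flat_fun_smooth: "Cinf_on UNIV (flat_fun P)"
  unfolding Cinf_on_def
proof
  fix k show "Ck_on k UNIV (flat_fun P)"
  proof (induction k arbitrary: P)
    case 0
    then show ?case
      using DERIV_isCont[OF flat_fun_has_derivative] by (simp add: continuous_at_imp_continuous_on)
  next
    case (Suc k)
    show ?case
    proof (rule Ck_on_SucI)
      show "(flat_fun P has_derivative (\<lambda>v. flat_fun ([:0,0,1:] * (P - pderiv P)) x * v)) (at x)" for x
        using flat_fun_has_derivative[of P x] by (simp add: has_field_derivative_def)
      show "Ck_on k UNIV (\<lambda>x. flat_fun ([:0,0,1:] * (P - pderiv P)) x * v)" for v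
        by (intro Ck_on_mult Ck_on_const Suc.IH) simp
    qed simp
  qed
qed

lemma bump_function_exists:
  fixes x0 :: "'e::euclidean_space"
  assumes "r > 0"
  obtains b :: "'e \<Rightarrow> real" where "Cinf_on UNIV b" "\<And>x. b x \<ge> 0" "\<And>x. b x > 0 \<longleftrightarrow> x \<in> ball x0 r"
proof
  \<comment> \<open>This is \<open>exp(-1/(r^2 - |x - x0|^2))\<close> inside the ball and 0 outside.
    The norm is spelled out in coordinates so that the closure rules for sums and products give
    smoothness.\<close>
  define b where "b = (\<lambda>x. flat_fun 1 (r\<^sup>2 + (\<Sum>i\<in>Basis. (-1) * ((x \<bullet> i + (- x0 \<bullet> i)) * (x \<bullet> i + (- x0 \<bullet> i))))))"
  have eq: "b x = flat_fun 1 (r\<^sup>2 - (norm (x - x0))\<^sup>2)" for x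
    unfolding b_def power2_norm_eq_inner euclidean_inner[of "x - x0" "x - x0"]
    by (simp add: 
        inner_diff_left[of x x0 "_::'e" for x x0] sum_negf)
  show "Cinf_on UNIV b" unfolding b_def
    by (intro Cinf_on_compose[OF _ _ _ flat_fun_smooth] Cinf_on_add Cinf_on_sum Cinf_on_mult
        Cinf_on_const Cinf_on_bounded_linear bounded_linear_inner_left open_UNIV subset_UNIV)
  show "b x \<ge> 0" for x unfolding eq flat_fun_def by simp
  have "r\<^sup>2 - (norm (x - x0))\<^sup>2 > 0 \<longleftrightarrow> x \<in> ball x0 r" for x
    using assms power_mono_iff[of r "norm (x - x0)" 2]
    by (auto simp: dist_norm norm_minus_commute not_le[symmetric])
  then show "b x > 0 \<longleftrightarrow> x \<in> ball x0 r" for x unfolding eq flat_fun_def by simp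
qed

section \<open>Smooth functions and tangent vectors on a manifold\<close>

abbreviation chart_inv :: "('m, 'e) chart \<Rightarrow> 'e \<Rightarrow> 'm" where
  "chart_inv c \<equiv> inv_into (fst c) (snd c)"

lemma smooth_fun_on_iff:
  "smooth_fun_on A W f \<longleftrightarrow>
     open W \<and> (\<forall>c\<in>A. Cinf_on (snd c ` (fst c \<inter> W)) (\<lambda>x. f (chart_inv c x)))"
  by (auto simp: smooth_fun_on_def o_def split_beta)

lemma smooth_fun_on_open: "smooth_fun_on A W f \<Longrightarrow> open W"
  by (simp add: smooth_fun_on_iff)

lemma smooth_nearI: "smooth_fun_on A W f \<Longrightarrow> p \<in> W \<Longrightarrow> smooth_near A p f"
  by (auto simp: smooth_near_def)

locale smooth_manifold =
  fixes A :: "('m::{t2_space, second_countable_topology}, 'e::euclidean_space) chart set"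
  assumes atlas: "smooth_atlas A"
begin

lemma atlas_facts:
  "(\<Union>c\<in>A. fst c) = UNIV"
  "\<forall>c\<in>A. open (fst c) \<and> open (snd c ` fst c) \<and>
     homeomorphism (fst c) (snd c ` fst c) (snd c) (chart_inv c)"
  "\<forall>c\<in>A. \<forall>c'\<in>A. Cinf_on (snd c ` (fst c \<inter> fst c')) (\<lambda>x. snd c' (chart_inv c x))"
  using atlas unfolding smooth_atlas_def by (simp_all add: split_beta o_def)

lemma chart_exists:
  obtains c where "c \<in> A" "p \<in> fst c"
  using atlas_facts(1) by blast

lemma chart_homeomorphism:
  "c \<in> A \<Longrightarrow> homeomorphism (fst c) (snd c ` fst c) (snd c) (chart_inv c)"
  using atlas_facts(2) by blast

lemma chart_open: "c \<in> A \<Longrightarrow> open (fst c)"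
  using atlas_facts(2) by blast

lemma chart_open_range: "c \<in> A \<Longrightarrow> open (snd c ` fst c)"
  using atlas_facts(2) by blast

lemma chart_transition:
  "c \<in> A \<Longrightarrow> c' \<in> A \<Longrightarrow> Cinf_on (snd c ` (fst c \<inter> fst c')) (\<lambda>x. snd c' (chart_inv c x))"
  using atlas_facts(3) by blast

lemma chart_inv_left: "c \<in> A \<Longrightarrow> p \<in> fst c \<Longrightarrow> chart_inv c (snd c p) = p"
  using chart_homeomorphism[of c] by (simp add: homeomorphism_def)

lemma chart_inv_right: "x \<in> snd c ` fst c \<Longrightarrow> snd c (chart_inv c x) = x"
  by (rule f_inv_into_f)

lemma chart_continuous_on: "c \<in> A \<Longrightarrow> continuous_on (fst c) (snd c)"
  using chart_homeomorphism[of c] by (simp add: homeomorphism_def)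

lemma chart_inv_continuous_on: "c \<in> A \<Longrightarrow> continuous_on (snd c ` fst c) (chart_inv c)"
  using chart_homeomorphism[of c] by (simp add: homeomorphism_def)

lemma chart_open_image:
  assumes c: "c \<in> A" and W: "open W" "W \<subseteq> fst c"
  shows "open (snd c ` W)"
proof -
  have "openin (top_of_set (snd c ` fst c)) (snd c ` W)"
    by (rule homeomorphism_imp_open_map[OF chart_homeomorphism[OF c]])
      (use W chart_open[OF c] in \<open>simp add: openin_open_eq\<close>)
  then show ?thesis using chart_open_range[OF c] openin_open_trans by blast
qed

lemma chart_open_image_Int: "c \<in> A \<Longrightarrow> open W \<Longrightarrow> open (snd c ` (fst c \<inter> W))"
  by (simp add: chart_open chart_open_image open_Int)

lemma smooth_fun_on_subset:
  assumes "smooth_fun_on A W f" "open W'" "W' \<subseteq> W"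
  shows "smooth_fun_on A W' f"
proof -
  have "snd c ` (fst c \<inter> W') \<subseteq> snd c ` (fst c \<inter> W)" for c :: "('m, 'e) chart"
    using assms(3) by blast
  note sub = Cinf_on_subset[OF _ this]
  show ?thesis unfolding smooth_fun_on_iff
    by (intro conjI ballI assms(2) sub) (use assms(1) in \<open>simp add: smooth_fun_on_iff\<close>)
qed

lemma smooth_fun_on_cong:
  assumes f: "smooth_fun_on A W f" and eq: "\<And>p. p \<in> W \<Longrightarrow> f p = h p"
  shows "smooth_fun_on A W h"
  unfolding smooth_fun_on_iff
proof (intro conjI ballI)
  show W: "open W" by (rule smooth_fun_on_open[OF f])
  fix c assume c: "c \<in> A"
  show "Cinf_on (snd c ` (fst c \<inter> W)) (\<lambda>x. h (chart_inv c x))"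
  proof (rule Cinf_on_cong[OF chart_open_image_Int[OF c W]])
    show "Cinf_on (snd c ` (fst c \<inter> W)) (\<lambda>x. f (chart_inv c x))"
      using f c by (simp add: smooth_fun_on_iff)
  qed (auto simp: chart_inv_left[OF c] eq)
qed

lemma smooth_fun_on_local:
  assumes W: "open W" and loc: "\<And>p. p \<in> W \<Longrightarrow> \<exists>W'. p \<in> W' \<and> smooth_fun_on A W' f"
  shows "smooth_fun_on A W f"
  unfolding smooth_fun_on_iff
proof (intro conjI ballI W)
  fix c assume c: "c \<in> A"
  show "Cinf_on (snd c ` (fst c \<inter> W)) (\<lambda>x. f (chart_inv c x))"
  proof (rule Cinf_on_local)
    fix x assume "x \<in> snd c ` (fst c \<inter> W)"
    then obtain p where p: "p \<in> fst c" "p \<in> W" "x = snd c p" by blast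
    from loc[OF p(2)] obtain W' where W': "p \<in> W'" "smooth_fun_on A W' f" by blast
    then show "\<exists>T. open T \<and> x \<in> T \<and> Cinf_on T (\<lambda>x. f (chart_inv c x))"
      using c p chart_open_image_Int[OF c, of W']
      by (intro exI[of _ "snd c ` (fst c \<inter> W')"]) (auto simp: smooth_fun_on_iff)
  qed
qed

lemma smooth_fun_on_const: "open W \<Longrightarrow> smooth_fun_on A W (\<lambda>p. k)"
  by (simp add: smooth_fun_on_iff Cinf_on_const)

lemma smooth_fun_on_add:
  "smooth_fun_on A W f \<Longrightarrow> smooth_fun_on A W h \<Longrightarrow> smooth_fun_on A W (\<lambda>p. f p + h p)"
  by (simp add: smooth_fun_on_iff Cinf_on_add chart_open_image_Int)

lemma smooth_fun_on_mult:
  "smooth_fun_on A W f \<Longrightarrow> smooth_fun_on A W h \<Longrightarrow> smooth_fun_on A W (\<lambda>p. f p * h p)"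
  by (simp add: smooth_fun_on_iff Cinf_on_mult chart_open_image_Int)

lemma smooth_fun_on_cmult:
  "smooth_fun_on A W f \<Longrightarrow> smooth_fun_on A W (\<lambda>p. k * f p)"
  by (intro smooth_fun_on_mult smooth_fun_on_const smooth_fun_on_open)

lemma smooth_fun_on_diff:
  "smooth_fun_on A W f \<Longrightarrow> smooth_fun_on A W h \<Longrightarrow> smooth_fun_on A W (\<lambda>p. f p - h p)"
  using smooth_fun_on_add[OF _ smooth_fun_on_cmult[of W h "-1"]] by simp

lemma smooth_fun_on_sum:
  "open W \<Longrightarrow> (\<And>i. i \<in> I \<Longrightarrow> smooth_fun_on A W (f i)) \<Longrightarrow> smooth_fun_on A W (\<lambda>p. \<Sum>i\<in>I. f i p)"
  by (simp add: smooth_fun_on_iff Cinf_on_sum chart_open_image_Int)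

lemma smooth_fun_on_prod:
  assumes "open W" "\<And>i. i \<in> I \<Longrightarrow> smooth_fun_on A W (f i)"
  shows "smooth_fun_on A W (\<lambda>p. \<Prod>i\<in>I. f i p)"
  using assms(2)
  by (induction I rule: infinite_finite_induct)
    (auto intro: smooth_fun_on_const[OF assms(1)] smooth_fun_on_mult)

lemma smooth_fun_on_in_chart:
  "smooth_fun_on A W f \<Longrightarrow> c \<in> A \<Longrightarrow> Cinf_on (snd c ` (fst c \<inter> W)) (\<lambda>x. f (chart_inv c x))"
  by (simp add: smooth_fun_on_iff)

text \<open>The smooth transition maps carry smoothness from the single chart \<open>c\<close> to
  every chart of the atlas.\<close>

lemma smooth_fun_on_chart_compose:
  assumes c: "c \<in> A" and W: "open W" "W \<subseteq> fst c" and F: "Cinf_on (snd c ` W) F"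
  shows "smooth_fun_on A W (\<lambda>p. F (snd c p))"
  unfolding smooth_fun_on_iff
proof (intro conjI ballI W)
  fix c' assume c': "c' \<in> A"
  show "Cinf_on (snd c' ` (fst c' \<inter> W)) (\<lambda>x. F (snd c (chart_inv c' x)))"
  proof (rule Cinf_on_compose[OF chart_open_image_Int[OF c' W(1)] _ _ F])
    have "snd c' ` (fst c' \<inter> W) \<subseteq> snd c' ` (fst c' \<inter> fst c)" using W(2) by blast
    then show "Cinf_on (snd c' ` (fst c' \<inter> W)) (\<lambda>x. snd c (chart_inv c' x))"
      by (rule Cinf_on_subset[OF chart_transition[OF c' c]])
  qed (auto simp: chart_inv_left[OF c'])
qed

lemma smooth_fun_on_coordinate:
  "c \<in> A \<Longrightarrow> smooth_fun_on A (fst c) (\<lambda>q. snd c q \<bullet> b)"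
  by (rule smooth_fun_on_chart_compose[where F="\<lambda>x. x \<bullet> b"])
    (auto simp: chart_open chart_open_range Cinf_on_bounded_linear bounded_linear_inner_left)

lemma smooth_fun_on_continuous_on:
  assumes f: "smooth_fun_on A W f"
  shows "continuous_on W f"
proof -
  have "isCont f p" if p: "p \<in> W" for p
  proof -
    obtain c where c: "c \<in> A" "p \<in> fst c" by (rule chart_exists)
    have op: "open (fst c \<inter> W)" using chart_open[OF c(1)] smooth_fun_on_open[OF f] by blast
    have "continuous_on (fst c \<inter> W) (\<lambda>q. f (chart_inv c (snd c q)))"
      by (rule continuous_on_compose2[OF Cinf_on_continuous_on[OF smooth_fun_on_in_chart[OF f c(1)]]])
        (auto intro: continuous_on_subset[OF chart_continuous_on[OF c(1)]])
    then have "continuous_on (fst c \<inter> W) f"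
      by (rule continuous_on_eq) (simp add: chart_inv_left[OF c(1)])
    then show ?thesis using op p c(2) continuous_on_eq_continuous_at by blast
  qed
  then show ?thesis by (simp add: continuous_at_imp_continuous_on)
qed

lemma smooth_near_common:
  assumes "smooth_near A p f" "smooth_near A p h"
  obtains W where "p \<in> W" "smooth_fun_on A W f" "smooth_fun_on A W h"
proof -
  from assms obtain V W where "p \<in> V" "smooth_fun_on A V f" "p \<in> W" "smooth_fun_on A W h"
    by (auto simp: smooth_near_def)
  then show ?thesis
    by (intro that[of "V \<inter> W"]) (auto intro: smooth_fun_on_subset simp: smooth_fun_on_open open_Int)
qed

lemma smooth_near_cong:
  assumes "open W" "p \<in> W" "\<And>q. q \<in> W \<Longrightarrow> f q = h q" "smooth_near A p f"
  shows "smooth_near A p h"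
proof -
  from assms(4) obtain V where V: "p \<in> V" "smooth_fun_on A V f" by (auto simp: smooth_near_def)
  then have "smooth_fun_on A (V \<inter> W) f"
    using assms(1) by (auto intro: smooth_fun_on_subset simp: smooth_fun_on_open open_Int)
  then have "smooth_fun_on A (V \<inter> W) h" by (rule smooth_fun_on_cong) (use assms(3) in auto)
  then show ?thesis using V assms(2) by (auto intro: smooth_nearI)
qed

lemma smooth_near_add: "smooth_near A p f \<Longrightarrow> smooth_near A p h \<Longrightarrow> smooth_near A p (\<lambda>q. f q + h q)"
  by (erule smooth_near_common, assumption) (blast intro: smooth_nearI smooth_fun_on_add)

lemma smooth_near_mult: "smooth_near A p f \<Longrightarrow> smooth_near A p h \<Longrightarrow> smooth_near A p (\<lambda>q. f q * h q)"
  by (erule smooth_near_common, assumption) (blast intro: smooth_nearI smooth_fun_on_mult)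

lemma smooth_near_const: "smooth_near A p (\<lambda>q. k)"
  using smooth_nearI[OF smooth_fun_on_const[OF open_UNIV]] by blast

lemma smooth_near_sum:
  "(\<And>i. i \<in> I \<Longrightarrow> smooth_near A p (f i)) \<Longrightarrow> smooth_near A p (\<lambda>q. \<Sum>i\<in>I. f i q)"
  by (induction I rule: infinite_finite_induct) (auto intro: smooth_near_const smooth_near_add)

lemma smooth_near_prod:
  "(\<And>i. i \<in> I \<Longrightarrow> smooth_near A p (f i)) \<Longrightarrow> smooth_near A p (\<lambda>q. \<Prod>i\<in>I. f i q)"
  by (induction I rule: infinite_finite_induct) (auto intro: smooth_near_const smooth_near_mult)

section \<open>Tangent vectors as derivations on germs\<close>

lemma chart_has_derivative:
  assumes "c \<in> A" "p \<in> fst c" "smooth_near A p f"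
  shows "((f \<circ> chart_inv c) has_derivative frechet_derivative (f \<circ> chart_inv c) (at (snd c p)))
    (at (snd c p))"
proof -
  from assms(3) obtain W where W: "p \<in> W" "smooth_fun_on A W f" by (auto simp: smooth_near_def)
  have "Cinf_on (snd c ` (fst c \<inter> W)) (f \<circ> chart_inv c)"
    using smooth_fun_on_in_chart[OF W(2) assms(1)] by (simp add: o_def)
  then show ?thesis by (rule Cinf_on_has_derivative) (use W assms in auto)
qed

lemma coord_vec_eqI:
  assumes "c \<in> A" "p \<in> fst c" "smooth_near A p f"
    and "((f \<circ> chart_inv c) has_derivative f') (at (snd c p))"
  shows "coord_vec A c \<xi> p f = f' \<xi>"
  using assms(3) frechet_derivative_at[OF assms(4)] by (simp add: coord_vec_def)

text \<open>The chain rule for the transition map. \<open>tangent_space\<close> collects the vectors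
  of all charts at \<open>p\<close>; this shows that one chart already yields all of them, so that
  they can be added.\<close>

lemma coord_vec_change_chart:
  assumes c: "c \<in> A" "p \<in> fst c" and c': "c' \<in> A" "p \<in> fst c'"
  shows "coord_vec A c \<xi> p =
    coord_vec A c' (frechet_derivative (\<lambda>x. snd c' (chart_inv c x)) (at (snd c p)) \<xi>) p"
proof
  fix f
  show "coord_vec A c \<xi> p f =
    coord_vec A c' (frechet_derivative (\<lambda>x. snd c' (chart_inv c x)) (at (snd c p)) \<xi>) p f"
  proof (cases "smooth_near A p f")
    case True
    let ?t = "\<lambda>x. snd c' (chart_inv c x)"
    have t: "(?t has_derivative frechet_derivative ?t (at (snd c p))) (at (snd c p))"
      using c c' by (intro Cinf_on_has_derivative[OF chart_transition]) auto
    have tp: "?t (snd c p) = snd c' p" using c by (simp add: chart_inv_left)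
    have "((f \<circ> chart_inv c' \<circ> ?t) has_derivative
        frechet_derivative (f \<circ> chart_inv c') (at (snd c' p)) \<circ> frechet_derivative ?t (at (snd c p)))
        (at (snd c p))"
      by (rule diff_chain_at[OF t]) (use chart_has_derivative[OF c' True] tp in simp)
    then have "((f \<circ> chart_inv c) has_derivative
        frechet_derivative (f \<circ> chart_inv c') (at (snd c' p)) \<circ> frechet_derivative ?t (at (snd c p)))
        (at (snd c p))"
      by (rule has_derivative_transform_within_open[OF _
            chart_open_image_Int[OF c(1) chart_open[OF c'(1)]]])
        (use c c' in \<open>auto simp: chart_inv_left\<close>)
    from coord_vec_eqI[OF c True this] True show ?thesis by (simp add: coord_vec_def)
  qed (simp add: coord_vec_def)
qed

lemma tangent_space_chart:
  assumes "c \<in> A" "p \<in> fst c"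
  shows "tangent_space A p = range (\<lambda>\<xi>. coord_vec A c \<xi> p)"
  unfolding tangent_space_def using assms coord_vec_change_chart by blast

lemma tangent_space_chartE:
  assumes "u \<in> tangent_space A p" "c \<in> A" "p \<in> fst c"
  obtains \<xi> where "u = coord_vec A c \<xi> p"
  using assms tangent_space_chart by blast

lemma coord_vec_in_tangent_space: "c \<in> A \<Longrightarrow> p \<in> fst c \<Longrightarrow> coord_vec A c \<xi> p \<in> tangent_space A p"
  using tangent_space_chart by blast

lemma coord_vec_linear:
  assumes "c \<in> A" "p \<in> fst c"
  shows "coord_vec A c (a *\<^sub>R \<xi> + b *\<^sub>R \<eta>) p = (\<lambda>f. a * coord_vec A c \<xi> p f + b * coord_vec A c \<eta> p f)"
proof
  fix f
  show "coord_vec A c (a *\<^sub>R \<xi> + b *\<^sub>R \<eta>) p f = a * coord_vec A c \<xi> p f + b * coord_vec A c \<eta> p f"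
    using has_derivative_linear[OF chart_has_derivative[OF assms, of f]]
    by (auto simp: coord_vec_def linear_add linear_scale)
qed

lemma tangent_space_lincomb:
  assumes "u \<in> tangent_space A p" "v \<in> tangent_space A p"
  shows "(\<lambda>f. a * u f + b * v f) \<in> tangent_space A p"
proof -
  obtain c where c: "c \<in> A" "p \<in> fst c" by (rule chart_exists)
  obtain \<xi> \<eta> where "u = coord_vec A c \<xi> p" "v = coord_vec A c \<eta> p"
    using assms c by (metis tangent_space_chartE)
  then show ?thesis
    using coord_vec_linear[OF c, of a \<xi> b \<eta>] coord_vec_in_tangent_space[OF c] by metis
qed

lemma tangent_space_zero: "(\<lambda>f. 0) \<in> tangent_space A p"
proof -
  obtain c where c: "c \<in> A" "p \<in> fst c" by (rule chart_exists)
  show ?thesis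
    using tangent_space_lincomb[OF coord_vec_in_tangent_space[OF c] coord_vec_in_tangent_space[OF c],
        of 0 _ 0] by simp
qed

lemma tangent_space_sum:
  assumes "\<And>i. i \<in> I \<Longrightarrow> u i \<in> tangent_space A p"
  shows "(\<lambda>f. \<Sum>i\<in>I. a i * u i f) \<in> tangent_space A p"
  using assms
proof (induction I rule: infinite_finite_induct)
  case (insert i I)
  then show ?case using tangent_space_lincomb[of "u i" p _ "a i" 1] by simp
qed (simp_all add: tangent_space_zero)

text \<open>Smoothness near \<open>p\<close> depends only on the germ as well, so if one function is
  not smooth there, neither is the other, and both values are the default 0.\<close>

lemma tangent_vector_cong:
  assumes "u \<in> tangent_space A p" "open W" "p \<in> W" "\<And>q. q \<in> W \<Longrightarrow> f q = h q"
  shows "u f = u h"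
proof (cases "smooth_near A p f")
  case True
  obtain c where c: "c \<in> A" "p \<in> fst c" by (rule chart_exists)
  obtain \<xi> where u: "u = coord_vec A c \<xi> p" using assms c by (metis tangent_space_chartE)
  have h: "smooth_near A p h" using smooth_near_cong[OF assms(2-4) True] .
  have "((h \<circ> chart_inv c) has_derivative frechet_derivative (f \<circ> chart_inv c) (at (snd c p)))
      (at (snd c p))"
    by (rule has_derivative_transform_within_open[OF chart_has_derivative[OF c True]
          chart_open_image_Int[OF c(1) assms(2)]])
      (use c assms(3,4) in \<open>auto simp: chart_inv_left\<close>)
  from coord_vec_eqI[OF c h this] True show ?thesis by (simp add: u coord_vec_def)
next
  case False
  then have "\<not> smooth_near A p h" using smooth_near_cong[OF assms(2,3), of h f] assms(4) by auto
  then show ?thesis using False assms(1) by (auto simp: tangent_space_def coord_vec_def)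
qed

lemma tangent_vector_add:
  assumes "u \<in> tangent_space A p" "smooth_near A p f" "smooth_near A p h"
  shows "u (\<lambda>q. f q + h q) = u f + u h"
proof -
  obtain c where c: "c \<in> A" "p \<in> fst c" by (rule chart_exists)
  obtain \<xi> where u: "u = coord_vec A c \<xi> p" using assms c by (metis tangent_space_chartE)
  show ?thesis
    using coord_vec_eqI[OF c smooth_near_add[OF assms(2,3)]]
      has_derivative_add[OF chart_has_derivative[OF c assms(2)] chart_has_derivative[OF c assms(3)]]
      assms by (simp add: u coord_vec_def o_def)
qed

lemma tangent_vector_mult:
  assumes "u \<in> tangent_space A p" "smooth_near A p f" "smooth_near A p h"
  shows "u (\<lambda>q. f q * h q) = f p * u h + u f * h p"
proof -
  obtain c where c: "c \<in> A" "p \<in> fst c" by (rule chart_exists)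
  obtain \<xi> where u: "u = coord_vec A c \<xi> p" using assms c by (metis tangent_space_chartE)
  show ?thesis
    using coord_vec_eqI[OF c smooth_near_mult[OF assms(2,3)]]
      has_derivative_mult[OF chart_has_derivative[OF c assms(2)] chart_has_derivative[OF c assms(3)]]
      assms c by (simp add: u coord_vec_def o_def chart_inv_left)
qed

lemma tangent_vector_const:
  assumes "u \<in> tangent_space A p"
  shows "u (\<lambda>q. k) = 0"
  using assms by (auto simp: tangent_space_def coord_vec_def o_def)

lemma tangent_vector_cmult:
  assumes "u \<in> tangent_space A p" "smooth_near A p f"
  shows "u (\<lambda>q. k * f q) = k * u f"
  using tangent_vector_mult[OF assms(1) smooth_near_const assms(2)] tangent_vector_const[OF assms(1)]
  by simp

lemma tangent_vector_diff:
  assumes "u \<in> tangent_space A p" "smooth_near A p f" "smooth_near A p h"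
  shows "u (\<lambda>q. f q - h q) = u f - u h"
  using tangent_vector_add[OF assms(1,2) smooth_near_mult[OF smooth_near_const assms(3), of "-1"]]
    tangent_vector_cmult[OF assms(1,3), of "-1"] by simp

lemma tangent_vector_sum:
  assumes "u \<in> tangent_space A p" "\<And>i. i \<in> I \<Longrightarrow> smooth_near A p (f i)"
  shows "u (\<lambda>q. \<Sum>i\<in>I. f i q) = (\<Sum>i\<in>I. u (f i))"
  using assms(2)
  by (induction I rule: infinite_finite_induct)
    (auto simp: tangent_vector_const[OF assms(1)] tangent_vector_add[OF assms(1)] smooth_near_sum)

text \<open>Meant for the \<open>n\<close> factors of \<open>(d\<theta>)^n\<close>.\<close>

lemma tangent_vector_prod:
  assumes "u \<in> tangent_space A p" "finite I" "\<And>i. i \<in> I \<Longrightarrow> smooth_near A p (f i)"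
  shows "u (\<lambda>q. \<Prod>i\<in>I. f i q) = (\<Sum>i\<in>I. u (f i) * (\<Prod>j\<in>I - {i}. f j p))"
  using assms(2,3)
proof (induction I rule: finite_induct)
  case empty
  then show ?case by (simp add: tangent_vector_const[OF assms(1)])
next
  case (insert k I)
  have "(\<Prod>j\<in>insert k I - {i}. f j p) = f k p * (\<Prod>j\<in>I - {i}. f j p)" if "i \<in> I" for i
  proof -
    have "insert k I - {i} = insert k (I - {i})" using that insert.hyps by auto
    then show ?thesis using insert.hyps by simp
  qed
  moreover have "insert k I - {k} = I" using insert.hyps by auto
  ultimately show ?case using insert
    by (simp add: tangent_vector_mult[OF assms(1)] smooth_near_prod sum_distrib_left mult.commute
        mult.left_commute)
qed

lemma coord_vec_coordinate:
  assumes c: "c \<in> A" "p \<in> fst c"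
  shows "coord_vec A c \<xi> p (\<lambda>q. snd c q \<bullet> b) = \<xi> \<bullet> b"
proof (rule coord_vec_eqI[OF c, where f'="\<lambda>\<xi>. \<xi> \<bullet> b"])
  show "smooth_near A p (\<lambda>q. snd c q \<bullet> b)"
    using smooth_nearI[OF smooth_fun_on_coordinate[OF c(1)] c(2)] .
  have "((\<lambda>x. x \<bullet> b) has_derivative (\<lambda>\<xi>. \<xi> \<bullet> b)) (at (snd c p))"
    by (rule bounded_linear_imp_has_derivative[OF bounded_linear_inner_left])
  then show "((\<lambda>q. snd c q \<bullet> b) \<circ> chart_inv c has_derivative (\<lambda>\<xi>. \<xi> \<bullet> b)) (at (snd c p))"
    by (rule has_derivative_transform_within_open[OF _ chart_open_range[OF c(1)]])
      (use c in \<open>auto simp: chart_inv_right\<close>)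
qed

lemma coord_vec_zero: "c \<in> A \<Longrightarrow> p \<in> fst c \<Longrightarrow> coord_vec A c 0 p = (\<lambda>f. 0)"
  using coord_vec_linear[of c p 0 0 0 0] by simp

lemma coord_vec_sum:
  assumes c: "c \<in> A" "p \<in> fst c"
  shows "coord_vec A c (\<Sum>i\<in>I. a i *\<^sub>R \<xi> i) p = (\<lambda>f. \<Sum>i\<in>I. a i * coord_vec A c (\<xi> i) p f)"
proof (induction I rule: infinite_finite_induct)
  case (insert i I)
  then show ?case using coord_vec_linear[OF c, of "a i" "\<xi> i" 1] by simp
qed (simp_all add: coord_vec_zero[OF c])

lemma tangent_vector_expansion:
  assumes "u \<in> tangent_space A p" "c \<in> A" "p \<in> fst c"
  shows "u = (\<lambda>f. \<Sum>b\<in>Basis. u (\<lambda>q. snd c q \<bullet> b) * coord_vec A c b p f)"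
proof -
  obtain \<xi> where u: "u = coord_vec A c \<xi> p" using assms by (metis tangent_space_chartE)
  have "u = coord_vec A c (\<Sum>b\<in>Basis. (\<xi> \<bullet> b) *\<^sub>R b) p" by (simp add: u euclidean_representation)
  also have "\<dots> = (\<lambda>f. \<Sum>b\<in>Basis. (\<xi> \<bullet> b) * coord_vec A c b p f)"
    by (rule coord_vec_sum[OF assms(2,3)])
  finally have "u = (\<lambda>f. \<Sum>b\<in>Basis. (\<xi> \<bullet> b) * coord_vec A c b p f)" .
  moreover have "u (\<lambda>q. snd c q \<bullet> b) = \<xi> \<bullet> b" for b
    unfolding u by (rule coord_vec_coordinate[OF assms(2,3)])
  ultimately show ?thesis by presburger
qed

section \<open>Smooth vector fields and their brackets\<close>

lemma coord_vec_smooth: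
  assumes c: "c \<in> A"
  shows "smooth_vfield_on A (fst c) (coord_vec A c \<xi>)"
  unfolding smooth_vfield_on_def
proof (intro conjI ballI allI impI)
  show "open (fst c)" by (rule chart_open[OF c])
  show "coord_vec A c \<xi> p \<in> tangent_space A p" if "p \<in> fst c" for p
    using coord_vec_in_tangent_space[OF c that] .
  fix V f assume "V \<subseteq> fst c \<and> smooth_fun_on A V f"
  then have V: "V \<subseteq> fst c" and f: "smooth_fun_on A V f" by auto
  have eq: "fst c \<inter> V = V" using V by auto
  have "smooth_fun_on A V (\<lambda>p. (\<lambda>x. frechet_derivative (f \<circ> chart_inv c) (at x) \<xi>) (snd c p))"
    by (rule smooth_fun_on_chart_compose[OF c smooth_fun_on_open[OF f] V])
      (use Cinf_on_frechet_derivative[OF smooth_fun_on_in_chart[OF f c]] eq in \<open>simp add: o_def\<close>)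
  then show "smooth_fun_on A V (\<lambda>p. coord_vec A c \<xi> p f)"
    by (rule smooth_fun_on_cong) (use smooth_nearI[OF f] in \<open>simp add: coord_vec_def\<close>)
qed

lemma smooth_vfield_on_subset:
  "smooth_vfield_on A U X \<Longrightarrow> open W \<Longrightarrow> W \<subseteq> U \<Longrightarrow> smooth_vfield_on A W X"
  unfolding smooth_vfield_on_def by (meson subset_iff subset_trans)

lemma smooth_vfield_apply:
  "smooth_vfield_on A U X \<Longrightarrow> smooth_fun_on A W f \<Longrightarrow> W \<subseteq> U \<Longrightarrow> smooth_fun_on A W (\<lambda>p. X p f)"
  unfolding smooth_vfield_on_def by blast

lemma smooth_vfield_tangent: "smooth_vfield_on A U X \<Longrightarrow> p \<in> U \<Longrightarrow> X p \<in> tangent_space A p"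
  unfolding smooth_vfield_on_def by blast

lemma smooth_vfield_apply_near:
  assumes X: "smooth_vfield_on A U X" and "p \<in> U" and f: "smooth_near A p f"
  shows "smooth_near A p (\<lambda>q. X q f)"
proof -
  from f obtain W where W: "p \<in> W" "smooth_fun_on A W f" by (auto simp: smooth_near_def)
  have "open U" using X by (simp add: smooth_vfield_on_def)
  then have "smooth_fun_on A (W \<inter> U) f"
    using W by (auto intro: smooth_fun_on_subset simp: smooth_fun_on_open open_Int)
  from smooth_vfield_apply[OF X this] show ?thesis using W assms(2) by (auto intro: smooth_nearI)
qed

text \<open>Tangency of the bracket is a premise, because in the intended use the structure
  equations exhibit the bracket as a combination of frame fields.\<close>

lemma lie_bracket_smooth:
  assumes X: "smooth_vfield_on A U X" and Y: "smooth_vfield_on A U Y"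
    and T: "\<And>p. p \<in> U \<Longrightarrow> lie_bracket A X Y p \<in> tangent_space A p"
  shows "smooth_vfield_on A U (lie_bracket A X Y)"
  unfolding smooth_vfield_on_def
proof (intro conjI ballI allI impI T)
  show "open U" using X by (simp add: smooth_vfield_on_def)
  fix V f assume *: "V \<subseteq> U \<and> smooth_fun_on A V f"
  then have V: "V \<subseteq> U" and f: "smooth_fun_on A V f" by auto
  have "smooth_fun_on A V (\<lambda>p. X p (vapp Y f) - Y p (vapp X f))"
    unfolding vapp_def
    by (intro smooth_fun_on_diff smooth_vfield_apply[OF X smooth_vfield_apply[OF Y f V] V]
        smooth_vfield_apply[OF Y smooth_vfield_apply[OF X f V] V])
  then show "smooth_fun_on A V (\<lambda>p. lie_bracket A X Y p f)"
    by (rule smooth_fun_on_cong) (simp add: lie_bracket_def smooth_nearI[OF f])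
qed

section \<open>Linear forms on tangent spaces\<close>

lemma linear_on_tangentD:
  assumes "linear_on_tangent A p \<alpha>" "u \<in> tangent_space A p" "v \<in> tangent_space A p"
  shows "\<alpha> (\<lambda>f. a * u f + b * v f) = a * \<alpha> u + b * \<alpha> v"
  using assms unfolding linear_on_tangent_def by blast

lemma linear_on_tangent_zero:
  assumes "linear_on_tangent A p \<alpha>"
  shows "\<alpha> (\<lambda>f. 0) = 0"
proof -
  show ?thesis
    using linear_on_tangentD[OF assms tangent_space_zero tangent_space_zero, of 0 0] by simp
qed

lemma linear_on_tangent_sum:
  assumes "linear_on_tangent A p \<alpha>" "\<And>i. i \<in> I \<Longrightarrow> u i \<in> tangent_space A p"
  shows "\<alpha> (\<lambda>f. \<Sum>i\<in>I. a i * u i f) = (\<Sum>i\<in>I. a i * \<alpha> (u i))"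
  using assms(2)
proof (induction I rule: infinite_finite_induct)
  case (insert i I)
  have "\<alpha> (\<lambda>f. a i * u i f + 1 * (\<Sum>i\<in>I. a i * u i f))
      = a i * \<alpha> (u i) + 1 * \<alpha> (\<lambda>f. \<Sum>i\<in>I. a i * u i f)"
    by (rule linear_on_tangentD[OF assms(1)]) (auto intro: insert.prems tangent_space_sum)
  then show ?case using insert by simp
qed (simp_all add: linear_on_tangent_zero[OF assms(1)])

text \<open>The map \<open>\<xi> \<mapsto> \<Sum>\<^sub>b g(\<partial>\<^sub>\<xi>, \<partial>\<^sub>b) b\<close> on the coordinate space is injective, hence surjective.\<close>

lemma riesz_representation:
  assumes g: "riemannian_metric A g" and l: "linear_on_tangent A p l"
  obtains v where "v \<in> tangent_space A p" "\<And>u. u \<in> tangent_space A p \<Longrightarrow> g p v u = l u"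
proof -
  obtain c where c: "c \<in> A" "p \<in> fst c" by (rule chart_exists)
  let ?d = "\<lambda>\<xi>. coord_vec A c \<xi> p"
  have d: "?d \<xi> \<in> tangent_space A p" for \<xi> using coord_vec_in_tangent_space[OF c] .
  have lin: "linear_on_tangent A p (g p u)" if "u \<in> tangent_space A p" for u
    using g that by (auto simp: riemannian_metric_def)
  have sym: "g p u v = g p v u" if "u \<in> tangent_space A p" "v \<in> tangent_space A p" for u v
    using g that by (auto simp: riemannian_metric_def)
  have pos: "0 < g p u u" if "u \<in> tangent_space A p" "u \<noteq> (\<lambda>f. 0)" for u
    using g that by (simp add: riemannian_metric_def)
  define T where "T = (\<lambda>\<xi>. \<Sum>b\<in>Basis. g p (?d \<xi>) (?d b) *\<^sub>R b)"
  have gl: "g p (?d (a *\<^sub>R \<xi> + b *\<^sub>R \<eta>)) (?d \<zeta>) = a * g p (?d \<xi>) (?d \<zeta>) + b * g p (?d \<eta>) (?d \<zeta>)"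
    for a b \<xi> \<eta> \<zeta>
  proof -
    have "g p (?d \<zeta>) (\<lambda>f. a * ?d \<xi> f + b * ?d \<eta> f) = a * g p (?d \<zeta>) (?d \<xi>) + b * g p (?d \<zeta>) (?d \<eta>)"
      by (rule linear_on_tangentD[OF lin[OF d] d d])
    then show ?thesis
      unfolding coord_vec_linear[OF c, symmetric] by (simp only: sym[OF d d, of \<zeta>])
  qed
  have "linear T"
  proof (rule linearI)
    show "T (x + y) = T x + T y" for x y
      using gl[of 1 x 1 y] by (simp add: T_def scaleR_add_left sum.distrib)
    show "T (a *\<^sub>R x) = a *\<^sub>R T x" for a x
      using gl[of a x 0 0] by (simp add: T_def scaleR_sum_right)
  qed
  have Tb: "T \<xi> \<bullet> b = g p (?d \<xi>) (?d b)" if "b \<in> Basis" for \<xi> b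
    using that by (simp add: T_def inner_sum_left inner_Basis if_distrib cong: if_cong)
  have exp: "\<alpha> (?d \<eta>) = (\<Sum>b\<in>Basis. (\<eta> \<bullet> b) * \<alpha> (?d b))" if "linear_on_tangent A p \<alpha>" for \<alpha> \<eta>
  proof -
    have "?d \<eta> = (\<lambda>f. \<Sum>b\<in>Basis. (\<eta> \<bullet> b) * ?d b f)"
      using coord_vec_sum[OF c, of "\<lambda>b. \<eta> \<bullet> b" "\<lambda>b. b" Basis] by (simp add: euclidean_representation)
    then have "\<alpha> (?d \<eta>) = \<alpha> (\<lambda>f. \<Sum>b\<in>Basis. (\<eta> \<bullet> b) * ?d b f)"
      by (rule arg_cong)
    also have "\<dots> = (\<Sum>b\<in>Basis. (\<eta> \<bullet> b) * \<alpha> (?d b))"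
      by (rule linear_on_tangent_sum[OF that d])
    finally show ?thesis .
  qed
  have "inj T"
  proof (rule linear_injective_0[THEN iffD2, OF \<open>linear T\<close>, rule_format])
    fix \<xi> assume "T \<xi> = 0"
    then have "g p (?d \<xi>) (?d b) = 0" if "b \<in> Basis" for b using Tb[OF that, of \<xi>] by simp
    then have "(\<Sum>b\<in>Basis. (\<xi> \<bullet> b) * g p (?d \<xi>) (?d b)) = 0" by simp
    then have "g p (?d \<xi>) (?d \<xi>) = 0" by (rule trans[OF exp[OF lin[OF d]]])
    then have "?d \<xi> = (\<lambda>f. 0)" using pos[OF d[of \<xi>]] by (metis less_irrefl)
    then have "\<xi> \<bullet> b = 0" for b using coord_vec_coordinate[OF c, of \<xi> b] by simp
    then show "\<xi> = 0" by (metis inner_eq_zero_iff)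
  qed
  then have "surj T" using linear_injective_imp_surjective \<open>linear T\<close> by blast
  then obtain \<xi> where \<xi>: "T \<xi> = (\<Sum>b\<in>Basis. l (?d b) *\<^sub>R b)" by (metis surjD)
  have gb: "g p (?d \<xi>) (?d b) = l (?d b)" if "b \<in> Basis" for b
    using Tb[OF that, of \<xi>] that
    by (simp add: \<xi> inner_sum_left inner_Basis if_distrib cong: if_cong)
  show ?thesis
  proof (rule that[OF d])
    fix u assume "u \<in> tangent_space A p"
    then obtain \<eta> where u: "u = ?d \<eta>" using c by (metis tangent_space_chartE)
    show "g p (?d \<xi>) u = l u"
      unfolding u by (rule trans[OF exp[OF lin[OF d]] trans[OF _ exp[OF l, symmetric]]])
        (simp add: gb)
  qed
qed

end

section \<open>The alternating form \<open>\<theta> \<and> (d\<theta>)\<^sup>n\<close>\<close>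

definition contact_term ::
    "nat \<Rightarrow> ('v \<Rightarrow> real) \<Rightarrow> ('v \<Rightarrow> 'v \<Rightarrow> real) \<Rightarrow> (nat \<Rightarrow> 'v) \<Rightarrow> real" where
  "contact_term n t B v = t (v 0) * (\<Prod>k = 1..n. B (v (2 * k - 1)) (v (2 * k)))"

text \<open>This is \<open>2^n\<close> times the wedge product \<open>t \<and> B^n\<close>. The type
  of the slots stays abstract, so that they can be filled with tangent vectors or with mere
  indices.\<close>

definition contact_alt ::
    "nat \<Rightarrow> ('v \<Rightarrow> real) \<Rightarrow> ('v \<Rightarrow> 'v \<Rightarrow> real) \<Rightarrow> (nat \<Rightarrow> 'v) \<Rightarrow> real" where
  "contact_alt n t B v =
     (\<Sum>\<sigma> | \<sigma> permutes {0..2 * n}. of_int (sign \<sigma>) * contact_term n t B (v \<circ> \<sigma>))"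

lemma contact_term_cong:
  assumes "\<And>i. i \<in> {0..2 * n} \<Longrightarrow> v i = w i"
  shows "contact_term n t B v = contact_term n t B w"
  unfolding contact_term_def using assms by (intro arg_cong2[where f="(*)"] prod.cong) auto

lemma contact_alt_cong:
  assumes "\<And>i. i \<in> {0..2 * n} \<Longrightarrow> v i = w i"
  shows "contact_alt n t B v = contact_alt n t B w"
  unfolding contact_alt_def
proof (intro sum.cong refl arg_cong2[where f="(*)"] contact_term_cong)
  fix \<sigma> i assume "\<sigma> \<in> {\<sigma>. \<sigma> permutes {0..2 * n}}" "i \<in> {0..2 * n}"
  then have "\<sigma> i \<in> {0..2 * n}" by (metis mem_Collect_eq permutes_in_image)
  then show "(v \<circ> \<sigma>) i = (w \<circ> \<sigma>) i" by (simp add: assms)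
qed

text \<open>The sum over all \<open>\<sigma>\<close> is reindexed by
  \<open>\<tau> \<circ> \<sigma>\<close>, and the sign is multiplicative.\<close>

lemma contact_alt_permute:
  assumes \<tau>: "\<tau> permutes {0..2 * n}"
  shows "contact_alt n t B (v \<circ> \<tau>) = of_int (sign \<tau>) * contact_alt n t B v"
proof -
  have perm: "permutation \<sigma>" if "\<sigma> permutes {0..2 * n}" for \<sigma>
    using that finite_atLeastAtMost by (meson permutation_permutes)
  have sq: "(of_int (sign \<tau>) :: real) * of_int (sign \<tau>) = 1"
    by (simp add: sign_def)
  have "contact_alt n t B v = (\<Sum>\<sigma> | \<sigma> permutes {0..2 * n}.
      of_int (sign (\<tau> \<circ> \<sigma>)) * contact_term n t B (v \<circ> (\<tau> \<circ> \<sigma>)))"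
    unfolding contact_alt_def by (rule setum_permutations_compose_left[OF \<tau>])
  also have "\<dots> = of_int (sign \<tau>) * contact_alt n t B (v \<circ> \<tau>)"
    unfolding contact_alt_def sum_distrib_left
    by (intro sum.cong refl) (simp add: sign_compose perm \<tau> o_assoc)
  finally show ?thesis using sq by (simp add: mult.assoc[symmetric])
qed

text \<open>Transposing \<open>a\<close> and \<open>b\<close> leaves \<open>v\<close> unchanged but
  flips the sign.\<close>

lemma contact_alt_repeated:
  assumes "a \<in> {0..2 * n}" "b \<in> {0..2 * n}" "a \<noteq> b" "v a = v b"
  shows "contact_alt n t B v = 0"
proof -
  have "v \<circ> Transposition.transpose a b = v" using assms(4) by (auto simp: Transposition.transpose_def)
  moreover have "contact_alt n t B (v \<circ> Transposition.transpose a b) = - contact_alt n t B v"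
    using contact_alt_permute[OF permutes_swap_id[OF assms(1,2)], of t B v] assms(3)
    by (simp add: sign_swap_id)
  ultimately show ?thesis by simp
qed

lemma contact_slot_cases:
  fixes q :: nat
  assumes "q \<in> {0..2 * n}"
  obtains "q = 0" | k where "k \<in> {1..n}" "q = 2 * k - 1" | k where "k \<in> {1..n}" "q = 2 * k"
proof (cases "q = 0")
  case False
  show thesis
  proof (cases "even q")
    case True
    then obtain k where "q = 2 * k" by blast
    then show thesis using that(3)[of k] assms False by auto
  next
    case odd: False
    then obtain k where "q = 2 * k + 1" using oddE by blast
    then show thesis using that(2)[of "Suc k"] assms by auto
  qed
qed (use that in blast)

text \<open>Each slot enters exactly one factor of the term: slot 0 the factor \<open>t\<close>,
  slots \<open>2 * k - 1\<close> and \<open>2 * k\<close> the \<open>k\<close>-th factor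
  \<open>B\<close>. The three update lemmas isolate that factor, which gives linearity in each
  slot.\<close>

lemma contact_term_update_0: "contact_term n t B (v(0 := x)) = t x * (\<Prod>k = 1..n. B (v (2 * k - 1)) (v (2 * k)))"
  unfolding contact_term_def by (auto intro!: arg_cong2[where f="(*)"] prod.cong)

lemma contact_term_update_odd:
  assumes k: "k \<in> {1..n}"
  shows "contact_term n t B (v(2 * k - 1 := x)) =
    t (v 0) * (B x (v (2 * k)) * (\<Prod>j\<in>{1..n} - {k}. B (v (2 * j - 1)) (v (2 * j))))"
proof -
  have "(\<Prod>j\<in>{1..n} - {k}. B ((v(2 * k - 1 := x)) (2 * j - 1)) ((v(2 * k - 1 := x)) (2 * j)))
      = (\<Prod>j\<in>{1..n} - {k}. B (v (2 * j - 1)) (v (2 * j)))"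
  proof (rule prod.cong[OF refl])
    fix j assume j: "j \<in> {1..n} - {k}"
    then have "2 * j - 1 \<noteq> 2 * k - 1 \<and> 2 * j \<noteq> 2 * k - 1"
      using k unfolding Diff_iff atLeastAtMost_iff singleton_iff by presburger
    then show "B ((v(2 * k - 1 := x)) (2 * j - 1)) ((v(2 * k - 1 := x)) (2 * j)) = B (v (2 * j - 1)) (v (2 * j))"
      by simp
  qed
  moreover have "2 * k \<noteq> 2 * k - 1" "0 \<noteq> 2 * k - 1" using k by auto
  ultimately show ?thesis
    unfolding contact_term_def using k by (subst prod.remove[OF _ k]) auto
qed

lemma contact_term_update_even:
  assumes k: "k \<in> {1..n}"
  shows "contact_term n t B (v(2 * k := x)) =
    t (v 0) * (B (v (2 * k - 1)) x * (\<Prod>j\<in>{1..n} - {k}. B (v (2 * j - 1)) (v (2 * j))))"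
proof -
  have "(\<Prod>j\<in>{1..n} - {k}. B ((v(2 * k := x)) (2 * j - 1)) ((v(2 * k := x)) (2 * j)))
      = (\<Prod>j\<in>{1..n} - {k}. B (v (2 * j - 1)) (v (2 * j)))"
  proof (rule prod.cong[OF refl])
    fix j assume j: "j \<in> {1..n} - {k}"
    then have "2 * j - 1 \<noteq> 2 * k \<and> 2 * j \<noteq> 2 * k"
      using k unfolding Diff_iff atLeastAtMost_iff singleton_iff by presburger
    then show "B ((v(2 * k := x)) (2 * j - 1)) ((v(2 * k := x)) (2 * j)) = B (v (2 * j - 1)) (v (2 * j))"
      by simp
  qed
  moreover have "2 * k \<noteq> 2 * k - 1" "0 \<noteq> 2 * k" using k by auto
  ultimately show ?thesis
    unfolding contact_term_def using k by (subst prod.remove[OF _ k]) auto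
qed

text \<open>The slot type carries no vector space structure, so the expansion of \<open>x\<close> is
  expressed through its effect on \<open>t\<close> and \<open>B\<close>; the set \<open>T\<close>
  confines the other arguments to where that effect is known, later the tangent space.\<close>

lemma contact_term_linear:
  assumes q: "q \<in> {0..2 * n}" and v: "\<And>i. i \<in> {0..2 * n} \<Longrightarrow> v i \<in> T"
    and t: "t x = (\<Sum>k\<in>I. c k * t (e k))"
    and B1: "\<And>y. y \<in> T \<Longrightarrow> B x y = (\<Sum>k\<in>I. c k * B (e k) y)"
    and B2: "\<And>y. y \<in> T \<Longrightarrow> B y x = (\<Sum>k\<in>I. c k * B y (e k))"
  shows "contact_term n t B (v(q := x)) = (\<Sum>k\<in>I. c k * contact_term n t B (v(q := e k)))"
  using q
proof (cases rule: contact_slot_cases)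
  case 1
  then show ?thesis
    by (simp add: contact_term_update_0 t sum_distrib_right mult.assoc)
next
  case (2 j)
  then have "v (2 * j) \<in> T" by (intro v) auto
  from B1[OF this] show ?thesis unfolding 2(2) contact_term_update_odd[OF 2(1)]
    by (simp add: sum_distrib_right sum_distrib_left mult.left_commute mult.assoc)
next
  case (3 j)
  then have "v (2 * j - 1) \<in> T" by (intro v) auto
  from B2[OF this] show ?thesis unfolding 3(2) contact_term_update_even[OF 3(1)]
    by (simp add: sum_distrib_right sum_distrib_left mult.left_commute mult.assoc)
qed

lemma contact_alt_linear:
  assumes m: "m \<in> {0..2 * n}" and v: "\<And>i. i \<in> {0..2 * n} \<Longrightarrow> v i \<in> T"
    and t: "t x = (\<Sum>k\<in>I. c k * t (e k))"
    and B1: "\<And>y. y \<in> T \<Longrightarrow> B x y = (\<Sum>k\<in>I. c k * B (e k) y)"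
    and B2: "\<And>y. y \<in> T \<Longrightarrow> B y x = (\<Sum>k\<in>I. c k * B y (e k))"
  shows "contact_alt n t B (v(m := x)) = (\<Sum>k\<in>I. c k * contact_alt n t B (v(m := e k)))"
proof -
  have *: "contact_term n t B (v(m := x) \<circ> \<sigma>) = (\<Sum>k\<in>I. c k * contact_term n t B (v(m := e k) \<circ> \<sigma>))"
    if \<sigma>: "\<sigma> permutes {0..2 * n}" for \<sigma>
  proof -
    let ?q = "inv \<sigma> m"
    have q: "?q \<in> {0..2 * n}" using m permutes_in_image[OF permutes_inv[OF \<sigma>]] by simp
    \<comment> \<open>Slot \<open>m\<close> of \<open>v\<close> sits at position
      \<open>inv \<sigma> m\<close> of \<open>v \<circ> \<sigma>\<close>.\<close>
    have upd: "v(m := y) \<circ> \<sigma> = (v \<circ> \<sigma>)(?q := y)" for y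
      using permutes_inverses[OF \<sigma>] by (auto simp: fun_eq_iff)
    have "(v \<circ> \<sigma>) i \<in> T" if "i \<in> {0..2 * n}" for i
      using v[of "\<sigma> i"] permutes_in_image[OF \<sigma>, of i] that by simp
    from contact_term_linear[OF q this t B1 B2] show ?thesis by (simp only: upd)
  qed
  have "contact_alt n t B (v(m := x)) = (\<Sum>\<sigma> | \<sigma> permutes {0..2 * n}. \<Sum>k\<in>I.
      c k * (of_int (sign \<sigma>) * contact_term n t B (v(m := e k) \<circ> \<sigma>)))"
    unfolding contact_alt_def by (intro sum.cong refl) (simp add: * sum_distrib_left mult.left_commute)
  also have "\<dots> = (\<Sum>k\<in>I. c k * contact_alt n t B (v(m := e k)))"
    unfolding contact_alt_def by (subst sum.swap) (simp add: sum_distrib_left)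
  finally show ?thesis .
qed

text \<open>Multilinearity reduces arbitrary vectors to selections from the spanning family
  \<open>e\<close>. Such a selection either repeats a member, giving 0, or permutes
  \<open>e\<close>, giving the value on \<open>e\<close> up to sign.\<close>

lemma contact_alt_zero_if_zero_on_basis:
  assumes e: "\<And>i. i \<in> {0..2 * n} \<Longrightarrow> e i \<in> T" and zero: "contact_alt n t B e = 0"
    and span: "\<And>x. x \<in> T \<Longrightarrow> \<exists>c. t x = (\<Sum>k\<in>{0..2 * n}. c k * t (e k)) \<and>
      (\<forall>y\<in>T. B x y = (\<Sum>k\<in>{0..2 * n}. c k * B (e k) y)) \<and>
      (\<forall>y\<in>T. B y x = (\<Sum>k\<in>{0..2 * n}. c k * B y (e k)))"
    and v: "\<And>i. i \<in> {0..2 * n} \<Longrightarrow> v i \<in> T"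
  shows "contact_alt n t B v = 0"
proof -
  have basis: "contact_alt n t B v = 0" if "\<And>i. i \<in> {0..2 * n} \<Longrightarrow> v i \<in> e ` {0..2 * n}" for v
  proof -
    have "\<exists>j. j \<in> {0..2 * n} \<and> v i = e j" if "i \<in> {0..2 * n}" for i
      using \<open>\<And>i. i \<in> {0..2 * n} \<Longrightarrow> v i \<in> e ` {0..2 * n}\<close>[OF that] by blast
    then obtain s where s: "\<And>i. i \<in> {0..2 * n} \<Longrightarrow> s i \<in> {0..2 * n} \<and> v i = e (s i)"
      by metis
    show ?thesis
    proof (cases "inj_on s {0..2 * n}")
      case True
      define \<tau> where "\<tau> i = (if i \<in> {0..2 * n} then s i else i)" for i
      have "bij_betw s {0..2 * n} {0..2 * n}"
        unfolding bij_betw_def using True s by (intro conjI endo_inj_surj) blast+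
      then have "bij_betw \<tau> {0..2 * n} {0..2 * n}"
        by (rule bij_betw_cong[THEN iffD1, rotated]) (simp add: \<tau>_def)
      then have "\<tau> permutes {0..2 * n}" by (rule bij_imp_permutes) (auto simp: \<tau>_def)
      moreover have "contact_alt n t B v = contact_alt n t B (e \<circ> \<tau>)"
        by (rule contact_alt_cong) (use s in \<open>auto simp: \<tau>_def\<close>)
      ultimately show ?thesis by (simp add: contact_alt_permute zero)
    next
      case False
      then obtain a b where "a \<in> {0..2 * n}" "b \<in> {0..2 * n}" "a \<noteq> b" "s a = s b"
        by (auto simp: inj_on_def)
      moreover from this have "v a = v b" using s by metis
      ultimately show ?thesis by (intro contact_alt_repeated)
    qed
  qed
  \<comment> \<open>Slots below \<open>m\<close> are arbitrary, those from \<open>m\<close> on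
    already hold members of \<open>e\<close>. The induction frees one slot at a time, up to
    \<open>m = 2 * n + 1\<close>, where no restriction remains.\<close>
  have "contact_alt n t B v = 0"
    if "m \<le> 2 * n + 1" "\<And>i. i \<in> {0..2 * n} \<Longrightarrow> v i \<in> T"
      "\<And>i. i \<in> {0..2 * n} \<Longrightarrow> i \<ge> m \<Longrightarrow> v i \<in> e ` {0..2 * n}" for m v
    using that
  proof (induction m arbitrary: v)
    case 0
    then show ?case by (intro basis) auto
  next
    case (Suc m)
    have m: "m \<in> {0..2 * n}" using Suc.prems(1) by auto
    obtain c where c: "t (v m) = (\<Sum>k\<in>{0..2 * n}. c k * t (e k))"
      "\<And>y. y \<in> T \<Longrightarrow> B (v m) y = (\<Sum>k\<in>{0..2 * n}. c k * B (e k) y)"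
      "\<And>y. y \<in> T \<Longrightarrow> B y (v m) = (\<Sum>k\<in>{0..2 * n}. c k * B y (e k))"
      using span[OF Suc.prems(2)[OF m]] by blast
    have "contact_alt n t B (v(m := e k)) = 0" if k: "k \<in> {0..2 * n}" for k
    proof (rule Suc.IH)
      fix i assume "i \<in> {0..2 * n}" "i \<ge> m"
      then show "(v(m := e k)) i \<in> e ` {0..2 * n}" using Suc.prems(3)[of i] k by (cases "i = m") auto
    qed (use Suc.prems e k in auto)
    then show ?case
      using contact_alt_linear[where v=v, OF m Suc.prems(2) c] by simp
  qed
  from this[of "2 * n + 1" v] v show ?thesis by auto
qed

lemma sum_contact_slots:
  fixes F :: "nat \<Rightarrow> 'a::comm_monoid_add"
  shows "(\<Sum>m = 0..2 * n. F m) = F 0 + (\<Sum>k = 1..n. F (2 * k - 1) + F (2 * k))"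
proof (induction n)
  case (Suc n)
  have "2 * Suc n = Suc (Suc (2 * n))" by simp
  then show ?case using Suc by (simp add: add.assoc)
qed simp

text \<open>An infinitesimal change of basis with matrix \<open>K\<close> acts on an alternating form of top degree as
  multiplication by the trace of \<open>K\<close>.\<close>

lemma contact_alt_derivation:
  fixes K :: "nat \<Rightarrow> nat \<Rightarrow> real"
  assumes t': "\<And>i. i \<in> {0..2 * n} \<Longrightarrow> t' i = (\<Sum>c\<in>{0..2 * n}. K i c * t c)"
    and B': "\<And>i j. i \<in> {0..2 * n} \<Longrightarrow> j \<in> {0..2 * n} \<Longrightarrow>
      B' i j = (\<Sum>c\<in>{0..2 * n}. K i c * B c j) + (\<Sum>c\<in>{0..2 * n}. K j c * B i c)"
  shows "(\<Sum>\<sigma> | \<sigma> permutes {0..2 * n}. of_int (sign \<sigma>) *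
      (t' (\<sigma> 0) * (\<Prod>k = 1..n. B (\<sigma> (2 * k - 1)) (\<sigma> (2 * k))) +
       t (\<sigma> 0) * (\<Sum>k = 1..n. B' (\<sigma> (2 * k - 1)) (\<sigma> (2 * k)) *
          (\<Prod>j\<in>{1..n} - {k}. B (\<sigma> (2 * j - 1)) (\<sigma> (2 * j))))))
    = (\<Sum>i\<in>{0..2 * n}. K i i) * contact_alt n t B id"
proof -
  let ?I = "{0..2 * n}"
  have term_eq: "t' (\<sigma> 0) * (\<Prod>k = 1..n. B (\<sigma> (2 * k - 1)) (\<sigma> (2 * k))) +
       t (\<sigma> 0) * (\<Sum>k = 1..n. B' (\<sigma> (2 * k - 1)) (\<sigma> (2 * k)) *
          (\<Prod>j\<in>{1..n} - {k}. B (\<sigma> (2 * j - 1)) (\<sigma> (2 * j))))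
      = (\<Sum>j\<in>?I. \<Sum>c\<in>?I. K j c * contact_term n t B (id(j := c) \<circ> \<sigma>))"
    if \<sigma>: "\<sigma> permutes ?I" for \<sigma>
  proof -
    have \<sigma>I: "\<sigma> i \<in> ?I" if "i \<in> ?I" for i using permutes_in_image[OF \<sigma>, of i] that by simp
    \<comment> \<open>\<open>F m\<close> is the effect of letting \<open>K\<close> act on the slot
      \<open>m\<close> alone; the product rule adds these up over all slots.\<close>
    define F where "F m = (\<Sum>c\<in>?I. K (\<sigma> m) c * contact_term n t B (\<sigma>(m := c)))" for m
    have F0: "F 0 = t' (\<sigma> 0) * (\<Prod>k = 1..n. B (\<sigma> (2 * k - 1)) (\<sigma> (2 * k)))"
      unfolding F_def contact_term_update_0 using \<sigma>I[of 0]
      by (simp add: t' sum_distrib_right mult.assoc)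
    have Fk: "F (2 * k - 1) + F (2 * k) = t (\<sigma> 0) * (B' (\<sigma> (2 * k - 1)) (\<sigma> (2 * k)) *
          (\<Prod>j\<in>{1..n} - {k}. B (\<sigma> (2 * j - 1)) (\<sigma> (2 * j))))" if k: "k \<in> {1..n}" for k
    proof -
      have "\<sigma> (2 * k - 1) \<in> ?I" "\<sigma> (2 * k) \<in> ?I" using \<sigma>I[of "2 * k - 1"] \<sigma>I[of "2 * k"] k by auto
      from B'[OF this] show ?thesis
        unfolding F_def contact_term_update_odd[OF k] contact_term_update_even[OF k]
        by (simp add: sum_distrib_right sum_distrib_left distrib_left distrib_right mult_ac)
    qed
    \<comment> \<open>Slot \<open>m\<close> of the term of \<open>\<sigma>\<close> holds the index
      \<open>\<sigma> m\<close>, so summing over slots amounts to summing over the indices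
      \<open>j = \<sigma> m\<close> being replaced.\<close>
    have "(\<Sum>m\<in>?I. F m) = (\<Sum>j\<in>?I. \<Sum>c\<in>?I. K j c * contact_term n t B (id(j := c) \<circ> \<sigma>))"
    proof (rule sum.reindex_bij_betw[OF permutes_imp_bij[OF \<sigma>], THEN trans[rotated]])
      show "(\<Sum>m\<in>?I. F m) = (\<Sum>m\<in>?I. \<Sum>c\<in>?I. K (\<sigma> m) c * contact_term n t B (id(\<sigma> m := c) \<circ> \<sigma>))"
        unfolding F_def
      proof (intro sum.cong refl arg_cong2[where f="(*)"] arg_cong[where f="contact_term n t B"])
        fix m c show "\<sigma>(m := c) = id(\<sigma> m := c) \<circ> \<sigma>"
          using permutes_inj[OF \<sigma>] by (auto simp: fun_eq_iff inj_eq)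
      qed
    qed
    moreover have "(\<Sum>m\<in>?I. F m) = F 0 + (\<Sum>k = 1..n. F (2 * k - 1) + F (2 * k))"
      by (rule sum_contact_slots)
    ultimately show ?thesis using F0 Fk by (simp add: sum_distrib_left)
  qed
  \<comment> \<open>Replacing \<open>j\<close> by a different index \<open>c\<close> repeats
    \<open>c\<close>, which kills the alternating sum; only the diagonal of \<open>K\<close>
    survives.\<close>
  have diag: "(\<Sum>c\<in>?I. K j c * contact_alt n t B (id(j := c))) = K j j * contact_alt n t B id"
    if j: "j \<in> ?I" for j
  proof -
    have "K j c * contact_alt n t B (id(j := c)) = (if c = j then K j j * contact_alt n t B id else 0)"
      if "c \<in> ?I" for c
      using contact_alt_repeated[OF j that, of "id(j := c)" t B]
      by (cases "c = j") (simp_all add: fun_upd_idem)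
    then show ?thesis using j by (simp add: sum.delta)
  qed
  have "(\<Sum>\<sigma> | \<sigma> permutes ?I. of_int (sign \<sigma>) *
      (\<Sum>j\<in>?I. \<Sum>c\<in>?I. K j c * contact_term n t B (id(j := c) \<circ> \<sigma>)))
    = (\<Sum>\<sigma> | \<sigma> permutes ?I. \<Sum>j\<in>?I. \<Sum>c\<in>?I.
        K j c * (of_int (sign \<sigma>) * contact_term n t B (id(j := c) \<circ> \<sigma>)))"
    by (simp add: sum_distrib_left mult.left_commute)
  also have "\<dots> = (\<Sum>j\<in>?I. \<Sum>c\<in>?I. \<Sum>\<sigma> | \<sigma> permutes ?I.
        K j c * (of_int (sign \<sigma>) * contact_term n t B (id(j := c) \<circ> \<sigma>)))"
    by (subst sum.swap, intro sum.cong refl, rule sum.swap)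
  also have "\<dots> = (\<Sum>j\<in>?I. \<Sum>c\<in>?I. K j c * contact_alt n t B (id(j := c)))"
    unfolding contact_alt_def by (simp add: sum_distrib_left)
  also have "\<dots> = (\<Sum>j\<in>?I. K j j) * contact_alt n t B id"
    by (simp add: diag sum_distrib_right)
  finally show ?thesis using term_eq by simp
qed

section \<open>Contact Riemannian manifolds and horizontal frames\<close>

lemma sum_mat_assoc:
  fixes P :: "'a \<Rightarrow> real"
  shows "(\<Sum>k\<in>K. (\<Sum>l\<in>I. P l * Q l k) * R k) = (\<Sum>l\<in>I. P l * (\<Sum>k\<in>K. Q l k * R k))"
  by (simp add: sum_distrib_left sum_distrib_right mult.assoc) (rule sum.swap)

lemma sum_mat_swap:
  fixes P :: "'a \<Rightarrow> real"
  shows "(\<Sum>k\<in>K. P k * (\<Sum>l\<in>I. Q l * R k l)) = (\<Sum>l\<in>I. Q l * (\<Sum>k\<in>K. P k * R k l))"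
  by (simp add: sum_distrib_left mult.left_commute) (rule sum.swap)

text \<open>Here \<open>M\<close> and \<open>N\<close> are the transition matrices between a coordinate frame and an orthonormal
  frame, \<open>G\<close> is the matrix of \<open>d\<theta>\<close> in the orthonormal frame and primes denote derivatives. Since
  \<open>G\<close> is skew with \<open>G\<^sup>2 = -1\<close> off the index \<open>0\<close>, one has \<open>G' = S G + G S\<^sup>T\<close> for \<open>S = - G' G / 2\<close>, and this \<open>S\<close>
  is traceless because the Frobenius norm of \<open>G\<close> is constant. So \<open>K = (M' + M S) N\<close> generates the
  change of \<open>\<theta>\<close> and \<open>d\<theta>\<close> in the coordinate frame.\<close>

lemma frame_change_generator:
  fixes M N M' N' G G' B D :: "nat \<Rightarrow> nat \<Rightarrow> real"
  assumes I: "finite I" "0 \<in> I"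
    and NM: "\<And>j k. j \<in> I \<Longrightarrow> k \<in> I \<Longrightarrow> (\<Sum>a\<in>I. N j a * M a k) = (if j = k then 1 else 0)"
    and MN: "\<And>a b. a \<in> I \<Longrightarrow> b \<in> I \<Longrightarrow> (\<Sum>j\<in>I. M a j * N j b) = (if a = b then 1 else 0)"
    and MN': "\<And>a. a \<in> I \<Longrightarrow> (\<Sum>j\<in>I. M' a j * N j a + M a j * N' j a) = 0"
    and N': "\<And>j a. j \<in> I \<Longrightarrow> a \<in> I \<Longrightarrow>
      N' j a = (\<Sum>b\<in>I. N j b * D b a) + (\<Sum>k\<in>I. B j k * N k a)"
    and skew: "\<And>i j. i \<in> I \<Longrightarrow> j \<in> I \<Longrightarrow> G i j = - G j i"
    and skew': "\<And>i j. i \<in> I \<Longrightarrow> j \<in> I \<Longrightarrow> G' i j = - G' j i"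
    and G0: "\<And>i. i \<in> I \<Longrightarrow> G i 0 = 0" and G'0: "\<And>i. i \<in> I \<Longrightarrow> G' i 0 = 0"
    and GG: "\<And>i j. i \<in> I \<Longrightarrow> j \<in> I \<Longrightarrow>
      (\<Sum>k\<in>I. G i k * G k j) = (if i = j \<and> j \<noteq> 0 then - 1 else 0)"
    and GG': "(\<Sum>i\<in>I. \<Sum>j\<in>I. G' i j * G i j) = 0"
  obtains K where
    "\<And>a. a \<in> I \<Longrightarrow> M' a 0 = (\<Sum>c\<in>I. K a c * M c 0)"
    "\<And>a b. a \<in> I \<Longrightarrow> b \<in> I \<Longrightarrow>
      (\<Sum>i\<in>I. \<Sum>j\<in>I. M' a i * M b j * G i j + M a i * M' b j * G i j + M a i * M b j * G' i j) =
      (\<Sum>c\<in>I. K a c * (\<Sum>i\<in>I. \<Sum>j\<in>I. M c i * M b j * G i j)) +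
      (\<Sum>c\<in>I. K b c * (\<Sum>i\<in>I. \<Sum>j\<in>I. M a i * M c j * G i j))"
    "(\<Sum>a\<in>I. K a a) = - (\<Sum>a\<in>I. D a a) - (\<Sum>j\<in>I. B j j)"
proof -
  define S where "S i j = (\<Sum>l\<in>I. (- 1 / 2) * G' i l * G l j)" for i j
  define Q where "Q a j = M' a j + (\<Sum>i\<in>I. M a i * S i j)" for a j
  define K where "K a c = (\<Sum>j\<in>I. Q a j * N j c)" for a c
  have KM: "(\<Sum>c\<in>I. K a c * M c i) = Q a i" if "i \<in> I" for a i
  proof -
    have "(\<Sum>c\<in>I. K a c * M c i) = (\<Sum>j\<in>I. Q a j * (\<Sum>c\<in>I. N j c * M c i))"
      unfolding K_def by (rule sum_mat_assoc)
    also have "\<dots> = (\<Sum>j\<in>I. if j = i then Q a j else 0)"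
      by (intro sum.cong refl) (simp add: NM that)
    finally show ?thesis using I that by simp
  qed
  \<comment> \<open>Since \<open>G^2 = -1\<close> off the index 0, multiplying
    \<open>S = - G' G / 2\<close> by \<open>G\<close> gives \<open>G' / 2\<close>. At
    \<open>j = 0\<close> both sides vanish, because column 0 of \<open>G'\<close> does.\<close>
  have SG: "(\<Sum>l\<in>I. S i l * G l j) = 1 / 2 * G' i j" if "i \<in> I" "j \<in> I" for i j
  proof -
    have "(\<Sum>l\<in>I. S i l * G l j) = (\<Sum>m\<in>I. (- 1 / 2) * G' i m * (\<Sum>l\<in>I. G m l * G l j))"
      unfolding S_def by (rule sum_mat_assoc)
    also have "\<dots> = (\<Sum>m\<in>I. if m = j then (if j \<noteq> 0 then 1 / 2 * G' i j else 0) else 0)"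
      by (intro sum.cong refl) (simp add: GG that)
    finally show ?thesis using I that G'0[OF that(1)] by auto
  qed
  have GS: "(\<Sum>l\<in>I. S j l * G i l) = 1 / 2 * G' i j" if "i \<in> I" "j \<in> I" for i j
  proof -
    have "(\<Sum>l\<in>I. S j l * G i l) = - (\<Sum>l\<in>I. S j l * G l i)"
      unfolding sum_negf[symmetric] by (intro sum.cong refl) (simp add: skew[of i] that)
    then show ?thesis using SG[OF that(2,1)] skew'[OF that] by simp
  qed
  have S0: "S i 0 = 0" for i unfolding S_def by (simp add: G0)
  have trS: "(\<Sum>i\<in>I. S i i) = 0"
  proof -
    have "(\<Sum>i\<in>I. S i i) = (\<Sum>i\<in>I. \<Sum>l\<in>I. 1 / 2 * (G' i l * G i l))"
      unfolding S_def
    proof (intro sum.cong refl)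
      fix i l assume "i \<in> I" "l \<in> I"
      from skew[OF this(2,1)] show "- 1 / 2 * G' i l * G l i = 1 / 2 * (G' i l * G i l)" by simp
    qed
    also have "\<dots> = 1 / 2 * (\<Sum>i\<in>I. \<Sum>l\<in>I. G' i l * G i l)"
      by (simp only: sum_distrib_left)
    finally show ?thesis by (simp add: GG')
  qed
  show thesis
  proof (rule that[of K])
    show "M' a 0 = (\<Sum>c\<in>I. K a c * M c 0)" if "a \<in> I" for a
      using KM[OF I(2), of a] by (simp add: Q_def S0)
  next
    fix a b assume a: "a \<in> I" and b: "b \<in> I"
    have 1: "(\<Sum>c\<in>I. K a c * (\<Sum>i\<in>I. \<Sum>j\<in>I. M c i * M b j * G i j)) =
        (\<Sum>i\<in>I. Q a i * (\<Sum>j\<in>I. M b j * G i j))"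
    proof -
      have "(\<Sum>c\<in>I. K a c * (\<Sum>i\<in>I. \<Sum>j\<in>I. M c i * M b j * G i j)) =
          (\<Sum>c\<in>I. K a c * (\<Sum>i\<in>I. M c i * (\<Sum>j\<in>I. M b j * G i j)))"
        by (simp add: sum_distrib_left mult.assoc)
      also have "\<dots> = (\<Sum>i\<in>I. (\<Sum>c\<in>I. K a c * M c i) * (\<Sum>j\<in>I. M b j * G i j))"
        by (rule sum_mat_assoc[symmetric])
      finally show ?thesis by (simp add: KM)
    qed
    have 2: "(\<Sum>c\<in>I. K b c * (\<Sum>i\<in>I. \<Sum>j\<in>I. M a i * M c j * G i j)) =
        (\<Sum>j\<in>I. Q b j * (\<Sum>i\<in>I. M a i * G i j))"
    proof -
      have "(\<Sum>c\<in>I. K b c * (\<Sum>i\<in>I. \<Sum>j\<in>I. M a i * M c j * G i j)) =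
          (\<Sum>c\<in>I. K b c * (\<Sum>j\<in>I. M c j * (\<Sum>i\<in>I. M a i * G i j)))"
        by (subst sum.swap) (simp add: sum_distrib_left mult.assoc mult.left_commute)
      also have "\<dots> = (\<Sum>j\<in>I. (\<Sum>c\<in>I. K b c * M c j) * (\<Sum>i\<in>I. M a i * G i j))"
        by (rule sum_mat_assoc[symmetric])
      finally show ?thesis by (simp add: KM)
    qed
    have 3: "(\<Sum>i\<in>I. (\<Sum>k\<in>I. M a k * S k i) * (\<Sum>j\<in>I. M b j * G i j)) =
        (\<Sum>i\<in>I. \<Sum>j\<in>I. M a i * M b j * (1 / 2 * G' i j))"
    proof -
      have "(\<Sum>i\<in>I. (\<Sum>k\<in>I. M a k * S k i) * (\<Sum>j\<in>I. M b j * G i j)) =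
          (\<Sum>k\<in>I. M a k * (\<Sum>i\<in>I. S k i * (\<Sum>j\<in>I. M b j * G i j)))"
        by (rule sum_mat_assoc)
      also have "\<dots> = (\<Sum>k\<in>I. M a k * (\<Sum>j\<in>I. M b j * (\<Sum>i\<in>I. S k i * G i j)))"
        by (rule sum.cong[OF refl], rule arg_cong2[where f="(*)", OF refl], rule sum_mat_swap)
      finally show ?thesis by (simp add: SG sum_distrib_left mult.assoc)
    qed
    have 4: "(\<Sum>j\<in>I. (\<Sum>k\<in>I. M b k * S k j) * (\<Sum>i\<in>I. M a i * G i j)) =
        (\<Sum>i\<in>I. \<Sum>j\<in>I. M a i * M b j * (1 / 2 * G' i j))"
    proof -
      have "(\<Sum>j\<in>I. (\<Sum>k\<in>I. M b k * S k j) * (\<Sum>i\<in>I. M a i * G i j)) =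
          (\<Sum>k\<in>I. M b k * (\<Sum>j\<in>I. S k j * (\<Sum>i\<in>I. M a i * G i j)))"
        by (rule sum_mat_assoc)
      also have "\<dots> = (\<Sum>k\<in>I. M b k * (\<Sum>i\<in>I. M a i * (\<Sum>j\<in>I. S k j * G i j)))"
        by (rule sum.cong[OF refl], rule arg_cong2[where f="(*)", OF refl], rule sum_mat_swap)
      also have "\<dots> = (\<Sum>k\<in>I. \<Sum>i\<in>I. M a i * M b k * (1 / 2 * G' i k))"
        by (simp add: GS sum_distrib_left mult.left_commute mult.assoc)
      also have "\<dots> = (\<Sum>i\<in>I. \<Sum>j\<in>I. M a i * M b j * (1 / 2 * G' i j))"
        by (rule sum.swap)
      finally show ?thesis .
    qed
    have 5: "(\<Sum>i\<in>I. M' a i * (\<Sum>j\<in>I. M b j * G i j)) = (\<Sum>i\<in>I. \<Sum>j\<in>I. M' a i * M b j * G i j)"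
      by (simp add: sum_distrib_left mult.assoc)
    have 6: "(\<Sum>j\<in>I. M' b j * (\<Sum>i\<in>I. M a i * G i j)) = (\<Sum>i\<in>I. \<Sum>j\<in>I. M a i * M' b j * G i j)"
      by (subst sum.swap) (simp add: sum_distrib_left mult.assoc mult.left_commute)
    show "(\<Sum>i\<in>I. \<Sum>j\<in>I. M' a i * M b j * G i j + M a i * M' b j * G i j + M a i * M b j * G' i j) =
      (\<Sum>c\<in>I. K a c * (\<Sum>i\<in>I. \<Sum>j\<in>I. M c i * M b j * G i j)) +
      (\<Sum>c\<in>I. K b c * (\<Sum>i\<in>I. \<Sum>j\<in>I. M a i * M c j * G i j))"
      unfolding 1 2 unfolding Q_def distrib_right sum.distrib 3 4 5 6
      by (simp add: sum_distrib_left[symmetric] mult.left_commute[of _ "1/2"] sum_divide_distrib[symmetric])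
  next
    \<comment> \<open>The trace of \<open>K = (M' + M S) N\<close> splits. Cyclically,
      \<open>tr (M S N) = tr S = 0\<close>. Differentiating \<open>M N = 1\<close> gives
      \<open>tr (M' N) = - tr (M N')\<close>, and \<open>N' = N D + B N\<close> turns this into
      \<open>- tr D - tr B\<close>.\<close>
    have SMN: "(\<Sum>a\<in>I. \<Sum>j\<in>I. (\<Sum>i\<in>I. M a i * S i j) * N j a) = 0"
    proof -
      have "(\<Sum>a\<in>I. \<Sum>j\<in>I. (\<Sum>i\<in>I. M a i * S i j) * N j a) =
          (\<Sum>j\<in>I. \<Sum>i\<in>I. S i j * (\<Sum>a\<in>I. N j a * M a i))"
        by (subst sum.swap, rule sum.cong[OF refl], subst sum_mat_swap[symmetric])
          (simp add: mult.commute)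
      also have "\<dots> = (\<Sum>j\<in>I. \<Sum>i\<in>I. if i = j then S i j else 0)"
        by (intro sum.cong refl) (simp add: NM)
      finally show ?thesis using I trS by simp
    qed
    have DN: "(\<Sum>a\<in>I. \<Sum>j\<in>I. M a j * (\<Sum>b\<in>I. N j b * D b a)) = (\<Sum>a\<in>I. D a a)"
    proof (intro sum.cong refl)
      fix a assume a: "a \<in> I"
      have "(\<Sum>j\<in>I. M a j * (\<Sum>b\<in>I. N j b * D b a)) = (\<Sum>b\<in>I. (\<Sum>j\<in>I. M a j * N j b) * D b a)"
        by (rule sum_mat_assoc[symmetric])
      also have "\<dots> = (\<Sum>b\<in>I. if a = b then D b a else 0)"
        by (intro sum.cong refl) (simp add: MN a)
      finally show "(\<Sum>j\<in>I. M a j * (\<Sum>b\<in>I. N j b * D b a)) = D a a" using I a by simp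
    qed
    have BN: "(\<Sum>a\<in>I. \<Sum>j\<in>I. M a j * (\<Sum>k\<in>I. B j k * N k a)) = (\<Sum>j\<in>I. B j j)"
    proof -
      have "(\<Sum>a\<in>I. \<Sum>j\<in>I. M a j * (\<Sum>k\<in>I. B j k * N k a)) =
          (\<Sum>j\<in>I. \<Sum>k\<in>I. B j k * (\<Sum>a\<in>I. N k a * M a j))"
        by (subst sum.swap, rule sum.cong[OF refl], subst sum_mat_swap) (simp add: mult.commute)
      also have "\<dots> = (\<Sum>j\<in>I. \<Sum>k\<in>I. if k = j then B j k else 0)"
        by (intro sum.cong refl) (simp add: NM)
      finally show ?thesis using I by simp
    qed
    have "(\<Sum>a\<in>I. \<Sum>j\<in>I. M' a j * N j a) = - (\<Sum>a\<in>I. \<Sum>j\<in>I. M a j * N' j a)"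
      unfolding sum_negf[symmetric, of _ I]
    proof (rule sum.cong[OF refl])
      fix a assume "a \<in> I"
      from MN'[OF this] show "(\<Sum>j\<in>I. M' a j * N j a) = (\<Sum>j\<in>I. - (M a j * N' j a))"
        by (simp add: sum.distrib sum_negf eq_neg_iff_add_eq_0)
    qed
    also have "(\<Sum>a\<in>I. \<Sum>j\<in>I. M a j * N' j a) = (\<Sum>a\<in>I. D a a) + (\<Sum>j\<in>I. B j j)"
      unfolding DN[symmetric] BN[symmetric] sum.distrib[symmetric]
      by (intro sum.cong refl) (simp add: N' distrib_left)
    finally show "(\<Sum>a\<in>I. K a a) = - (\<Sum>a\<in>I. D a a) - (\<Sum>j\<in>I. B j j)"
      unfolding K_def Q_def distrib_right sum.distrib SMN by simp
  qed
qed

locale contact_riemannian =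
  fixes A :: "('m::{t2_space, second_countable_topology}, 'e::euclidean_space) chart set"
    and n :: nat
    and \<theta> :: "'m \<Rightarrow> 'm tvec \<Rightarrow> real"
    and Z :: "'m vfield"
    and g :: "'m \<Rightarrow> 'm tvec \<Rightarrow> 'm tvec \<Rightarrow> real"
    and J :: "'m \<Rightarrow> 'm tvec \<Rightarrow> 'm tvec"
  assumes crm: "contact_riemannian_manifold A n \<theta> Z g J"

sublocale contact_riemannian \<subseteq> smooth_manifold A
  using crm by unfold_locales (simp add: contact_riemannian_manifold_def)

context contact_riemannian
begin

lemma dim: "DIM('e) = 2 * n + 1"
  using crm by (simp add: contact_riemannian_manifold_def)

lemma theta_linear: "linear_on_tangent A p (\<theta> p)"
  using crm by (simp add: contact_riemannian_manifold_def contact_form_def smooth_one_form_def)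

lemma reeb_smooth: "smooth_vfield_on A UNIV Z"
  using crm by (simp add: contact_riemannian_manifold_def reeb_field_def)

lemma reeb_tangent: "Z p \<in> tangent_space A p"
  by (rule smooth_vfield_tangent[OF reeb_smooth UNIV_I])

lemma theta_reeb: "\<theta> p (Z p) = 1"
  using crm by (simp add: contact_riemannian_manifold_def reeb_field_def)

lemma metric: "riemannian_metric A g"
  using crm by (simp add: contact_riemannian_manifold_def)

lemma g_linear: "u \<in> tangent_space A p \<Longrightarrow> linear_on_tangent A p (g p u)"
  using metric by (simp add: riemannian_metric_def)

lemma g_sym: "u \<in> tangent_space A p \<Longrightarrow> v \<in> tangent_space A p \<Longrightarrow> g p u v = g p v u"
  using metric by (simp add: riemannian_metric_def)

lemma g_pos: "u \<in> tangent_space A p \<Longrightarrow> u \<noteq> (\<lambda>f. 0) \<Longrightarrow> 0 < g p u u"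
  using metric by (simp add: riemannian_metric_def)

lemma g_smooth:
  "smooth_vfield_on A W X \<Longrightarrow> smooth_vfield_on A W Y \<Longrightarrow> smooth_fun_on A W (\<lambda>p. g p (X p) (Y p))"
  using metric by (simp add: riemannian_metric_def)

lemma g_reeb: "u \<in> tangent_space A p \<Longrightarrow> g p u (Z p) = \<theta> p u"
  using crm by (simp add: contact_riemannian_manifold_def)

lemma J_tangent: "u \<in> tangent_space A p \<Longrightarrow> J p u \<in> tangent_space A p"
  using crm by (simp add: contact_riemannian_manifold_def smooth_endomorphism_def)

lemma J_smooth: "smooth_vfield_on A W X \<Longrightarrow> smooth_vfield_on A W (\<lambda>p. J p (X p))"
  using crm by (simp add: contact_riemannian_manifold_def smooth_endomorphism_def)

lemma J_lincomb:
  "u \<in> tangent_space A p \<Longrightarrow> v \<in> tangent_space A p \<Longrightarrow>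
    J p (\<lambda>f. a * u f + b * v f) = (\<lambda>f. a * J p u f + b * J p v f)"
  using crm by (simp add: contact_riemannian_manifold_def smooth_endomorphism_def)

lemma J_J: "u \<in> tangent_space A p \<Longrightarrow> J p (J p u) = (\<lambda>f. - u f + \<theta> p u * Z p f)"
  using crm by (simp add: contact_riemannian_manifold_def)

lemma g_J:
  "smooth_vfield_on A W X \<Longrightarrow> smooth_vfield_on A W Y \<Longrightarrow> p \<in> W \<Longrightarrow>
    g p (X p) (J p (Y p)) = ext_deriv A \<theta> X Y p"
  using crm unfolding contact_riemannian_manifold_def by blast

lemma J_sum:
  assumes "finite I" "\<And>i. i \<in> I \<Longrightarrow> u i \<in> tangent_space A p"
  shows "J p (\<lambda>f. \<Sum>i\<in>I. a i * u i f) = (\<lambda>f. \<Sum>i\<in>I. a i * J p (u i) f)"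
  using assms
proof (induction I rule: finite_induct)
  case empty
  show ?case using J_lincomb[OF tangent_space_zero tangent_space_zero, of p 0 0] by simp
next
  case (insert i I)
  have "J p (\<lambda>f. a i * u i f + 1 * (\<Sum>i\<in>I. a i * u i f))
      = (\<lambda>f. a i * J p (u i) f + 1 * J p (\<lambda>f. \<Sum>i\<in>I. a i * u i f) f)"
    by (rule J_lincomb) (auto intro: insert.prems tangent_space_sum)
  then show ?case using insert by simp
qed

lemma g_sum_right:
  assumes "v \<in> tangent_space A p" "\<And>i. i \<in> I \<Longrightarrow> u i \<in> tangent_space A p"
  shows "g p v (\<lambda>f. \<Sum>i\<in>I. a i * u i f) = (\<Sum>i\<in>I. a i * g p v (u i))"
  by (rule linear_on_tangent_sum[OF g_linear[OF assms(1)] assms(2)])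

lemma g_sum_left:
  assumes "v \<in> tangent_space A p" "\<And>i. i \<in> I \<Longrightarrow> u i \<in> tangent_space A p"
  shows "g p (\<lambda>f. \<Sum>i\<in>I. a i * u i f) v = (\<Sum>i\<in>I. a i * g p (u i) v)"
proof -
  have "g p (\<lambda>f. \<Sum>i\<in>I. a i * u i f) v = g p v (\<lambda>f. \<Sum>i\<in>I. a i * u i f)"
    by (rule g_sym[OF tangent_space_sum[OF assms(2)] assms(1)])
  also have "\<dots> = (\<Sum>i\<in>I. a i * g p v (u i))" by (rule g_sum_right[OF assms])
  finally show ?thesis by (simp add: g_sym[OF assms(1) assms(2)])
qed

text \<open>\<open>\<theta> \<and> (d\<theta>)\<^sup>n\<close> is a tensor because \<open>d\<theta> = g(\<cdot>, J \<cdot>)\<close>.\<close>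

lemma contact_volume_form_eq:
  assumes "\<And>i. i \<in> {0..2 * n} \<Longrightarrow> smooth_vfield_on A W (V i)" "p \<in> W"
  shows "contact_volume_form A n \<theta> V p =
    1 / 2 ^ n * contact_alt n (\<theta> p) (\<lambda>u v. g p u (J p v)) (\<lambda>i. V i p)"
proof -
  have "(\<Prod>k = 1..n. ext_deriv A \<theta> (V (\<sigma> (2 * k - 1))) (V (\<sigma> (2 * k))) p) =
      (\<Prod>k = 1..n. g p (V (\<sigma> (2 * k - 1)) p) (J p (V (\<sigma> (2 * k)) p)))"
    if \<sigma>: "\<sigma> permutes {0..2 * n}" for \<sigma>
  proof (rule prod.cong[OF refl])
    fix k assume k: "k \<in> {1..n}"
    have "2 * k - 1 \<in> {0..2 * n}" "2 * k \<in> {0..2 * n}" using k by auto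
    then have "\<sigma> (2 * k - 1) \<in> {0..2 * n}" "\<sigma> (2 * k) \<in> {0..2 * n}"
      by (simp_all only: permutes_in_image[OF \<sigma>])
    then show "ext_deriv A \<theta> (V (\<sigma> (2 * k - 1))) (V (\<sigma> (2 * k))) p =
        g p (V (\<sigma> (2 * k - 1)) p) (J p (V (\<sigma> (2 * k)) p))"
      by (intro g_J[symmetric, OF assms(1) assms(1) assms(2)])
  qed
  note prods = this
  show ?thesis
    unfolding contact_volume_form_def contact_alt_def contact_term_def o_def
    by (rule arg_cong2[where f="(*)", OF refl sum.cong[OF refl]]) (simp only: mult.assoc prods mem_Collect_eq)
qed

end

subsection \<open>The volume density in a chart\<close>

locale contact_chart = contact_riemannian A n \<theta> Z g J
  for A :: "('m::{t2_space, second_countable_topology}, 'e::euclidean_space) chart set"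
    and n \<theta> Z g J +
  fixes c :: "('m, 'e) chart" and e :: "nat \<Rightarrow> 'e"
  assumes chart: "c \<in> A" and e: "bij_betw e {0..2 * n} (Basis :: 'e set)"
begin

abbreviation coord_field :: "nat \<Rightarrow> 'm vfield" where
  "coord_field a \<equiv> coord_vec A c (e a)"

abbreviation coord :: "nat \<Rightarrow> 'm \<Rightarrow> real" where
  "coord a \<equiv> \<lambda>q. snd c q \<bullet> e a"

abbreviation volume_density :: "'m \<Rightarrow> real" where
  "volume_density \<equiv> contact_volume_form A n \<theta> coord_field"

lemma coord_field_smooth: "smooth_vfield_on A (fst c) (coord_field a)"
  by (rule coord_vec_smooth[OF chart])

lemma coord_field_tangent: "p \<in> fst c \<Longrightarrow> coord_field a p \<in> tangent_space A p"
  by (rule coord_vec_in_tangent_space[OF chart])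

lemma coord_smooth: "smooth_fun_on A (fst c) (coord a)"
  by (rule smooth_fun_on_coordinate[OF chart])

lemma coord_field_coord:
  assumes "p \<in> fst c" "a \<in> {0..2 * n}" "b \<in> {0..2 * n}"
  shows "coord_field a p (coord b) = (if a = b then 1 else 0)"
proof -
  have "e a \<in> Basis" "e b \<in> Basis" using e assms by (auto simp: bij_betw_def)
  moreover have "e a = e b \<longleftrightarrow> a = b" using e assms by (auto simp: bij_betw_def inj_on_def)
  ultimately show ?thesis
    using coord_vec_coordinate[OF chart assms(1), of "e a" "e b"] by (simp add: inner_Basis)
qed

lemma coord_expansion:
  assumes "u \<in> tangent_space A p" "p \<in> fst c"
  shows "u = (\<lambda>f. \<Sum>a\<in>{0..2 * n}. u (coord a) * coord_field a p f)"
proof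
  fix f
  have "u f = (\<Sum>b\<in>Basis. u (\<lambda>q. snd c q \<bullet> b) * coord_vec A c b p f)"
    by (rule fun_cong[OF tangent_vector_expansion[OF assms(1) chart assms(2)]])
  also have "\<dots> = (\<Sum>a\<in>{0..2 * n}. u (coord a) * coord_field a p f)"
    by (rule sum.reindex_bij_betw[OF e, symmetric])
  finally show "u f = (\<Sum>a\<in>{0..2 * n}. u (coord a) * coord_field a p f)" .
qed

lemma volume_density_eq:
  "p \<in> fst c \<Longrightarrow> volume_density p =
    1 / 2 ^ n * contact_alt n (\<theta> p) (\<lambda>u v. g p u (J p v)) (\<lambda>a. coord_field a p)"
  by (rule contact_volume_form_eq[OF coord_field_smooth])

text \<open>\<open>contact_form\<close> only promises some fields \<open>V\<close> on which the form
  does not vanish at \<open>p\<close>. Were it zero on the coordinate frame, which spans, it would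
  be zero on these \<open>V\<close> too.\<close>

lemma volume_density_nonzero:
  assumes p: "p \<in> fst c"
  shows "volume_density p \<noteq> 0"
proof
  assume "volume_density p = 0"
  then have zero: "contact_alt n (\<theta> p) (\<lambda>u v. g p u (J p v)) (\<lambda>a. coord_field a p) = 0"
    by (simp add: volume_density_eq[OF p])
  have "contact_form A n \<theta>" using crm by (simp add: contact_riemannian_manifold_def)
  then obtain W V where W: "p \<in> W" "\<And>i. i \<le> 2 * n \<Longrightarrow> smooth_vfield_on A W (V i)"
    and nz: "contact_volume_form A n \<theta> V p \<noteq> 0"
    unfolding contact_form_def by blast
  note d = coord_field_tangent[OF p]
  have "contact_alt n (\<theta> p) (\<lambda>u v. g p u (J p v)) (\<lambda>i. V i p) = 0"
  proof (rule contact_alt_zero_if_zero_on_basis[where T="tangent_space A p", OF d zero])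
    fix x assume x: "x \<in> tangent_space A p"
    let ?r = "\<lambda>k. x (coord k)"
    note ex = coord_expansion[OF x p]
    have "\<theta> p x = (\<Sum>k\<in>{0..2 * n}. ?r k * \<theta> p (coord_field k p))"
      by (rule trans[OF arg_cong[OF ex, of "\<theta> p"]]) (rule linear_on_tangent_sum[OF theta_linear d])
    moreover have "g p x (J p y) = (\<Sum>k\<in>{0..2 * n}. ?r k * g p (coord_field k p) (J p y))"
      if "y \<in> tangent_space A p" for y
      by (rule trans[OF arg_cong[OF ex, of "\<lambda>x. g p x (J p y)"]]) (rule g_sum_left[OF J_tangent[OF that] d])
    moreover have "g p y (J p x) = (\<Sum>k\<in>{0..2 * n}. ?r k * g p y (J p (coord_field k p)))"
      if "y \<in> tangent_space A p" for y
    proof (rule trans[OF arg_cong[OF ex, of "\<lambda>x. g p y (J p x)"]])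
      show "g p y (J p (\<lambda>f. \<Sum>k\<in>{0..2 * n}. ?r k * coord_field k p f)) =
          (\<Sum>k\<in>{0..2 * n}. ?r k * g p y (J p (coord_field k p)))"
        unfolding J_sum[OF finite_atLeastAtMost d] by (rule g_sum_right[OF that J_tangent[OF d]])
    qed
    ultimately show "\<exists>r. \<theta> p x = (\<Sum>k\<in>{0..2 * n}. r k * \<theta> p (coord_field k p)) \<and>
      (\<forall>y\<in>tangent_space A p. g p x (J p y) = (\<Sum>k\<in>{0..2 * n}. r k * g p (coord_field k p) (J p y))) \<and>
      (\<forall>y\<in>tangent_space A p. g p y (J p x) = (\<Sum>k\<in>{0..2 * n}. r k * g p y (J p (coord_field k p))))"
      by (intro exI[of _ ?r] conjI ballI)
  next
    show "V i p \<in> tangent_space A p" if "i \<in> {0..2 * n}" for i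
      using smooth_vfield_tangent[OF W(2) W(1)] that by simp
  qed
  moreover have "contact_volume_form A n \<theta> V p =
      1 / 2 ^ n * contact_alt n (\<theta> p) (\<lambda>u v. g p u (J p v)) (\<lambda>i. V i p)"
    by (rule contact_volume_form_eq[OF _ W(1)]) (simp add: W(2))
  ultimately show False using nz by simp
qed

lemma volume_density_smooth: "smooth_fun_on A (fst c) volume_density"
proof (rule smooth_fun_on_cong[OF _ volume_density_eq[symmetric]])
  have op: "open (fst c)" by (rule chart_open[OF chart])
  have t: "smooth_fun_on A (fst c) (\<lambda>p. \<theta> p (coord_field a p))" for a
    using crm coord_field_smooth
    by (simp add: contact_riemannian_manifold_def contact_form_def smooth_one_form_def)
  have B: "smooth_fun_on A (fst c) (\<lambda>p. g p (coord_field a p) (J p (coord_field b p)))" for a b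
    by (rule g_smooth[OF coord_field_smooth J_smooth[OF coord_field_smooth]])
  show "smooth_fun_on A (fst c) (\<lambda>p. 1 / 2 ^ n *
      contact_alt n (\<theta> p) (\<lambda>u v. g p u (J p v)) (\<lambda>a. coord_field a p))"
    unfolding contact_alt_def contact_term_def o_def
    by (intro smooth_fun_on_cmult smooth_fun_on_sum smooth_fun_on_mult smooth_fun_on_prod op t B)
qed

end

text \<open>Shifts all dependence on the point into the scalar entries: the slots become fixed
  indices, as \<open>contact_alt_derivation\<close> requires.\<close>

lemma contact_alt_reindex:
  "contact_alt n t B v = contact_alt n (\<lambda>a. t (v a)) (\<lambda>a b. B (v a) (v b)) id"
  by (simp add: contact_alt_def contact_term_def)

text \<open>The product rule, arranged so that the result is the left-hand side of
  \<open>contact_alt_derivation\<close>.\<close>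

lemma (in smooth_manifold) tangent_vector_contact_alt:
  assumes u: "u \<in> tangent_space A p" and t: "\<And>a. smooth_near A p (t a)"
    and B: "\<And>a b. smooth_near A p (B a b)"
  shows "u (\<lambda>q. contact_alt n (\<lambda>a. t a q) (\<lambda>a b. B a b q) id) =
    (\<Sum>\<sigma> | \<sigma> permutes {0..2 * n}. of_int (sign \<sigma>) *
      (u (t (\<sigma> 0)) * (\<Prod>k = 1..n. B (\<sigma> (2 * k - 1)) (\<sigma> (2 * k)) p) +
       t (\<sigma> 0) p * (\<Sum>k = 1..n. u (B (\<sigma> (2 * k - 1)) (\<sigma> (2 * k))) *
          (\<Prod>j\<in>{1..n} - {k}. B (\<sigma> (2 * j - 1)) (\<sigma> (2 * j)) p))))"
proof -
  let ?P = "\<lambda>\<sigma> q. \<Prod>k = 1..n. B (\<sigma> (2 * k - 1)) (\<sigma> (2 * k)) q"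
  have P: "smooth_near A p (?P \<sigma>)" for \<sigma> :: "nat \<Rightarrow> nat" by (rule smooth_near_prod[OF B])
  have tP: "smooth_near A p (\<lambda>q. t (\<sigma> 0) q * ?P \<sigma> q)" for \<sigma> :: "nat \<Rightarrow> nat"
    by (rule smooth_near_mult[OF t P])
  have "u (\<lambda>q. contact_alt n (\<lambda>a. t a q) (\<lambda>a b. B a b q) id) =
      u (\<lambda>q. \<Sum>\<sigma> | \<sigma> permutes {0..2 * n}. of_int (sign \<sigma>) * (t (\<sigma> 0) q * ?P \<sigma> q))"
    by (simp add: contact_alt_def contact_term_def)
  also have "\<dots> = (\<Sum>\<sigma> | \<sigma> permutes {0..2 * n}. u (\<lambda>q. of_int (sign \<sigma>) * (t (\<sigma> 0) q * ?P \<sigma> q)))"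
    by (rule tangent_vector_sum[OF u smooth_near_mult[OF smooth_near_const tP]])
  also have "\<dots> = (\<Sum>\<sigma> | \<sigma> permutes {0..2 * n}. of_int (sign \<sigma>) *
      (u (t (\<sigma> 0)) * ?P \<sigma> p + t (\<sigma> 0) p * (\<Sum>k = 1..n. u (B (\<sigma> (2 * k - 1)) (\<sigma> (2 * k))) *
          (\<Prod>j\<in>{1..n} - {k}. B (\<sigma> (2 * j - 1)) (\<sigma> (2 * j)) p))))"
  proof (rule sum.cong[OF refl])
    fix \<sigma> :: "nat \<Rightarrow> nat"
    have "u (\<lambda>q. of_int (sign \<sigma>) * (t (\<sigma> 0) q * ?P \<sigma> q)) =
        of_int (sign \<sigma>) * (t (\<sigma> 0) p * u (?P \<sigma>) + u (t (\<sigma> 0)) * ?P \<sigma> p)"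
      unfolding tangent_vector_cmult[OF u tP] tangent_vector_mult[OF u t P] by (rule refl)
    also have "u (?P \<sigma>) = (\<Sum>k = 1..n. u (B (\<sigma> (2 * k - 1)) (\<sigma> (2 * k))) *
          (\<Prod>j\<in>{1..n} - {k}. B (\<sigma> (2 * j - 1)) (\<sigma> (2 * j)) p))"
      by (rule tangent_vector_prod[OF u finite_atLeastAtMost B])
    finally show "u (\<lambda>q. of_int (sign \<sigma>) * (t (\<sigma> 0) q * ?P \<sigma> q)) = of_int (sign \<sigma>) *
      (u (t (\<sigma> 0)) * ?P \<sigma> p + t (\<sigma> 0) p * (\<Sum>k = 1..n. u (B (\<sigma> (2 * k - 1)) (\<sigma> (2 * k))) *
          (\<Prod>j\<in>{1..n} - {k}. B (\<sigma> (2 * j - 1)) (\<sigma> (2 * j)) p)))"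
      by (simp only: add.commute)
  qed
  finally show ?thesis .
qed

section \<open>The orthonormal frame \<open>Z, X 1, ..., X (2 * n)\<close> and the matrix of
  \<open>d\<theta>\<close> in it\<close>

locale horizontal_frame = contact_riemannian A n \<theta> Z g J
  for A :: "('m::{t2_space, second_countable_topology}, 'e::euclidean_space) chart set"
    and n \<theta> Z g J +
  fixes U :: "'m set" and X :: "nat \<Rightarrow> 'm vfield"
    and w :: "nat \<Rightarrow> nat \<Rightarrow> nat \<Rightarrow> 'm \<Rightarrow> real" and \<gamma> \<delta> :: "nat \<Rightarrow> nat \<Rightarrow> 'm \<Rightarrow> real"
  assumes frame: "horizontal_orthonormal_frame A n \<theta> g U X"
    and bracket_X: "\<And>i j p. i \<in> {1..2 * n} \<Longrightarrow> j \<in> {1..2 * n} \<Longrightarrow> p \<in> U \<Longrightarrow>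
      lie_bracket A (X i) (X j) p =
        (\<lambda>h. (\<Sum>k = 1..2 * n. w i j k p * X k p h) + \<gamma> i j p * Z p h)"
    and bracket_Z: "\<And>i p. i \<in> {1..2 * n} \<Longrightarrow> p \<in> U \<Longrightarrow>
      lie_bracket A (X i) Z p = (\<lambda>h. \<Sum>j = 1..2 * n. \<delta> i j p * X j p h)"
begin

definition E :: "nat \<Rightarrow> 'm vfield" where
  "E i = (if i = 0 then Z else X i)"

text \<open>The coefficients of \<open>[X i, E j]\<close> in the frame \<open>E\<close>. Index 0
  stands for the Reeb direction, and the entry at \<open>j = k = 0\<close> is 0 because
  \<open>[X i, Z]\<close> is horizontal.\<close>

definition bracket_coeff :: "nat \<Rightarrow> nat \<Rightarrow> nat \<Rightarrow> 'm \<Rightarrow> real" where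
  "bracket_coeff i j k = (if j = 0 then (if k = 0 then (\<lambda>p. 0) else \<delta> i k)
     else if k = 0 then \<gamma> i j else w i j k)"

lemma frame_open: "open U"
  using frame by (simp add: horizontal_orthonormal_frame_def)

lemma X_smooth: "i \<in> {1..2 * n} \<Longrightarrow> smooth_vfield_on A U (X i)"
  using frame by (simp add: horizontal_orthonormal_frame_def)

lemma X_horizontal: "i \<in> {1..2 * n} \<Longrightarrow> p \<in> U \<Longrightarrow> X i p \<in> tangent_space A p \<and> \<theta> p (X i p) = 0"
  using frame by (simp add: horizontal_orthonormal_frame_def horizontal_space_def)

lemma E_smooth: "i \<in> {0..2 * n} \<Longrightarrow> smooth_vfield_on A U (E i)"
  using X_smooth[of i] smooth_vfield_on_subset[OF reeb_smooth frame_open subset_UNIV]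
  by (cases "i = 0") (simp_all add: E_def)

lemma E_tangent: "i \<in> {0..2 * n} \<Longrightarrow> p \<in> U \<Longrightarrow> E i p \<in> tangent_space A p"
  by (rule smooth_vfield_tangent[OF E_smooth])

lemma theta_E: "i \<in> {0..2 * n} \<Longrightarrow> p \<in> U \<Longrightarrow> \<theta> p (E i p) = (if i = 0 then 1 else 0)"
  using X_horizontal[of i p] by (simp add: E_def theta_reeb)

lemma E_orthonormal:
  assumes "i \<in> {0..2 * n}" "j \<in> {0..2 * n}" "p \<in> U"
  shows "g p (E i p) (E j p) = (if i = j then 1 else 0)"
proof -
  have 0: "g p (E k p) (E 0 p) = (if k = 0 then 1 else 0)" if "k \<in> {0..2 * n}" for k
    using g_reeb[OF E_tangent[OF that assms(3)]] theta_E[OF that assms(3)] by (simp add: E_def)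
  consider "j = 0" | "i = 0" "j \<noteq> 0" | "i \<noteq> 0" "j \<noteq> 0" by blast
  then show ?thesis
  proof cases
    case 1
    then show ?thesis using 0[OF assms(1)] by simp
  next
    case 2
    then show ?thesis
      using 0[OF assms(2)] g_sym[OF E_tangent[OF assms(1,3)] E_tangent[OF assms(2,3)]] by simp
  next
    case 3
    then show ?thesis using frame assms by (simp add: E_def horizontal_orthonormal_frame_def)
  qed
qed

lemma sum_from_0: "(\<Sum>i\<in>{0..2 * n}. h i) = h 0 + (\<Sum>i = 1..2 * n. h i)" for h :: "nat \<Rightarrow> real"
  by (simp add: sum.atLeast_Suc_atMost)

text \<open>Subtracting \<open>\<theta>(u) Z\<close> leaves a horizontal vector, which the
  \<open>X i\<close> span; orthonormality then identifies the coefficients.\<close>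

lemma E_expansion:
  assumes u: "u \<in> tangent_space A p" and p: "p \<in> U"
  shows "u = (\<lambda>f. \<Sum>j\<in>{0..2 * n}. g p u (E j p) * E j p f)"
proof -
  let ?h = "\<lambda>f. 1 * u f + (- \<theta> p u) * Z p f"
  have "\<theta> p ?h = 0"
    using linear_on_tangentD[OF theta_linear u reeb_tangent, of 1 "- \<theta> p u"] by (simp add: theta_reeb)
  then have "?h \<in> horizontal_space A \<theta> p"
    unfolding horizontal_space_def using tangent_space_lincomb[OF u reeb_tangent, of 1 "- \<theta> p u"]
    by blast
  then obtain c where c: "?h = (\<lambda>f. \<Sum>i = 1..2 * n. c i * X i p f)"
    using frame p unfolding horizontal_orthonormal_frame_def by blast
  define r where "r j = (if j = 0 then \<theta> p u else c j)" for j
  have ur: "u = (\<lambda>f. \<Sum>j\<in>{0..2 * n}. r j * E j p f)"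
  proof
    fix f
    have "u f = \<theta> p u * Z p f + (\<Sum>i = 1..2 * n. c i * X i p f)" using fun_cong[OF c, of f] by simp
    then show "u f = (\<Sum>j\<in>{0..2 * n}. r j * E j p f)"
      unfolding sum_from_0 by (simp add: r_def E_def)
  qed
  have "g p u (E j p) = r j" if j: "j \<in> {0..2 * n}" for j
  proof -
    have "g p u (E j p) = (\<Sum>i\<in>{0..2 * n}. r i * g p (E i p) (E j p))"
      by (rule trans[OF arg_cong[OF ur, of "\<lambda>v. g p v (E j p)"]])
        (rule g_sum_left[OF E_tangent[OF j p] E_tangent[OF _ p]])
    also have "\<dots> = (\<Sum>i\<in>{0..2 * n}. if i = j then r i else 0)"
      by (rule sum.cong[OF refl]) (simp add: E_orthonormal[OF _ j p])
    finally show ?thesis using j by simp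
  qed
  then have "(\<lambda>f. \<Sum>j\<in>{0..2 * n}. g p u (E j p) * E j p f) = (\<lambda>f. \<Sum>j\<in>{0..2 * n}. r j * E j p f)"
    by simp
  with ur show ?thesis by (rule trans[OF _ sym])
qed

lemma bracket_E:
  assumes "i \<in> {1..2 * n}" "j \<in> {0..2 * n}" "p \<in> U"
  shows "lie_bracket A (X i) (E j) p = (\<lambda>h. \<Sum>k\<in>{0..2 * n}. bracket_coeff i j k p * E k p h)"
proof (cases "j = 0")
  case True
  then show ?thesis unfolding sum_from_0 using bracket_Z[OF assms(1,3)]
    by (simp add: E_def bracket_coeff_def)
next
  case False
  then have "j \<in> {1..2 * n}" using assms(2) by simp
  from bracket_X[OF assms(1) this assms(3)] False show ?thesis
    unfolding sum_from_0 by (simp add: E_def bracket_coeff_def add.commute)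
qed

lemma bracket_E_tangent:
  assumes "i \<in> {1..2 * n}" "j \<in> {0..2 * n}" "p \<in> U"
  shows "lie_bracket A (X i) (E j) p \<in> tangent_space A p"
  unfolding bracket_E[OF assms] by (rule tangent_space_sum[OF E_tangent[OF _ assms(3)]])

text \<open>By orthonormality the coefficient is the inner product of the bracket with
  \<open>E k\<close>, and the metric of two smooth fields is smooth. This is the source of
  smoothness for \<open>w\<close> and \<open>\<delta>\<close>.\<close>

lemma bracket_coeff_smooth:
  assumes i: "i \<in> {1..2 * n}" and j: "j \<in> {0..2 * n}" and k: "k \<in> {0..2 * n}"
  shows "smooth_fun_on A U (bracket_coeff i j k)"
proof (rule smooth_fun_on_cong)
  show "smooth_fun_on A U (\<lambda>p. g p (lie_bracket A (X i) (E j) p) (E k p))"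
    by (rule g_smooth[OF lie_bracket_smooth[OF X_smooth[OF i] E_smooth[OF j] bracket_E_tangent[OF i j]]
          E_smooth[OF k]])
  fix p assume p: "p \<in> U"
  have "g p (lie_bracket A (X i) (E j) p) (E k p) =
      (\<Sum>l\<in>{0..2 * n}. bracket_coeff i j l p * g p (E l p) (E k p))"
    unfolding bracket_E[OF i j p] by (rule g_sum_left[OF E_tangent[OF k p] E_tangent[OF _ p]])
  also have "\<dots> = (\<Sum>l\<in>{0..2 * n}. if l = k then bracket_coeff i j l p else 0)"
    by (rule sum.cong[OF refl]) (simp add: E_orthonormal[OF _ k p])
  finally show "g p (lie_bracket A (X i) (E j) p) (E k p) = bracket_coeff i j k p" using k by simp
qed

lemma w_smooth:
  "i \<in> {1..2 * n} \<Longrightarrow> j \<in> {1..2 * n} \<Longrightarrow> k \<in> {1..2 * n} \<Longrightarrow> smooth_fun_on A U (w i j k)"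
  using bracket_coeff_smooth[of i j k] by (simp add: bracket_coeff_def)

lemma \<delta>_smooth: "i \<in> {1..2 * n} \<Longrightarrow> j \<in> {1..2 * n} \<Longrightarrow> smooth_fun_on A U (\<delta> i j)"
  using bracket_coeff_smooth[of i 0 j] by (simp add: bracket_coeff_def)

text \<open>The matrix of \<open>d\<theta>\<close> in the frame, written through \<open>g\<close>
  and \<open>J\<close> so that the identity for \<open>J^2\<close> becomes an identity of
  matrices.\<close>

definition dtheta :: "nat \<Rightarrow> nat \<Rightarrow> 'm \<Rightarrow> real" where
  "dtheta i j p = g p (E i p) (J p (E j p))"

lemma dtheta_smooth:
  "i \<in> {0..2 * n} \<Longrightarrow> j \<in> {0..2 * n} \<Longrightarrow> smooth_fun_on A U (dtheta i j)"
  unfolding dtheta_def by (rule g_smooth[OF E_smooth J_smooth[OF E_smooth]])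

text \<open>The functions \<open>\<theta>(E k)\<close> are constant on \<open>U\<close>, so only the
  bracket term of the exterior derivative remains.\<close>

lemma dtheta_eq:
  assumes "i \<in> {0..2 * n}" "j \<in> {0..2 * n}" "p \<in> U"
  shows "dtheta i j p = - \<theta> p (lie_bracket A (E i) (E j) p)"
proof -
  have *: "E k p (\<lambda>q. \<theta> q (E l q)) = 0" if "k \<in> {0..2 * n}" "l \<in> {0..2 * n}" for k l
  proof -
    have "E k p (\<lambda>q. \<theta> q (E l q)) = E k p (\<lambda>q. if l = 0 then 1 else 0)"
      by (rule tangent_vector_cong[OF E_tangent[OF that(1) assms(3)] frame_open assms(3)])
        (simp add: theta_E[OF that(2)])
    then show ?thesis using tangent_vector_const[OF E_tangent[OF that(1) assms(3)]] by simp
  qed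
  show ?thesis
    unfolding dtheta_def g_J[OF E_smooth[OF assms(1)] E_smooth[OF assms(2)] assms(3)] ext_deriv_def
    using *[OF assms(1,2)] *[OF assms(2,1)] by simp
qed

lemma theta_bracket_skew:
  assumes "lie_bracket A Y V p \<in> tangent_space A p"
  shows "\<theta> p (lie_bracket A V Y p) = - \<theta> p (lie_bracket A Y V p)"
proof -
  have "lie_bracket A V Y p = (\<lambda>f. (- 1) * lie_bracket A Y V p f + 0 * lie_bracket A Y V p f)"
    by (auto simp: lie_bracket_def)
  then have "\<theta> p (lie_bracket A V Y p) =
      \<theta> p (\<lambda>f. (- 1) * lie_bracket A Y V p f + 0 * lie_bracket A Y V p f)"
    by (rule arg_cong)
  also have "\<dots> = - 1 * \<theta> p (lie_bracket A Y V p) + 0 * \<theta> p (lie_bracket A Y V p)"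
    by (rule linear_on_tangentD[OF theta_linear assms assms])
  finally show ?thesis by simp
qed

text \<open>Comes from skewness of the bracket. Linearity of \<open>\<theta>\<close> needs a tangent
  bracket, which \<open>bracket_E_tangent\<close> supplies only with some \<open>X i\<close> in
  first place; hence the case distinction, with \<open>[Z, Z] = 0\<close> apart.\<close>

lemma dtheta_skew:
  assumes i: "i \<in> {0..2 * n}" and j: "j \<in> {0..2 * n}" and p: "p \<in> U"
  shows "dtheta i j p = - dtheta j i p"
proof -
  have *: "dtheta k l p = - dtheta l k p" if "k \<in> {1..2 * n}" "l \<in> {0..2 * n}" for k l
  proof -
    have k: "k \<in> {0..2 * n}" "E k = X k" using that by (auto simp: E_def)
    show ?thesis
      unfolding dtheta_eq[OF k(1) that(2) p] dtheta_eq[OF that(2) k(1) p]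
      using theta_bracket_skew[OF bracket_E_tangent[OF that p]] k(2) by simp
  qed
  have 00: "dtheta 0 0 p = 0"
  proof -
    have "lie_bracket A (E 0) (E 0) p = (\<lambda>f. 0)" by (auto simp: lie_bracket_def)
    then show ?thesis
      using dtheta_eq[of 0 0 p] p linear_on_tangent_zero[OF theta_linear] by simp
  qed
  consider "i = 0" "j = 0" | "i \<in> {1..2 * n}" | "j \<in> {1..2 * n}" using i j by fastforce
  then show ?thesis
  proof cases
    case 1
    then show ?thesis using 00 by simp
  next
    case 2
    then show ?thesis using *[OF 2 j] by simp
  next
    case 3
    then show ?thesis using *[OF 3 i] by simp
  qed
qed

text \<open>The structure equation gives \<open>[X i, Z]\<close> no Reeb component, so
  \<open>\<theta>\<close> vanishes on it.\<close>

lemma dtheta_0: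
  assumes "i \<in> {0..2 * n}" "p \<in> U"
  shows "dtheta i 0 p = 0"
proof (cases "i = 0")
  case True
  then show ?thesis using dtheta_skew[of 0 0 p] assms by simp
next
  case False
  then have i: "i \<in> {1..2 * n}" "E i = X i" using assms by (auto simp: E_def)
  have "\<theta> p (lie_bracket A (X i) (E 0) p) = (\<Sum>j = 1..2 * n. \<delta> i j p * \<theta> p (X j p))"
    using bracket_Z[OF i(1) assms(2)] X_horizontal[OF _ assms(2)]
      linear_on_tangent_sum[OF theta_linear, of "{1..2 * n}" "\<lambda>j. X j p" p "\<lambda>j. \<delta> i j p"]
    by (simp add: E_def)
  also have "\<dots> = 0" using X_horizontal[OF _ assms(2)] by (intro sum.neutral) simp
  finally show ?thesis using dtheta_eq[of i 0 p] assms i(2) by simp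
qed

lemma J_E:
  assumes "j \<in> {0..2 * n}" "p \<in> U"
  shows "J p (E j p) = (\<lambda>f. \<Sum>i\<in>{0..2 * n}. dtheta i j p * E i p f)"
proof -
  note t = J_tangent[OF E_tangent[OF assms]]
  have "g p (J p (E j p)) (E i p) = dtheta i j p" if "i \<in> {0..2 * n}" for i
    unfolding dtheta_def by (rule g_sym[OF t E_tangent[OF that assms(2)]])
  then have "(\<lambda>f. \<Sum>i\<in>{0..2 * n}. g p (J p (E j p)) (E i p) * E i p f) =
      (\<lambda>f. \<Sum>i\<in>{0..2 * n}. dtheta i j p * E i p f)" by simp
  then show ?thesis by (rule trans[OF E_expansion[OF t assms(2)]])
qed

text \<open>The matrix form of \<open>J^2 = - I + \<theta> \<otimes> Z\<close>, obtained by
  computing \<open>g(E i, J J (E j))\<close> in two ways.\<close>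

lemma dtheta_square:
  assumes i: "i \<in> {0..2 * n}" and j: "j \<in> {0..2 * n}" and p: "p \<in> U"
  shows "(\<Sum>k\<in>{0..2 * n}. dtheta i k p * dtheta k j p) = (if i = j \<and> j \<noteq> 0 then - 1 else 0)"
proof -
  note ET = E_tangent[OF _ p]
  have "J p (J p (E j p)) = (\<lambda>f. \<Sum>k\<in>{0..2 * n}. dtheta k j p * J p (E k p) f)"
    by (rule trans[OF arg_cong[OF J_E[OF j p], of "J p"]]) (rule J_sum[OF finite_atLeastAtMost ET])
  then have "g p (E i p) (J p (J p (E j p))) =
      g p (E i p) (\<lambda>f. \<Sum>k\<in>{0..2 * n}. dtheta k j p * J p (E k p) f)"
    by (rule arg_cong)
  also have "\<dots> = (\<Sum>k\<in>{0..2 * n}. dtheta k j p * dtheta i k p)"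
    unfolding dtheta_def[of i] by (rule g_sum_right[OF ET[OF i] J_tangent[OF ET]])
  finally have 1: "g p (E i p) (J p (J p (E j p))) = (\<Sum>k\<in>{0..2 * n}. dtheta k j p * dtheta i k p)" .
  have "J p (J p (E j p)) = (\<lambda>f. (- 1) * E j p f + \<theta> p (E j p) * Z p f)"
    using J_J[OF ET[OF j]] by simp
  then have "g p (E i p) (J p (J p (E j p))) = g p (E i p) (\<lambda>f. (- 1) * E j p f + \<theta> p (E j p) * Z p f)"
    by (rule arg_cong)
  also have "\<dots> = (- 1) * g p (E i p) (E j p) + \<theta> p (E j p) * g p (E i p) (Z p)"
    by (rule linear_on_tangentD[OF g_linear[OF ET[OF i]] ET[OF j] reeb_tangent])
  also have "\<dots> = (if i = j \<and> j \<noteq> 0 then - 1 else 0)"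
    unfolding g_reeb[OF ET[OF i]] using E_orthonormal[OF i j p] theta_E[OF i p] theta_E[OF j p] by simp
  finally show ?thesis using 1 by (simp add: mult.commute)
qed

end

section \<open>Derivative of the chart density along the frame\<close>

locale frame_chart = horizontal_frame A n \<theta> Z g J U X w \<gamma> \<delta> + contact_chart A n \<theta> Z g J c e
  for A :: "('m::{t2_space, second_countable_topology}, 'e::euclidean_space) chart set"
    and n \<theta> Z g J U X w \<gamma> \<delta> c e
begin

abbreviation W :: "'m set" where "W \<equiv> U \<inter> fst c"

lemma W_open: "open W"
  by (intro open_Int frame_open chart_open chart)

text \<open>In coordinates the divergence of \<open>X i\<close> is the sum of the
  \<open>\<partial>_a\<close> of its components plus the logarithmic derivative of the density. The
  latter is the trace of the matrix \<open>K\<close> from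
  \<open>frame_change_generator\<close>.\<close>

lemma volume_density_derivative:
  assumes i: "i \<in> {1..2 * n}" and p: "p \<in> W"
  shows "X i p volume_density =
    - ((\<Sum>a\<in>{0..2 * n}. coord_field a p (\<lambda>q. X i q (coord a))) + (\<Sum>k = 1..2 * n. w i k k p)) *
      volume_density p"
proof -
  let ?I = "{0..2 * n}" and ?y = "X i p"
  have pU: "p \<in> U" and pc: "p \<in> fst c" using p by auto
  have y: "?y \<in> tangent_space A p" by (rule smooth_vfield_tangent[OF X_smooth[OF i] pU])
  \<comment> \<open>\<open>M\<close> and \<open>N\<close> are the mutually inverse transition
    matrices between the coordinate frame and \<open>E\<close>. In terms of them,
    \<open>M a 0\<close> is \<open>\<theta>\<close> on the coordinate field \<open>a\<close>, and
    \<open>O'\<close>, the product of \<open>M\<close>, \<open>dtheta\<close> and the transpose of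
    \<open>M\<close>, is the matrix of \<open>d\<theta>\<close> in coordinates.\<close>
  define M where "M a j q = g q (coord_field a q) (E j q)" for a j q
  define N where "N j a q = E j q (coord a)" for j a q
  define D where "D b a = coord_field b p (\<lambda>q. X i q (coord a))" for a b
  define B where "B j k = bracket_coeff i j k p" for j k
  define O' where "O' a b q = (\<Sum>k\<in>?I. \<Sum>l\<in>?I. M a k q * M b l q * dtheta k l q)" for a b q
  have ET: "E j q \<in> tangent_space A q" if "j \<in> ?I" "q \<in> W" for j q
    using E_tangent[OF that(1)] that(2) by blast
  have CT: "coord_field a q \<in> tangent_space A q" if "q \<in> W" for a q
    using coord_field_tangent that by blast
  have Ms: "smooth_near A p (M a j)" if "j \<in> ?I" for a j
    unfolding M_def
    by (rule smooth_nearI[OF g_smooth[OF smooth_vfield_on_subset[OF coord_field_smooth W_open Int_lower2]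
            smooth_vfield_on_subset[OF E_smooth[OF that] W_open Int_lower1]] p])
  have cs: "smooth_near A p (coord a)" for a by (rule smooth_nearI[OF coord_smooth pc])
  have Ns: "smooth_near A p (N j a)" if "j \<in> ?I" for a j
    unfolding N_def by (rule smooth_vfield_apply_near[OF E_smooth[OF that] pU cs])
  have Gs: "smooth_near A p (dtheta k l)" if "k \<in> ?I" "l \<in> ?I" for k l
    by (rule smooth_nearI[OF dtheta_smooth[OF that] pU])
  have NM: "(\<Sum>a\<in>?I. N j a q * M a k q) = (if j = k then 1 else 0)"
    if "j \<in> ?I" "k \<in> ?I" "q \<in> W" for j k q
  proof -
    have q: "q \<in> U" "q \<in> fst c" using that by auto
    have "g q (E j q) (E k q) = (\<Sum>a\<in>?I. N j a q * M a k q)"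
      unfolding N_def M_def
      by (rule trans[OF arg_cong[OF coord_expansion[OF ET[OF that(1,3)] q(2)], of "\<lambda>u. g q u (E k q)"]])
        (rule g_sum_left[OF ET[OF that(2,3)] CT[OF that(3)]])
    then show ?thesis using E_orthonormal[OF that(1,2) q(1)] by simp
  qed
  have MN: "(\<Sum>j\<in>?I. M a j q * N j b q) = (if a = b then 1 else 0)"
    if "a \<in> ?I" "b \<in> ?I" "q \<in> W" for a b q
  proof -
    have q: "q \<in> U" "q \<in> fst c" using that by auto
    have "coord_field a q (coord b) = (\<Sum>j\<in>?I. M a j q * N j b q)"
      unfolding M_def N_def by (rule fun_cong[OF E_expansion[OF CT[OF that(3)] q(1)]])
    then show ?thesis using coord_field_coord[OF q(2) that(1,2)] by simp
  qed
  have const: "?y h = 0" if "\<And>q. q \<in> W \<Longrightarrow> h q = k" for h k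
    using tangent_vector_cong[OF y W_open p, of h "\<lambda>q. k"] that tangent_vector_const[OF y] by simp
  have MN': "(\<Sum>j\<in>?I. ?y (M a j) * N j a p + M a j p * ?y (N j a)) = 0" if "a \<in> ?I" for a
  proof -
    have "?y (\<lambda>q. \<Sum>j\<in>?I. M a j q * N j a q) = 0"
      by (rule const[where k=1]) (simp add: MN[OF that that])
    moreover have "?y (\<lambda>q. \<Sum>j\<in>?I. M a j q * N j a q) = (\<Sum>j\<in>?I. ?y (\<lambda>q. M a j q * N j a q))"
      by (rule tangent_vector_sum[OF y smooth_near_mult[OF Ms Ns]])
    moreover have "\<dots> = (\<Sum>j\<in>?I. M a j p * ?y (N j a) + ?y (M a j) * N j a p)"
      by (rule sum.cong[OF refl]) (rule tangent_vector_mult[OF y Ms Ns])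
    ultimately show ?thesis by (simp add: add.commute)
  qed
  \<comment> \<open>\<open>N j a\<close> is \<open>E j\<close> applied to the coordinate
    \<open>a\<close>. Moving \<open>X i\<close> past \<open>E j\<close> costs the bracket, which
    gives the \<open>B\<close> part; what remains is \<open>E j\<close> acting on a component of
    \<open>X i\<close>, the \<open>D\<close> part.\<close>
  have N': "?y (N j a) = (\<Sum>b\<in>?I. N j b p * D b a) + (\<Sum>k\<in>?I. B j k * N k a p)"
    if j: "j \<in> ?I" and "a \<in> ?I" for j a
  proof -
    have "lie_bracket A (X i) (E j) p (coord a) = (\<Sum>k\<in>?I. B j k * N k a p)"
      unfolding B_def N_def by (rule fun_cong[OF bracket_E[OF i j pU]])
    then have "?y (N j a) - E j p (\<lambda>q. X i q (coord a)) = (\<Sum>k\<in>?I. B j k * N k a p)"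
      using cs[of a] by (simp add: lie_bracket_def vapp_def N_def[abs_def])
    moreover have "E j p (\<lambda>q. X i q (coord a)) = (\<Sum>b\<in>?I. N j b p * D b a)"
      unfolding N_def D_def by (rule fun_cong[OF coord_expansion[OF ET[OF j p] pc]])
    ultimately show ?thesis by simp
  qed
  have Gskew: "?y (dtheta k l) = - ?y (dtheta l k)" if "k \<in> ?I" "l \<in> ?I" for k l
  proof -
    have "?y (dtheta k l) = ?y (\<lambda>q. (- 1) * dtheta l k q)"
      by (rule tangent_vector_cong[OF y frame_open pU]) (simp add: dtheta_skew[OF that])
    then show ?thesis using tangent_vector_cmult[OF y Gs[OF that(2,1)], of "-1"] by simp
  qed
  have GG': "(\<Sum>k\<in>?I. \<Sum>l\<in>?I. ?y (dtheta k l) * dtheta k l p) = 0"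
  proof -
    \<comment> \<open>By skewness the squared length of row \<open>k\<close> is minus the diagonal
      entry of the squared matrix, hence 1 for \<open>k \<noteq> 0\<close>.\<close>
    have "(\<Sum>k\<in>?I. \<Sum>l\<in>?I. dtheta k l q * dtheta k l q) = (\<Sum>k\<in>?I. if k \<noteq> 0 then 1 else 0)"
      if "q \<in> W" for q
    proof (rule sum.cong[OF refl])
      fix k assume k: "k \<in> ?I"
      have "(\<Sum>l\<in>?I. dtheta k l q * dtheta k l q) = - (\<Sum>l\<in>?I. dtheta k l q * dtheta l k q)"
        unfolding sum_negf[symmetric]
      proof (rule sum.cong[OF refl])
        fix l assume "l \<in> ?I"
        from dtheta_skew[OF this k] that
        show "dtheta k l q * dtheta k l q = - (dtheta k l q * dtheta l k q)" by simp
      qed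
      then show "(\<Sum>l\<in>?I. dtheta k l q * dtheta k l q) = (if k \<noteq> 0 then 1 else 0)"
        using dtheta_square[OF k k] that by simp
    qed
    then have "?y (\<lambda>q. \<Sum>k\<in>?I. \<Sum>l\<in>?I. dtheta k l q * dtheta k l q) = 0" by (rule const)
    moreover have "?y (\<lambda>q. \<Sum>k\<in>?I. \<Sum>l\<in>?I. dtheta k l q * dtheta k l q) =
        (\<Sum>k\<in>?I. \<Sum>l\<in>?I. 2 * (?y (dtheta k l) * dtheta k l p))"
      by (subst tangent_vector_sum[OF y smooth_near_sum[OF smooth_near_mult[OF Gs Gs]]], assumption+,
          rule sum.cong[OF refl],
          subst tangent_vector_sum[OF y smooth_near_mult[OF Gs Gs]], assumption+,
          rule sum.cong[OF refl], subst tangent_vector_mult[OF y Gs Gs]) simp_all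
    ultimately show ?thesis by (simp add: sum_distrib_left[symmetric])
  qed
  have I0: "0 \<in> ?I" by simp
  have G'0: "?y (dtheta k 0) = 0" if "k \<in> ?I" for k
    by (rule const[where k=0]) (simp add: dtheta_0[OF that])
  show ?thesis
  proof (rule frame_change_generator[where I="?I" and M="\<lambda>a j. M a j p" and N="\<lambda>j a. N j a p"
        and M'="\<lambda>a j. ?y (M a j)" and N'="\<lambda>j a. ?y (N j a)" and G="\<lambda>k l. dtheta k l p"
        and G'="\<lambda>k l. ?y (dtheta k l)" and B=B and D=D, OF finite_atLeastAtMost I0
        NM[OF _ _ p] MN[OF _ _ p] MN' N' dtheta_skew[OF _ _ pU] Gskew dtheta_0[OF _ pU] G'0
        dtheta_square[OF _ _ pU] GG'], assumption+, goal_cases)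
    case (1 K)
    note K = 1
    have tM: "\<theta> q (coord_field a q) = M a 0 q" if "q \<in> W" for a q
      unfolding M_def using g_reeb[OF CT[OF that]] by (simp add: E_def)
    have O'eq: "g q (coord_field a q) (J q (coord_field b q)) = O' a b q" if q: "q \<in> W" for a b q
    proof -
      have qU: "q \<in> U" using q by auto
      have ex: "coord_field a q = (\<lambda>f. \<Sum>k\<in>?I. M a k q * E k q f)" for a
        unfolding M_def by (rule E_expansion[OF CT[OF q] qU])
      have Jex: "J q (coord_field b q) = (\<lambda>f. \<Sum>l\<in>?I. M b l q * J q (E l q) f)"
        by (rule trans[OF arg_cong[OF ex, of "J q"]]) (rule J_sum[OF finite_atLeastAtMost ET[OF _ q]])
      have "g q (coord_field a q) (J q (coord_field b q)) =
          (\<Sum>k\<in>?I. M a k q * g q (E k q) (J q (coord_field b q)))"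
        by (rule trans[OF arg_cong[OF ex, of "\<lambda>u. g q u (J q (coord_field b q))"]])
          (rule g_sum_left[OF J_tangent[OF CT[OF q]] ET[OF _ q]])
      also have "\<dots> = O' a b q" unfolding O'_def
      proof (rule sum.cong[OF refl])
        fix k assume k: "k \<in> ?I"
        have "g q (E k q) (J q (coord_field b q)) = (\<Sum>l\<in>?I. M b l q * dtheta k l q)"
          unfolding dtheta_def
          by (rule trans[OF arg_cong[OF Jex, of "g q (E k q)"]])
            (rule g_sum_right[OF ET[OF k q] J_tangent[OF ET[OF _ q]]])
        then show "M a k q * g q (E k q) (J q (coord_field b q)) =
            (\<Sum>l\<in>?I. M a k q * M b l q * dtheta k l q)"
          by (simp add: sum_distrib_left mult.assoc)
      qed
      finally show ?thesis .
  qed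
  have vol: "volume_density q = 1 / 2 ^ n * contact_alt n (\<lambda>a. M a 0 q) (\<lambda>a b. O' a b q) id"
    if q: "q \<in> W" for q
  proof -
    have "volume_density q = 1 / 2 ^ n * contact_alt n (\<theta> q) (\<lambda>u v. g q u (J q v)) (\<lambda>a. coord_field a q)"
      using volume_density_eq q by blast
    then show ?thesis
      unfolding contact_alt_reindex[of n "\<theta> q"] tM[OF q] O'eq[OF q] .
  qed
  have MMG: "smooth_near A p (\<lambda>q. M a k q * M b l q * dtheta k l q)"
    if "k \<in> ?I" "l \<in> ?I" for a b k l
    by (rule smooth_near_mult[OF smooth_near_mult[OF Ms Ms] Gs]) (use that in auto)
  have O's: "smooth_near A p (O' a b)" for a b
    unfolding O'_def by (rule smooth_near_sum[OF smooth_near_sum[OF MMG]])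
  have M0s: "smooth_near A p (M a 0)" for a by (rule Ms) simp
  have O'': "?y (O' a b) = (\<Sum>c\<in>?I. K a c * O' c b p) + (\<Sum>c\<in>?I. K b c * O' a c p)"
    if "a \<in> ?I" "b \<in> ?I" for a b
  proof -
    have "?y (\<lambda>q. \<Sum>k\<in>?I. \<Sum>l\<in>?I. M a k q * M b l q * dtheta k l q) =
        (\<Sum>k\<in>?I. ?y (\<lambda>q. \<Sum>l\<in>?I. M a k q * M b l q * dtheta k l q))"
      by (rule tangent_vector_sum[OF y smooth_near_sum[OF MMG]])
    also have "\<dots> = (\<Sum>k\<in>?I. \<Sum>l\<in>?I. ?y (\<lambda>q. M a k q * M b l q * dtheta k l q))"
      by (rule sum.cong[OF refl]) (rule tangent_vector_sum[OF y MMG])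
    also have "\<dots> = (\<Sum>k\<in>?I. \<Sum>l\<in>?I. ?y (M a k) * M b l p * dtheta k l p
        + M a k p * ?y (M b l) * dtheta k l p + M a k p * M b l p * ?y (dtheta k l))"
    proof (intro sum.cong refl)
      fix k l assume kl: "k \<in> ?I" "l \<in> ?I"
      show "?y (\<lambda>q. M a k q * M b l q * dtheta k l q) = ?y (M a k) * M b l p * dtheta k l p
        + M a k p * ?y (M b l) * dtheta k l p + M a k p * M b l p * ?y (dtheta k l)"
        unfolding tangent_vector_mult[OF y smooth_near_mult[OF Ms[OF kl(1)] Ms[OF kl(2)]] Gs[OF kl]]
          tangent_vector_mult[OF y Ms[OF kl(1)] Ms[OF kl(2)]]
        by (simp add: algebra_simps)
    qed
    also have "\<dots> = (\<Sum>c\<in>?I. K a c * O' c b p) + (\<Sum>c\<in>?I. K b c * O' a c p)"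
      unfolding O'_def by (rule K(2)[OF that])
    finally show ?thesis unfolding O'_def[of a b, abs_def] .
  qed
  have "?y volume_density = ?y (\<lambda>q. 1 / 2 ^ n * contact_alt n (\<lambda>a. M a 0 q) (\<lambda>a b. O' a b q) id)"
    by (rule tangent_vector_cong[OF y W_open p vol])
  also have "\<dots> = 1 / 2 ^ n * ?y (\<lambda>q. contact_alt n (\<lambda>a. M a 0 q) (\<lambda>a b. O' a b q) id)"
  proof (rule tangent_vector_cmult[OF y])
    show "smooth_near A p (\<lambda>q. contact_alt n (\<lambda>a. M a 0 q) (\<lambda>a b. O' a b q) id)"
      unfolding contact_alt_def contact_term_def
      by (intro smooth_near_sum smooth_near_mult smooth_near_const smooth_near_prod M0s O's)
  qed
  also have "?y (\<lambda>q. contact_alt n (\<lambda>a. M a 0 q) (\<lambda>a b. O' a b q) id) =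
      (\<Sum>a\<in>?I. K a a) * contact_alt n (\<lambda>a. M a 0 p) (\<lambda>a b. O' a b p) id"
    by (rule trans[OF tangent_vector_contact_alt[where t="\<lambda>a. M a 0" and B=O', OF y M0s O's]
          contact_alt_derivation[where t'="\<lambda>a. ?y (M a 0)" and B'="\<lambda>a b. ?y (O' a b)" and
            t="\<lambda>a. M a 0 p" and B="\<lambda>a b. O' a b p", OF K(1) O'']])
  also have "1 / 2 ^ n * ((\<Sum>a\<in>?I. K a a) * contact_alt n (\<lambda>a. M a 0 p) (\<lambda>a b. O' a b p) id) =
      (\<Sum>a\<in>?I. K a a) * volume_density p"
    unfolding vol[OF p] by simp
  finally have "?y volume_density = (\<Sum>a\<in>?I. K a a) * volume_density p" .
  \<comment> \<open>Only \<open>w\<close> reaches the trace: \<open>\<gamma>\<close> and the entries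
    of \<open>\<delta>\<close> occupy off-diagonal places, and the corner entry is 0.\<close>
  moreover have "(\<Sum>j\<in>?I. B j j) = (\<Sum>k = 1..2 * n. w i k k p)"
    unfolding sum_from_0 by (simp add: B_def bracket_coeff_def)
  ultimately show ?case unfolding K(3) D_def by simp
  qed
qed

end

section \<open>Integration in charts\<close>

lemma integrable_continuous_compact_support:
  fixes F :: "'e::euclidean_space \<Rightarrow> real"
  assumes "continuous_on UNIV F" "compact K" "\<And>x. x \<notin> K \<Longrightarrow> F x = 0"
  shows "integrable lborel F"
proof -
  have "integrable lborel (\<lambda>x. indicator K x *\<^sub>R F x)"
    by (rule borel_integrable_compact[OF assms(2) continuous_on_subset[OF assms(1)]]) simp
  also have "(\<lambda>x. indicator K x *\<^sub>R F x) = F"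
    using assms(3) by (auto simp: indicator_def fun_eq_iff)
  finally show ?thesis .
qed

lemma frechet_derivative_outside_support:
  fixes F :: "'e::euclidean_space \<Rightarrow> real"
  assumes "closed K" "\<And>x. x \<notin> K \<Longrightarrow> F x = 0" "x \<notin> K"
  shows "frechet_derivative F (at x) v = 0"
proof -
  have "((\<lambda>x. 0) has_derivative (\<lambda>v. 0)) (at x)" by (rule has_derivative_const)
  then have "(F has_derivative (\<lambda>v. 0)) (at x)"
    by (rule has_derivative_transform_within_open[OF _ open_Compl[OF assms(1)]]) (use assms in auto)
  then show ?thesis using frechet_derivative_at by metis
qed

text \<open>By translation invariance the difference quotients of \<open>F\<close> have integral \<open>0\<close>, and they converge
  dominatedly to the derivative.\<close>

lemma integral_derivative_zero:
  fixes F :: "'e::euclidean_space \<Rightarrow> real"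
  assumes F: "Cinf_on UNIV F" and K: "compact K" and supp: "\<And>x. x \<notin> K \<Longrightarrow> F x = 0"
  shows "integrable lborel (\<lambda>x. frechet_derivative F (at x) v)"
    and "(\<integral>x. frechet_derivative F (at x) v \<partial>lborel) = 0"
proof -
  let ?D = "\<lambda>x. frechet_derivative F (at x) v"
  have cF: "continuous_on UNIV F" by (rule Cinf_on_continuous_on[OF F])
  have cD: "continuous_on UNIV ?D"
    by (rule Cinf_on_continuous_on[OF Cinf_on_frechet_derivative[OF F]])
  have D0: "?D x = 0" if "x \<notin> K" for x
    by (rule frechet_derivative_outside_support[OF compact_imp_closed[OF K] supp that])
  show "integrable lborel ?D" by (rule integrable_continuous_compact_support[OF cD K D0])
  obtain C0 where C0: "\<And>x. x \<in> K \<Longrightarrow> \<bar>?D x\<bar> \<le> C0"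
    using compact_imp_bounded[OF compact_continuous_image[OF continuous_on_subset[OF cD] K]]
    unfolding bounded_iff by auto
  \<comment> \<open>The bound must also hold off \<open>K\<close>, where the derivative is 0, and
    \<open>C0\<close> may be negative when \<open>K\<close> is empty.\<close>
  define C where "C = max C0 0"
  have C: "\<bar>?D x\<bar> \<le> C" for x
    using C0[of x] D0[of x] by (cases "x \<in> K") (auto simp: C_def)
  obtain R where R: "\<And>x. x \<in> K \<Longrightarrow> norm x \<le> R"
    using compact_imp_bounded[OF K] unfolding bounded_iff by auto
  \<comment> \<open>Outside this ball both \<open>x\<close> and \<open>x + t v\<close> with
    \<open>0 < t \<le> 1\<close> avoid \<open>K\<close>, so all the difference quotients vanish
    there.\<close>
  define K' where "K' = (cball 0 (R + norm v) :: 'e set)"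
  define s where "s k x = (F (x + inverse (real (Suc k)) *\<^sub>R v) - F x) / inverse (real (Suc k))" for k x
  have deriv: "((\<lambda>t. F (x + t *\<^sub>R v)) has_real_derivative ?D (x + t *\<^sub>R v)) (at t)" for x t
  proof -
    have F': "(F has_derivative frechet_derivative F (at (x + t *\<^sub>R v))) (at (x + t *\<^sub>R v))"
      by (rule Cinf_on_has_derivative[OF F UNIV_I])
    have "((\<lambda>t. x + t *\<^sub>R v) has_derivative (\<lambda>h. h *\<^sub>R v)) (at t)"
      by (auto intro!: derivative_eq_intros)
    from diff_chain_at[OF this F'] show ?thesis
      using linear_scale[OF has_derivative_linear[OF F'], of _ v]
      by (simp add: has_field_derivative_def o_def mult_commute_abs)
  qed
  have lim: "(\<lambda>k. s k x) \<longlonglongrightarrow> ?D x" for x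
  proof -
    have "((\<lambda>h. (F (x + h *\<^sub>R v) - F x) / h) \<longlongrightarrow> ?D x) (at 0)"
      using deriv[of x 0] by (simp add: DERIV_def)
    then have "((\<lambda>h. (F (x + h *\<^sub>R v) - F x) / h) \<circ> (\<lambda>k. inverse (real (Suc k)))) \<longlonglongrightarrow> ?D x"
      unfolding tendsto_at_iff_sequentially using LIMSEQ_inverse_real_of_nat by simp
    then show ?thesis by (simp add: o_def s_def)
  qed
  have bound: "norm (s k x) \<le> indicator K' x *\<^sub>R C" for k x
  proof (cases "x \<in> K'")
    case True
    let ?t = "inverse (real (Suc k))"
    have "?t > 0" by simp
    from MVT2[OF this deriv[of x]] obtain z
      where "F (x + ?t *\<^sub>R v) - F (x + 0 *\<^sub>R v) = (?t - 0) * ?D (x + z *\<^sub>R v)" by blast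
    then have "s k x = ?D (x + z *\<^sub>R v)" by (simp add: s_def del: of_nat_Suc)
    then show ?thesis using C True by simp
  next
    case False
    have "norm (inverse (real (Suc k)) *\<^sub>R v) \<le> norm v"
      by (simp add: mult_left_le_one_le inverse_le_1_iff del: of_nat_Suc)
    moreover have "norm x \<le> norm (x + inverse (real (Suc k)) *\<^sub>R v) + norm (inverse (real (Suc k)) *\<^sub>R v)"
      by (metis add_diff_cancel norm_triangle_ineq4)
    ultimately have "norm (x + inverse (real (Suc k)) *\<^sub>R v) > R" "norm x > R"
      using False norm_ge_zero[of v] by (simp_all add: K'_def del: norm_scaleR norm_ge_zero of_nat_Suc)
    then have "F (x + inverse (real (Suc k)) *\<^sub>R v) = 0" "F x = 0"
      using supp R not_le by blast+
    then show ?thesis using False by (simp add: s_def)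
  qed
  have intF: "integrable lborel F" by (rule integrable_continuous_compact_support[OF cF K supp])
  have shift: "integrable lborel (\<lambda>x. F (x + y))" "(\<integral>x. F (x + y) \<partial>lborel) = (\<integral>x. F x \<partial>lborel)" for y
  proof -
    have m: "(+) y \<in> measurable lborel borel" "F \<in> borel_measurable borel"
      using cF by (simp_all add: borel_measurable_continuous_onI)
    have "integrable (distr lborel borel ((+) y)) F" using intF by (simp add: lborel_distr_plus)
    from integrable_distr[OF m(1) this] show "integrable lborel (\<lambda>x. F (x + y))"
      by (simp add: add.commute)
    show "(\<integral>x. F (x + y) \<partial>lborel) = (\<integral>x. F x \<partial>lborel)"
      using integral_distr[OF m] by (simp add: lborel_distr_plus add.commute)
  qed
  have "(\<lambda>k. \<integral>x. s k x \<partial>lborel) \<longlonglongrightarrow> (\<integral>x. ?D x \<partial>lborel)"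
  proof (rule integral_dominated_convergence)
    show "?D \<in> borel_measurable lborel" using cD by (simp add: borel_measurable_continuous_onI)
    show "s k \<in> borel_measurable lborel" for k
      unfolding s_def[abs_def]
      using borel_measurable_integrable[OF shift(1)] borel_measurable_integrable[OF intF] by simp
    show "integrable lborel (\<lambda>x. indicator K' x *\<^sub>R C)"
      by (rule borel_integrable_compact) (auto simp: K'_def)
  qed (use lim bound in auto)
  moreover have "(\<integral>x. s k x \<partial>lborel) = 0" for k
    unfolding s_def using shift intF by simp
  ultimately show "(\<integral>x. ?D x \<partial>lborel) = 0" by (simp add: LIMSEQ_const_iff)
qed

text \<open>\<open>contact_measure\<close> prescribes only the measures of Borel subsets of the
  chart domain; this upgrades it to a change of variables for integrals.\<close>

lemma (in contact_chart) chart_integral: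
  fixes H :: "'m \<Rightarrow> real"
  assumes \<mu>: "contact_measure A n \<theta> \<mu>" and H: "continuous_on UNIV H"
    and supp: "\<And>q. q \<notin> fst c \<Longrightarrow> H q = 0"
  shows "(\<integral>q. H q \<partial>\<mu>) =
    (\<integral>x. indicator (snd c ` fst c) x *\<^sub>R (\<bar>volume_density (chart_inv c x)\<bar> * H (chart_inv c x)) \<partial>lborel)"
proof -
  let ?V = "fst c" and ?S = "snd c ` fst c" and ?\<psi> = "chart_inv c"
  let ?\<rho> = "\<lambda>x. \<bar>volume_density (?\<psi> x)\<bar>"
  \<comment> \<open>The inverse chart is continuous, hence measurable, on the range of the chart
    only.\<close>
  let ?R = "restrict_space lborel ?S"
  have V: "open ?V" and S: "open ?S" by (rule chart_open[OF chart], rule chart_open_range[OF chart])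
  have sets: "sets \<mu> = sets borel"
    and em: "\<And>B. B \<in> sets borel \<Longrightarrow> B \<subseteq> ?V \<Longrightarrow> emeasure \<mu> B =
      (\<integral>\<^sup>+ x\<in>snd c ` B. ennreal (?\<rho> x) \<partial>lborel)"
    using \<mu> chart e unfolding contact_measure_def by auto
  have Hm: "H \<in> borel_measurable borel" by (rule borel_measurable_continuous_onI[OF H])
  have \<psi>m: "?\<psi> \<in> measurable ?R borel"
    using borel_measurable_continuous_on_restrict[OF chart_inv_continuous_on[OF chart]]
    by (simp add: measurable_def space_restrict_space sets_restrict_space)
  have "continuous_on ?S (\<lambda>x. volume_density (?\<psi> x))"
    using Cinf_on_continuous_on[OF smooth_fun_on_in_chart[OF volume_density_smooth chart]] by simp
  then have "continuous_on ?S ?\<rho>" by (intro continuous_intros)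
  then have \<rho>m: "?\<rho> \<in> borel_measurable ?R"
    using borel_measurable_continuous_on_restrict[of ?S ?\<rho>]
    by (simp add: measurable_def space_restrict_space sets_restrict_space)
  \<comment> \<open>Inside the chart, \<open>\<mu>\<close> is the image under the inverse chart of
    Lebesgue measure weighted by the absolute density.\<close>
  have "density \<mu> (\<lambda>q. ennreal (indicator ?V q)) = distr (density ?R (\<lambda>x. ennreal (?\<rho> x))) borel ?\<psi>"
  proof (rule measure_eqI)
    show "sets (density \<mu> (\<lambda>q. ennreal (indicator ?V q))) =
        sets (distr (density ?R (\<lambda>x. ennreal (?\<rho> x))) borel ?\<psi>)" by (simp add: sets)
    fix B assume "B \<in> sets (density \<mu> (\<lambda>q. ennreal (indicator ?V q)))"
    then have B: "B \<in> sets borel" by (simp add: sets)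
    have Vs: "?V \<in> sets borel" using V by simp
    have BV: "B \<inter> ?V \<in> sets borel" using B Vs by simp
    have im: "snd c ` (B \<inter> ?V) = ?\<psi> -` B \<inter> ?S"
      using chart_inv_left[OF chart] by (auto simp: image_iff)
    have "emeasure (density \<mu> (\<lambda>q. ennreal (indicator ?V q))) B =
        (\<integral>\<^sup>+ q. ennreal (indicator ?V q) * indicator B q \<partial>\<mu>)"
      using B Vs by (intro emeasure_density) (auto simp: sets measurable_cong_sets[OF sets refl])
    also have "\<dots> = (\<integral>\<^sup>+ q. indicator (B \<inter> ?V) q \<partial>\<mu>)"
      by (rule nn_integral_cong) (auto simp: indicator_def)
    also have "\<dots> = emeasure \<mu> (B \<inter> ?V)" using BV by (simp add: sets)
    also have "\<dots> = (\<integral>\<^sup>+ x. ennreal (?\<rho> x) * indicator (?\<psi> -` B \<inter> ?S) x \<partial>lborel)"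
      using em[OF BV] im by simp
    also have "\<dots> = (\<integral>\<^sup>+ x. (ennreal (?\<rho> x) * indicator (?\<psi> -` B \<inter> ?S) x) * indicator ?S x \<partial>lborel)"
      by (rule nn_integral_cong) (auto simp: indicator_def)
    also have "\<dots> = (\<integral>\<^sup>+ x. ennreal (?\<rho> x) * indicator (?\<psi> -` B \<inter> ?S) x \<partial>?R)"
      using S by (subst nn_integral_restrict_space) auto
    also have "\<dots> = emeasure (density ?R (\<lambda>x. ennreal (?\<rho> x))) (?\<psi> -` B \<inter> ?S)"
      using measurable_sets[OF \<psi>m B] \<rho>m by (intro emeasure_density[symmetric]) (auto simp: space_restrict_space)
    also have "\<dots> = emeasure (distr (density ?R (\<lambda>x. ennreal (?\<rho> x))) borel ?\<psi>) B"
      using B \<psi>m by (subst emeasure_distr) (auto simp: space_restrict_space)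
    finally show "emeasure (density \<mu> (\<lambda>q. ennreal (indicator ?V q))) B =
        emeasure (distr (density ?R (\<lambda>x. ennreal (?\<rho> x))) borel ?\<psi>) B" .
  qed
  note eq = this
  have "(\<integral>q. H q \<partial>\<mu>) = (\<integral>q. indicator ?V q *\<^sub>R H q \<partial>\<mu>)"
    by (rule Bochner_Integration.integral_cong[OF refl]) (use supp in \<open>auto simp: indicator_def\<close>)
  also have "\<dots> = (\<integral>q. H q \<partial>density \<mu> (\<lambda>q. ennreal (indicator ?V q)))"
    using Hm V by (intro integral_density[symmetric]) (auto simp: measurable_cong_sets[OF sets refl])
  also have "\<dots> = (\<integral>x. H (?\<psi> x) \<partial>density ?R (\<lambda>x. ennreal (?\<rho> x)))"
    unfolding eq using \<psi>m Hm by (intro integral_distr) simp_all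
  also have "\<dots> = (\<integral>x. ?\<rho> x *\<^sub>R H (?\<psi> x) \<partial>?R)"
    using \<rho>m measurable_compose[OF \<psi>m Hm] by (intro integral_density) auto
  also have "\<dots> = (\<integral>x. indicator ?S x *\<^sub>R (?\<rho> x *\<^sub>R H (?\<psi> x)) \<partial>lborel)"
    using S by (intro integral_restrict_space) auto
  finally show ?thesis by simp
qed

section \<open>Horizontal gradients\<close>

context contact_riemannian
begin

text \<open>Testing against the single vector \<open>u - v\<close> suffices, so the lemma serves for
  uniqueness both in the tangent space and in the horizontal space.\<close>

lemma metric_nondegenerate:
  assumes u: "u \<in> tangent_space A p" and v: "v \<in> tangent_space A p"
    and eq: "g p u (\<lambda>f. 1 * u f + (- 1) * v f) = g p v (\<lambda>f. 1 * u f + (- 1) * v f)"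
  shows "u = v"
proof -
  let ?d = "\<lambda>f. 1 * u f + (- 1) * v f"
  have d: "?d \<in> tangent_space A p" by (rule tangent_space_lincomb[OF u v])
  have "g p ?d ?d = 1 * g p ?d u + (- 1) * g p ?d v"
    by (rule linear_on_tangentD[OF g_linear[OF d] u v])
  also have "\<dots> = 0" using eq g_sym[OF d u] g_sym[OF d v] by simp
  finally have "g p ?d ?d = 0" .
  then have "?d = (\<lambda>f. 0)" using g_pos[OF d] by (metis less_irrefl)
  then show "u = v" by (simp add: fun_eq_iff)
qed

text \<open>Resolves the definite description: existence by \<open>riesz_representation\<close>,
  uniqueness by nondegeneracy.\<close>

lemma riemannian_gradient:
  "riemannian_gradient A g f p \<in> tangent_space A p"
  "u \<in> tangent_space A p \<Longrightarrow> g p (riemannian_gradient A g f p) u = u f"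
proof -
  have "linear_on_tangent A p (\<lambda>u. u f)" by (simp add: linear_on_tangent_def)
  then obtain v where v: "v \<in> tangent_space A p" "\<And>u. u \<in> tangent_space A p \<Longrightarrow> g p v u = u f"
    using riesz_representation[OF metric, of p "\<lambda>u. u f"] by blast
  have "riemannian_gradient A g f p = v"
    unfolding riemannian_gradient_def
  proof (rule the_equality)
    fix v' assume "v' \<in> tangent_space A p \<and> (\<forall>u\<in>tangent_space A p. g p v' u = u f)"
    then have v': "v' \<in> tangent_space A p" "\<And>u. u \<in> tangent_space A p \<Longrightarrow> g p v' u = u f" by auto
    show "v' = v"
      by (rule metric_nondegenerate[OF v'(1) v(1)])
        (simp only: v(2)[OF tangent_space_lincomb[OF v'(1) v(1)]]
          v'(2)[OF tangent_space_lincomb[OF v'(1) v(1)]])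
  qed (use v in simp)
  then show "riemannian_gradient A g f p \<in> tangent_space A p"
    "u \<in> tangent_space A p \<Longrightarrow> g p (riemannian_gradient A g f p) u = u f"
    using v by simp_all
qed

lemma horizontal_space_lincomb:
  assumes "u \<in> horizontal_space A \<theta> p" "v \<in> horizontal_space A \<theta> p"
  shows "(\<lambda>f. a * u f + b * v f) \<in> horizontal_space A \<theta> p"
proof -
  have u: "u \<in> tangent_space A p" "\<theta> p u = 0" and v: "v \<in> tangent_space A p" "\<theta> p v = 0"
    using assms by (simp_all add: horizontal_space_def)
  show ?thesis
    using tangent_space_lincomb[OF u(1) v(1)] linear_on_tangentD[OF theta_linear u(1) v(1), of a b] u v
    by (simp add: horizontal_space_def)
qed

text \<open>Orthogonality of the full gradient minus \<open>v\<close> to the horizontal space says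
  that \<open>v\<close> and the full gradient pair equally with every horizontal \<open>u\<close>,
  that is, to \<open>u f\<close>.\<close>

lemma horizontal_gradient_eqI:
  assumes v: "v \<in> horizontal_space A \<theta> p"
    and eq: "\<And>u. u \<in> horizontal_space A \<theta> p \<Longrightarrow> g p v u = u f"
  shows "horizontal_gradient A \<theta> g f p = v"
proof -
  let ?G = "riemannian_gradient A g f p"
  have T: "x \<in> tangent_space A p" if "x \<in> horizontal_space A \<theta> p" for x
    using that by (simp add: horizontal_space_def)
  have diff: "g p (\<lambda>h. ?G h - x h) u = u f - g p x u"
    if x: "x \<in> horizontal_space A \<theta> p" and u: "u \<in> horizontal_space A \<theta> p" for x u
  proof -
    have d: "(\<lambda>h. 1 * ?G h + (- 1) * x h) \<in> tangent_space A p"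
      by (rule tangent_space_lincomb[OF riemannian_gradient(1) T[OF x]])
    have "g p (\<lambda>h. 1 * ?G h + (- 1) * x h) u = g p u (\<lambda>h. 1 * ?G h + (- 1) * x h)"
      by (rule g_sym[OF d T[OF u]])
    also have "\<dots> = 1 * g p u ?G + (- 1) * g p u x"
      by (rule linear_on_tangentD[OF g_linear[OF T[OF u]] riemannian_gradient(1) T[OF x]])
    finally show ?thesis
      using g_sym[OF T[OF u] riemannian_gradient(1)] g_sym[OF T[OF u] T[OF x]]
        riemannian_gradient(2)[OF T[OF u]] by simp
  qed
  show ?thesis unfolding horizontal_gradient_def
  proof (rule the_equality)
    show "v \<in> horizontal_space A \<theta> p \<and> (\<forall>u\<in>horizontal_space A \<theta> p. g p (\<lambda>h. ?G h - v h) u = 0)"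
      using v diff[OF v] eq by simp
    fix x assume "x \<in> horizontal_space A \<theta> p \<and>
      (\<forall>u\<in>horizontal_space A \<theta> p. g p (\<lambda>h. ?G h - x h) u = 0)"
    then have x: "x \<in> horizontal_space A \<theta> p" and
      "\<And>u. u \<in> horizontal_space A \<theta> p \<Longrightarrow> g p (\<lambda>h. ?G h - x h) u = 0" by auto
    then have xeq: "g p x u = u f" if "u \<in> horizontal_space A \<theta> p" for u
      using diff[OF x that] that by simp
    show "x = v"
      by (rule metric_nondegenerate[OF T[OF x] T[OF v]])
        (simp only: xeq[OF horizontal_space_lincomb[OF x v]] eq[OF horizontal_space_lincomb[OF x v]])
  qed
qed

lemma horizontal_gradient:
  "horizontal_gradient A \<theta> g f p \<in> horizontal_space A \<theta> p"
  "u \<in> horizontal_space A \<theta> p \<Longrightarrow> g p (horizontal_gradient A \<theta> g f p) u = u f"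
proof -
  let ?G = "riemannian_gradient A g f p"
  \<comment> \<open>Horizontal vectors are orthogonal to \<open>Z\<close>, so removing the Reeb
    component leaves the pairings with them unchanged.\<close>
  define v where "v = (\<lambda>h. 1 * ?G h + (- \<theta> p ?G) * Z p h)"
  have vT: "v \<in> tangent_space A p"
    unfolding v_def by (rule tangent_space_lincomb[OF riemannian_gradient(1) reeb_tangent])
  have "\<theta> p v = 1 * \<theta> p ?G + (- \<theta> p ?G) * \<theta> p (Z p)"
    unfolding v_def by (rule linear_on_tangentD[OF theta_linear riemannian_gradient(1) reeb_tangent])
  then have v: "v \<in> horizontal_space A \<theta> p" using vT by (simp add: horizontal_space_def theta_reeb)
  have eq: "g p v u = u f" if "u \<in> horizontal_space A \<theta> p" for u
  proof -
    have u: "u \<in> tangent_space A p" "\<theta> p u = 0" using that by (simp_all add: horizontal_space_def)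
    have "g p v u = g p u v" by (rule g_sym[OF vT u(1)])
    also have "\<dots> = 1 * g p u ?G + (- \<theta> p ?G) * g p u (Z p)"
      unfolding v_def
      by (rule linear_on_tangentD[OF g_linear[OF u(1)] riemannian_gradient(1) reeb_tangent])
    also have "\<dots> = u f"
      using g_reeb[OF u(1)] u(2) g_sym[OF u(1) riemannian_gradient(1)] riemannian_gradient(2)[OF u(1)]
      by simp
    finally show ?thesis .
  qed
  have "horizontal_gradient A \<theta> g f p = v" by (rule horizontal_gradient_eqI[OF v eq])
  then show "horizontal_gradient A \<theta> g f p \<in> horizontal_space A \<theta> p"
    "u \<in> horizontal_space A \<theta> p \<Longrightarrow> g p (horizontal_gradient A \<theta> g f p) u = u f"
    using v eq by simp_all
qed

text \<open>Turns the integrand of the weak identity into a derivative of \<open>f\<close>, so that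
  only the gradient of \<open>h\<close> has to be known explicitly.\<close>

lemma horizontal_gradient_product:
  "g p (horizontal_gradient A \<theta> g f p) (horizontal_gradient A \<theta> g h p) =
    horizontal_gradient A \<theta> g h p f"
  by (rule horizontal_gradient(2)[OF horizontal_gradient(1)])

lemma horizontal_gradient_locally_zero:
  assumes "open V" "p \<in> V" "\<And>q. q \<in> V \<Longrightarrow> h q = 0"
  shows "horizontal_gradient A \<theta> g h p = (\<lambda>f. 0)"
proof (rule horizontal_gradient_eqI)
  show "(\<lambda>f. 0) \<in> horizontal_space A \<theta> p"
    using tangent_space_zero linear_on_tangent_zero[OF theta_linear] by (simp add: horizontal_space_def)
  fix u assume "u \<in> horizontal_space A \<theta> p"
  then have u: "u \<in> tangent_space A p" by (simp add: horizontal_space_def)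
  have "u h = u (\<lambda>q. 0)" by (rule tangent_vector_cong[OF u assms])
  then show "g p (\<lambda>f. 0) u = u h"
    using tangent_vector_const[OF u] g_sym[OF tangent_space_zero u]
      linear_on_tangent_zero[OF g_linear[OF u]] by simp
qed

end

lemma (in horizontal_frame) horizontal_gradient_frame:
  assumes p: "p \<in> U"
  shows "horizontal_gradient A \<theta> g h p = (\<lambda>f. \<Sum>i = 1..2 * n. X i p h * X i p f)"
proof (rule horizontal_gradient_eqI)
  note XT = X_horizontal[OF _ p, THEN conjunct1] and X\<theta> = X_horizontal[OF _ p, THEN conjunct2]
  have "\<theta> p (\<lambda>f. \<Sum>i = 1..2 * n. X i p h * X i p f) = (\<Sum>i = 1..2 * n. X i p h * \<theta> p (X i p))"
    by (rule linear_on_tangent_sum[OF theta_linear XT])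
  also have "\<dots> = 0" by (rule sum.neutral) (simp add: X\<theta>)
  finally show "(\<lambda>f. \<Sum>i = 1..2 * n. X i p h * X i p f) \<in> horizontal_space A \<theta> p"
    using tangent_space_sum[of "{1..2 * n}" "\<lambda>i. X i p" p "\<lambda>i. X i p h", OF XT]
    by (simp add: horizontal_space_def)
  fix u assume "u \<in> horizontal_space A \<theta> p"
  then have u: "u \<in> tangent_space A p" "\<theta> p u = 0" by (simp_all add: horizontal_space_def)
  have "u h = (\<Sum>j\<in>{0..2 * n}. g p u (E j p) * E j p h)" by (rule fun_cong[OF E_expansion[OF u(1) p]])
  also have "\<dots> = (\<Sum>i = 1..2 * n. g p u (X i p) * X i p h)"
    unfolding sum_from_0 using g_reeb[OF u(1)] u(2) by (simp add: E_def)
  also have "\<dots> = (\<Sum>i = 1..2 * n. X i p h * g p (X i p) u)"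
    by (rule sum.cong[OF refl]) (simp add: g_sym[OF u(1) XT])
  also have "\<dots> = g p (\<lambda>f. \<Sum>i = 1..2 * n. X i p h * X i p f) u"
    by (rule g_sum_left[OF u(1) XT, symmetric])
  finally show "g p (\<lambda>f. \<Sum>i = 1..2 * n. X i p h * X i p f) u = u h" by (rule sym)
qed

section \<open>The divergence theorem for the frame\<close>

context frame_chart
begin

text \<open>Extension by 0 makes the coordinate expression of a function with compact support in
  \<open>W\<close> smooth on all of Euclidean space, as \<open>integral_derivative_zero\<close>
  requires.\<close>

definition pull :: "('m \<Rightarrow> real) \<Rightarrow> 'e \<Rightarrow> real" where
  "pull F x = (if x \<in> snd c ` W then F (chart_inv c x) else 0)"

lemma W_image_open: "open (snd c ` W)"
  by (rule chart_open_image[OF chart W_open Int_lower2])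

lemma chart_inv_W: "x \<in> snd c ` W \<Longrightarrow> chart_inv c x \<in> W \<and> snd c (chart_inv c x) = x"
  by (auto simp: chart_inv_left[OF chart])

lemma pull_outside:
  assumes "\<And>q. q \<in> W - K \<Longrightarrow> F q = 0" "x \<notin> snd c ` K"
  shows "pull F x = 0"
proof (cases "x \<in> snd c ` W")
  case True
  then have "chart_inv c x \<in> W" "snd c (chart_inv c x) = x" using chart_inv_W by auto
  moreover from this have "chart_inv c x \<notin> K" using assms(2) by (metis imageI)
  ultimately show ?thesis using assms(1)[of "chart_inv c x"] by (simp add: pull_def)
qed (simp add: pull_def)

lemma compact_chart_image: "compact K \<Longrightarrow> K \<subseteq> W \<Longrightarrow> compact (snd c ` K)"
  by (rule compact_continuous_image[OF continuous_on_subset[OF chart_continuous_on[OF chart]]]) auto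

lemma pull_smooth:
  assumes F: "smooth_fun_on A W F" and K: "compact K" "K \<subseteq> W" and supp: "\<And>q. q \<in> W - K \<Longrightarrow> F q = 0"
  shows "Cinf_on UNIV (pull F)"
  unfolding pull_def
proof (rule Cinf_on_extend_by_zero[OF W_image_open _ compact_imp_closed[OF compact_chart_image[OF K]]])
  show "Cinf_on (snd c ` W) (\<lambda>x. F (chart_inv c x))"
    using smooth_fun_on_in_chart[OF F chart] by (simp add: Int_commute Int_left_commute)
  show "snd c ` K \<subseteq> snd c ` W" using K(2) by blast
  fix x assume "x \<in> snd c ` W - snd c ` K"
  then show "F (chart_inv c x) = 0" using pull_outside[of K F x, OF supp] by (simp add: pull_def)
qed

lemma pull_integrable:
  assumes "smooth_fun_on A W F" "compact K" "K \<subseteq> W" "\<And>q. q \<in> W - K \<Longrightarrow> F q = 0"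
  shows "integrable lborel (pull F)"
  by (rule integrable_continuous_compact_support[OF Cinf_on_continuous_on[OF pull_smooth[OF assms]]
        compact_chart_image[OF assms(2,3)] pull_outside[OF assms(4)]])

text \<open>The product rule yields the divergence of the components of \<open>X i\<close> times
  \<open>F\<close> and the density; \<open>volume_density_derivative\<close> cancels it and leaves
  the \<open>w\<close> term.\<close>

lemma divergence_pointwise:
  assumes i: "i \<in> {1..2 * n}" and F: "smooth_fun_on A W F" and p: "p \<in> W"
  shows "(\<Sum>a\<in>{0..2 * n}. coord_field a p (\<lambda>q. F q * volume_density q * X i q (coord a))) =
    volume_density p * (X i p F - (\<Sum>k = 1..2 * n. w i k k p) * F p)"
proof -
  let ?I = "{0..2 * n}"
  have pU: "p \<in> U" and pc: "p \<in> fst c" using p by auto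
  have Fs: "smooth_near A p F" by (rule smooth_nearI[OF F p])
  have vs: "smooth_near A p volume_density" by (rule smooth_nearI[OF volume_density_smooth pc])
  have xs: "smooth_near A p (\<lambda>q. X i q (coord a))" for a
    by (rule smooth_vfield_apply_near[OF X_smooth[OF i] pU smooth_nearI[OF coord_smooth pc]])
  note Fv = smooth_near_mult[OF Fs vs] and ct = coord_field_tangent[OF pc]
  have XT: "X i p \<in> tangent_space A p" by (rule smooth_vfield_tangent[OF X_smooth[OF i] pU])
  have ex: "X i p h = (\<Sum>a\<in>?I. X i p (coord a) * coord_field a p h)" for h
    by (rule fun_cong[OF coord_expansion[OF XT pc]])
  have "(\<Sum>a\<in>?I. coord_field a p (\<lambda>q. F q * volume_density q * X i q (coord a))) =
      (\<Sum>a\<in>?I. F p * volume_density p * coord_field a p (\<lambda>q. X i q (coord a))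
        + X i p (coord a) * coord_field a p (\<lambda>q. F q * volume_density q))"
    by (rule sum.cong[OF refl], subst tangent_vector_mult[OF ct Fv xs]) (simp add: mult.commute)
  also have "\<dots> = F p * volume_density p * (\<Sum>a\<in>?I. coord_field a p (\<lambda>q. X i q (coord a)))
      + X i p (\<lambda>q. F q * volume_density q)"
    unfolding ex[of "\<lambda>q. F q * volume_density q"] by (simp add: sum.distrib sum_distrib_left)
  also have "X i p (\<lambda>q. F q * volume_density q) = F p * X i p volume_density + X i p F * volume_density p"
    by (rule tangent_vector_mult[OF XT Fs vs])
  finally show ?thesis unfolding volume_density_derivative[OF i p] by (simp add: algebra_simps)
qed

lemma divergence_integral:
  assumes i: "i \<in> {1..2 * n}" and F: "smooth_fun_on A W F" and K: "compact K" "K \<subseteq> W"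
    and supp: "\<And>q. q \<in> W - K \<Longrightarrow> F q = 0"
  shows "(\<integral>x. pull (\<lambda>q. volume_density q * (X i q F - (\<Sum>k = 1..2 * n. w i k k q) * F q)) x \<partial>lborel) = 0"
proof -
  let ?I = "{0..2 * n}"
  \<comment> \<open>The components of the field \<open>X i\<close> weighted by \<open>F\<close> and
    the density; being compactly supported, they have partial derivatives with integral 0.\<close>
  define \<Phi> where "\<Phi> a = (\<lambda>q. F q * volume_density q * X i q (coord a))" for a
  have \<Phi>s: "smooth_fun_on A W (\<Phi> a)" for a
    unfolding \<Phi>_def
    by (intro smooth_fun_on_mult F smooth_fun_on_subset[OF volume_density_smooth W_open Int_lower2]
        smooth_vfield_apply[OF X_smooth[OF i] smooth_fun_on_subset[OF coord_smooth W_open Int_lower2]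
          Int_lower1])
  have \<Phi>0: "\<Phi> a q = 0" if "q \<in> W - K" for a q using supp[OF that] by (simp add: \<Phi>_def)
  note Kc = compact_chart_image[OF K]
  have Ps: "Cinf_on UNIV (pull (\<Phi> a))" for a by (rule pull_smooth[OF \<Phi>s K \<Phi>0])
  have P0: "pull (\<Phi> a) x = 0" if "x \<notin> snd c ` K" for a x by (rule pull_outside[OF \<Phi>0 that])
  have sum: "(\<Sum>a\<in>?I. frechet_derivative (pull (\<Phi> a)) (at x) (e a)) =
      pull (\<lambda>q. volume_density q * (X i q F - (\<Sum>k = 1..2 * n. w i k k q) * F q)) x" for x
  proof (cases "x \<in> snd c ` W")
    case True
    let ?p = "chart_inv c x"
    have p: "?p \<in> W" "snd c ?p = x" using chart_inv_W[OF True] by auto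
    have "frechet_derivative (pull (\<Phi> a)) (at x) (e a) = coord_field a ?p (\<Phi> a)" for a
    proof -
      have "(pull (\<Phi> a) has_derivative frechet_derivative (pull (\<Phi> a)) (at x)) (at x)"
        by (rule Cinf_on_has_derivative[OF Ps UNIV_I])
      then have "((\<Phi> a \<circ> chart_inv c) has_derivative frechet_derivative (pull (\<Phi> a)) (at x)) (at (snd c ?p))"
        unfolding p(2) by (rule has_derivative_transform_within_open[OF _ W_image_open True])
          (simp add: pull_def)
      from coord_vec_eqI[OF chart _ smooth_nearI[OF \<Phi>s p(1)] this] p(1) show ?thesis by simp
    qed
    then show ?thesis
      using divergence_pointwise[OF i F p(1)] True by (simp add: \<Phi>_def pull_def)
  next
    case False
    then have x: "x \<notin> snd c ` K" using K(2) by blast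
    have "frechet_derivative (pull (\<Phi> a)) (at x) (e a) = 0" for a
      by (rule frechet_derivative_outside_support[OF compact_imp_closed[OF Kc] _ x]) (rule P0)
    then show ?thesis using False by (simp add: pull_def)
  qed
  have "(\<integral>x. (\<Sum>a\<in>?I. frechet_derivative (pull (\<Phi> a)) (at x) (e a)) \<partial>lborel) =
      (\<Sum>a\<in>?I. \<integral>x. frechet_derivative (pull (\<Phi> a)) (at x) (e a) \<partial>lborel)"
    by (rule Bochner_Integration.integral_sum) (rule integral_derivative_zero(1)[OF Ps Kc P0])
  also have "\<dots> = 0"
    by (rule sum.neutral, rule ballI, rule integral_derivative_zero(2)[OF Ps Kc P0])
  finally show ?thesis unfolding sum .
qed

end

section \<open>The sub-Laplacian in a horizontal frame\<close>

context horizontal_frame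
begin

definition frame_laplacian :: "('m \<Rightarrow> real) \<Rightarrow> 'm \<Rightarrow> real" where
  "frame_laplacian f p =
    (\<Sum>i = 1..2 * n. X i p (\<lambda>q. X i q f) - (\<Sum>k = 1..2 * n. w i k k p) * X i p f)"

lemma frame_laplacian_smooth:
  assumes "smooth_fun_on A U f"
  shows "smooth_fun_on A U (frame_laplacian f)"
proof -
  have Xf: "smooth_fun_on A U (\<lambda>q. X i q f)" if "i \<in> {1..2 * n}" for i
    by (rule smooth_vfield_apply[OF X_smooth[OF that] assms subset_refl])
  have XXf: "smooth_fun_on A U (\<lambda>p. X i p (\<lambda>q. X i q f))" if "i \<in> {1..2 * n}" for i
    by (rule smooth_vfield_apply[OF X_smooth[OF that] Xf[OF that] subset_refl])
  have ws: "smooth_fun_on A U (\<lambda>p. \<Sum>k = 1..2 * n. w i k k p)" if "i \<in> {1..2 * n}" for i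
    by (rule smooth_fun_on_sum[OF frame_open w_smooth[OF that]])
  show ?thesis unfolding frame_laplacian_def[abs_def]
    by (rule smooth_fun_on_sum[OF frame_open smooth_fun_on_diff[OF XXf smooth_fun_on_mult[OF ws Xf]]])
qed

end

context frame_chart
begin

text \<open>If \<open>L f\<close> and the claimed expression differed at some point, testing against a bump function
  supported near that point would violate the integral identity defining \<open>L\<close>.\<close>

lemma sub_laplacian_chart:
  assumes \<mu>: "contact_measure A n \<theta> \<mu>" and L: "sub_laplacian A \<theta> g \<mu> L"
    and f: "smooth_fun_on A UNIV f" and p0: "p0 \<in> W"
  shows "L f p0 = frame_laplacian f p0"
proof (rule ccontr)
  let ?v = volume_density
  define R where "R q = L f q - frame_laplacian f q" for q
  assume "L f p0 \<noteq> frame_laplacian f p0"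
  then have R0: "R p0 \<noteq> 0" by (simp add: R_def)
  have p0c: "p0 \<in> fst c" using p0 by blast
  have fU: "smooth_fun_on A U f" by (rule smooth_fun_on_subset[OF f frame_open subset_UNIV])
  have Lf: "smooth_fun_on A UNIV (L f)" using L f by (simp add: sub_laplacian_def)
  note subW = smooth_fun_on_subset[OF _ W_open]
  have FW: "smooth_fun_on A W (frame_laplacian f)"
    by (rule subW[OF frame_laplacian_smooth[OF fU] Int_lower1])
  have RW: "smooth_fun_on A W R"
    unfolding R_def[abs_def] by (rule smooth_fun_on_diff[OF subW[OF Lf subset_UNIV] FW])
  have vW: "smooth_fun_on A W ?v" by (rule subW[OF volume_density_smooth Int_lower2])
  \<comment> \<open>\<open>\<mu>\<close> uses the absolute value of the density, integration by
    parts the density itself; \<open>\<epsilon>\<close> records its sign at \<open>p0\<close>, and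
    \<open>s\<close> that of the discrepancy \<open>R\<close>. On \<open>W1\<close> both signs
    persist.\<close>
  define \<epsilon> where "\<epsilon> = sgn (?v p0)"
  define s where "s = sgn (R p0)"
  have \<epsilon>: "\<epsilon> * ?v p0 > 0" "\<epsilon> \<noteq> 0"
    using volume_density_nonzero[OF p0c] by (simp_all add: \<epsilon>_def sgn_if)
  have s: "s * R p0 > 0" using R0 by (simp add: s_def sgn_if)
  define W1 where "W1 = (W \<inter> (\<lambda>q. \<epsilon> * ?v q) -` {0<..}) \<inter> (W \<inter> (\<lambda>q. s * R q) -` {0<..})"
  have W1: "open W1" unfolding W1_def
    by (intro open_Int continuous_open_preimage[OF _ W_open open_greaterThan]
        smooth_fun_on_continuous_on[OF smooth_fun_on_cmult] vW RW)
  have W1W: "W1 \<subseteq> W" and W1c: "W1 \<subseteq> fst c" by (auto simp: W1_def)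
  have "p0 \<in> W1" using p0 \<epsilon>(1) s by (simp add: W1_def)
  then have "snd c p0 \<in> snd c ` W1" by blast
  \<comment> \<open>The closed ball provides the compact set \<open>K\<close> containing the
    support, the open ball the region where the bump function is positive.\<close>
  then obtain r where r: "r > 0" "cball (snd c p0) r \<subseteq> snd c ` W1"
    using chart_open_image[OF chart W1 W1c] open_contains_cball by blast
  obtain b :: "'e \<Rightarrow> real" where b: "Cinf_on UNIV b" "\<And>x. b x \<ge> 0" "\<And>x. b x > 0 \<longleftrightarrow> x \<in> ball (snd c p0) r"
    using bump_function_exists[OF r(1)] by blast
  define K where "K = chart_inv c ` cball (snd c p0) r"
  have S1: "snd c ` W1 \<subseteq> snd c ` fst c" using W1c by blast
  have K: "compact K" unfolding K_def
    by (rule compact_continuous_image[OF continuous_on_subset[OF chart_inv_continuous_on[OF chart]]])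
      (use r(2) S1 in auto)
  have KW1: "K \<subseteq> W1"
  proof
    fix q assume "q \<in> K"
    then obtain x where "x \<in> cball (snd c p0) r" "q = chart_inv c x" by (auto simp: K_def)
    moreover from this obtain q' where "q' \<in> W1" "x = snd c q'" using r(2) by blast
    ultimately show "q \<in> W1" using chart_inv_left[OF chart, of q'] W1c by auto
  qed
  then have KW: "K \<subseteq> W" using W1W by blast
  have oK: "open (- K)" using K by (simp add: compact_imp_closed open_Compl)
  define h where "h q = (if q \<in> W1 then b (snd c q) else 0)" for q
  have h0: "h q = 0" if "q \<notin> K" for q
  proof (cases "q \<in> W1")
    case True
    then have "chart_inv c (snd c q) = q" using W1c by (intro chart_inv_left[OF chart]) blast
    then have "snd c q \<notin> ball (snd c p0) r"
      using that by (metis K_def ball_subset_cball imageI subsetD)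
    then have "b (snd c q) = 0" using b(2,3)[of "snd c q"] by simp
    then show ?thesis by (simp add: h_def)
  qed (simp add: h_def)
  have hs: "smooth_fun_on A UNIV h"
  proof (rule smooth_fun_on_local[OF open_UNIV])
    fix q
    have "smooth_fun_on A W1 (\<lambda>q. b (snd c q))"
      by (rule smooth_fun_on_chart_compose[OF chart W1 W1c Cinf_on_subset[OF b(1)]]) simp
    then have "smooth_fun_on A W1 h" by (rule smooth_fun_on_cong) (simp add: h_def)
    moreover have "smooth_fun_on A (- K) h"
      by (rule smooth_fun_on_cong[OF smooth_fun_on_const[OF oK, of 0]]) (simp add: h0)
    ultimately show "\<exists>W'. q \<in> W' \<and> smooth_fun_on A W' h" using KW1 by (metis ComplI subsetD)
  qed
  have "closure {p. h p \<noteq> 0} \<subseteq> K"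
    by (rule closure_minimal) (use h0 compact_imp_closed[OF K] in auto)
  then have "compact (closure {p. h p \<noteq> 0})"
    using compact_Int_closed[OF K closed_closure[of "{p. h p \<noteq> 0}"]] by (simp add: inf_absorb2)
  then have "test_function A h" using hs by (simp add: test_function_def)
  then have test: "(\<integral>p. L f p * h p \<partial>\<mu>) =
      - (\<integral>p. g p (horizontal_gradient A \<theta> g f p) (horizontal_gradient A \<theta> g h p) \<partial>\<mu>)"
    using L f by (simp add: sub_laplacian_def)
  define Q where "Q q = (if q \<in> W then \<Sum>i = 1..2 * n. X i q h * X i q f else 0)" for q
  have gQ: "g q (horizontal_gradient A \<theta> g f q) (horizontal_gradient A \<theta> g h q) = Q q" for q
  proof (cases "q \<in> W")
    case True
    then have "q \<in> U" by blast
    then show ?thesis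
      unfolding horizontal_gradient_product using True by (simp add: horizontal_gradient_frame Q_def)
  next
    case False
    then have q: "q \<in> - K" using KW by blast
    have "horizontal_gradient A \<theta> g h q = (\<lambda>f. 0)"
      by (rule horizontal_gradient_locally_zero[OF oK q]) (simp add: h0)
    then show ?thesis unfolding horizontal_gradient_product using False by (auto simp: Q_def)
  qed
  have XT: "X i q \<in> tangent_space A q" if "i \<in> {1..2 * n}" "q \<in> W" for i q
    using X_horizontal[OF that(1)] that(2) by blast
  have Xh0: "X i q h = 0" if "i \<in> {1..2 * n}" "q \<in> W" "q \<notin> K" for i q
  proof -
    have q: "q \<in> - K" using that by simp
    have "X i q h = X i q (\<lambda>q. 0)"
      by (rule tangent_vector_cong[OF XT[OF that(1,2)] oK q]) (simp add: h0)
    then show ?thesis using tangent_vector_const[OF XT[OF that(1,2)]] by simp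
  qed
  have Q0: "Q q = 0" if "q \<notin> K" for q
    using Xh0[OF _ _ that] by (simp add: Q_def)
  have XfW: "smooth_fun_on A W (\<lambda>q. X i q f)" "smooth_fun_on A W (\<lambda>q. X i q h)"
    if "i \<in> {1..2 * n}" for i
    by (rule smooth_vfield_apply[OF X_smooth[OF that] subW[OF f subset_UNIV] Int_lower1],
        rule smooth_vfield_apply[OF X_smooth[OF that] subW[OF hs subset_UNIV] Int_lower1])
  have QW: "smooth_fun_on A W Q"
  proof (rule smooth_fun_on_cong)
    show "smooth_fun_on A W (\<lambda>q. \<Sum>i = 1..2 * n. X i q h * X i q f)"
      by (rule smooth_fun_on_sum[OF W_open smooth_fun_on_mult[OF XfW(2) XfW(1)]])
  qed (simp add: Q_def)
  have Qs: "smooth_fun_on A UNIV Q"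
  proof (rule smooth_fun_on_local[OF open_UNIV])
    fix q
    have "smooth_fun_on A (- K) Q"
      by (rule smooth_fun_on_cong[OF smooth_fun_on_const[OF oK, of 0]]) (simp add: Q0)
    with QW show "\<exists>W'. q \<in> W' \<and> smooth_fun_on A W' Q" using KW by (metis ComplI subsetD)
  qed
  note hW = subW[OF hs subset_UNIV] and LW = subW[OF Lf subset_UNIV]
  \<comment> \<open>On \<open>K\<close> the absolute density equals \<open>\<epsilon>\<close> times
    the density, so the sign leaves the integral as a constant factor.\<close>
  have to_pull: "(\<integral>q. H q \<partial>\<mu>) = \<epsilon> * (\<integral>x. pull (\<lambda>q. ?v q * H q) x \<partial>lborel)"
    if H: "continuous_on UNIV H" and H0: "\<And>q. q \<notin> K \<Longrightarrow> H q = 0" for H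
  proof -
    have "(\<integral>q. H q \<partial>\<mu>) = (\<integral>x. indicator (snd c ` fst c) x *\<^sub>R
        (\<bar>?v (chart_inv c x)\<bar> * H (chart_inv c x)) \<partial>lborel)"
      by (rule chart_integral[OF \<mu> H]) (use H0 KW in blast)
    also have "\<dots> = (\<integral>x. \<epsilon> * pull (\<lambda>q. ?v q * H q) x \<partial>lborel)"
    proof (rule Bochner_Integration.integral_cong[OF refl])
      fix x
      show "indicator (snd c ` fst c) x *\<^sub>R (\<bar>?v (chart_inv c x)\<bar> * H (chart_inv c x)) =
          \<epsilon> * pull (\<lambda>q. ?v q * H q) x"
      proof (cases "x \<in> snd c ` fst c \<and> chart_inv c x \<in> K")
        case True
        then have W1x: "chart_inv c x \<in> W1" using KW1 by blast
        then have pos: "\<epsilon> * ?v (chart_inv c x) > 0" by (simp add: W1_def)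
        have abs: "\<bar>?v (chart_inv c x)\<bar> = \<epsilon> * ?v (chart_inv c x)"
          using pos unfolding \<epsilon>_def by (auto simp: sgn_if zero_less_mult_iff split: if_splits)
        have "x = snd c (chart_inv c x)" using True chart_inv_right by metis
        then have "x \<in> snd c ` W" using W1x W1W by blast
        then show ?thesis using True abs by (simp add: pull_def)
      next
        case False
        have "H (chart_inv c x) = 0 \<or> x \<notin> snd c ` fst c" using False H0 by blast
        then show ?thesis by (auto simp: pull_def)
      qed
    qed
    finally show ?thesis by simp
  qed
  have cLh: "continuous_on UNIV (\<lambda>q. L f q * h q)"
    by (rule smooth_fun_on_continuous_on[OF smooth_fun_on_mult[OF Lf hs]])
  have cQ: "continuous_on UNIV Q" by (rule smooth_fun_on_continuous_on[OF Qs])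
  \<comment> \<open>The weak identity for \<open>L\<close> in coordinates;
    \<open>\<epsilon>\<close>, being nonzero, cancels.\<close>
  have I1: "(\<integral>x. pull (\<lambda>q. ?v q * (L f q * h q)) x \<partial>lborel) = - (\<integral>x. pull (\<lambda>q. ?v q * Q q) x \<partial>lborel)"
  proof -
    have "\<epsilon> * (\<integral>x. pull (\<lambda>q. ?v q * (L f q * h q)) x \<partial>lborel) = (\<integral>q. L f q * h q \<partial>\<mu>)"
      by (rule to_pull[OF cLh, symmetric]) (simp add: h0)
    also have "\<dots> = - (\<integral>q. Q q \<partial>\<mu>)" unfolding test gQ ..
    also have "(\<integral>q. Q q \<partial>\<mu>) = \<epsilon> * (\<integral>x. pull (\<lambda>q. ?v q * Q q) x \<partial>lborel)"
      by (rule to_pull[OF cQ Q0])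
    finally have "\<epsilon> * (\<integral>x. pull (\<lambda>q. ?v q * (L f q * h q)) x \<partial>lborel) =
        \<epsilon> * (- (\<integral>x. pull (\<lambda>q. ?v q * Q q) x \<partial>lborel))" by simp
    then show ?thesis using \<epsilon>(2) by (simp only: mult_cancel_left) simp
  qed
  have int: "integrable lborel (pull F)" if "smooth_fun_on A W F" "\<And>q. q \<notin> K \<Longrightarrow> F q = 0" for F
    by (rule pull_integrable[OF that(1) K KW]) (use that(2) in blast)
  have vh: "smooth_fun_on A W (\<lambda>q. ?v q * (F q * h q))" if "smooth_fun_on A W F" for F
    by (rule smooth_fun_on_mult[OF vW smooth_fun_on_mult[OF that hW]])
  have I2: "(\<integral>x. pull (\<lambda>q. ?v q * (frame_laplacian f q * h q)) x + pull (\<lambda>q. ?v q * Q q) x \<partial>lborel) = 0"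
  proof -
    \<comment> \<open>The integrand of \<open>divergence_integral\<close> for
      \<open>F = h * X i f\<close>. Summed over \<open>i\<close>, the terms without a derivative of
      \<open>h\<close> give \<open>h\<close> times \<open>frame_laplacian f\<close>, and those with
      one give \<open>Q\<close>, all weighted by the density.\<close>
    define D where "D i q = ?v q * (X i q (\<lambda>r. h r * X i r f) -
        (\<Sum>k = 1..2 * n. w i k k q) * (h q * X i q f))" for i q
    have hX: "smooth_fun_on A W (\<lambda>q. h q * X i q f)" if "i \<in> {1..2 * n}" for i
      by (rule smooth_fun_on_mult[OF hW XfW(1)[OF that]])
    have Dz: "(\<integral>x. pull (D i) x \<partial>lborel) = 0" if "i \<in> {1..2 * n}" for i
      unfolding D_def[abs_def] by (rule divergence_integral[OF that hX[OF that] K KW]) (simp add: h0)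
    have Deq: "D i q = ?v q * (h q * (X i q (\<lambda>r. X i r f) - (\<Sum>k = 1..2 * n. w i k k q) * X i q f)
        + X i q h * X i q f)" if "i \<in> {1..2 * n}" "q \<in> W" for i q
    proof -
      have "X i q (\<lambda>r. h r * X i r f) = h q * X i q (\<lambda>r. X i r f) + X i q h * X i q f"
        by (rule tangent_vector_mult[OF XT[OF that] smooth_nearI[OF hW that(2)]
              smooth_nearI[OF XfW(1)[OF that(1)] that(2)]])
      then show ?thesis by (simp add: D_def algebra_simps)
    qed
    have wW: "smooth_fun_on A W (\<lambda>q. \<Sum>k = 1..2 * n. w i k k q)" if "i \<in> {1..2 * n}" for i
      by (rule subW[OF smooth_fun_on_sum[OF frame_open w_smooth[OF that]] Int_lower1])
    have Ds: "smooth_fun_on A W (D i)" if "i \<in> {1..2 * n}" for i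
      unfolding D_def[abs_def]
      by (rule smooth_fun_on_mult[OF vW smooth_fun_on_diff[OF
              smooth_vfield_apply[OF X_smooth[OF that] hX[OF that] Int_lower1]
              smooth_fun_on_mult[OF wW[OF that] hX[OF that]]]])
    have Di: "integrable lborel (pull (D i))" if "i \<in> {1..2 * n}" for i
      by (rule pull_integrable[OF Ds[OF that] K KW]) (use that in \<open>simp add: Deq Xh0 h0\<close>)
    have "pull (\<lambda>q. ?v q * (frame_laplacian f q * h q)) x + pull (\<lambda>q. ?v q * Q q) x =
        (\<Sum>i = 1..2 * n. pull (D i) x)" for x
    proof (cases "x \<in> snd c ` W")
      case True
      then have q: "chart_inv c x \<in> W" using chart_inv_W by blast
      show ?thesis using True q
        by (simp add: pull_def Deq Q_def frame_laplacian_def sum_distrib_left sum_distrib_right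
            sum.distrib[symmetric] algebra_simps)
    qed (simp add: pull_def)
    then have "(\<integral>x. pull (\<lambda>q. ?v q * (frame_laplacian f q * h q)) x + pull (\<lambda>q. ?v q * Q q) x \<partial>lborel) =
        (\<integral>x. (\<Sum>i = 1..2 * n. pull (D i) x) \<partial>lborel)" by simp
    also have "\<dots> = (\<Sum>i = 1..2 * n. \<integral>x. pull (D i) x \<partial>lborel)"
      by (rule Bochner_Integration.integral_sum[OF Di])
    also have "\<dots> = 0" by (rule sum.neutral) (simp add: Dz)
    finally show ?thesis .
  qed
  have i1: "integrable lborel (pull (\<lambda>q. ?v q * (L f q * h q)))"
    by (rule int[OF vh[OF LW]]) (simp add: h0)
  have i2: "integrable lborel (pull (\<lambda>q. ?v q * (frame_laplacian f q * h q)))"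
    by (rule int[OF vh[OF FW]]) (simp add: h0)
  have i3: "integrable lborel (pull (\<lambda>q. ?v q * Q q))"
    by (rule int[OF smooth_fun_on_mult[OF vW QW]]) (simp add: Q0)
  \<comment> \<open>The signs make \<open>G\<close> nonnegative everywhere and positive on the ball,
    while \<open>I1\<close> and \<open>I2\<close> force its integral to be 0; the ball would then be
    a null set.\<close>
  define G where "G x = \<epsilon> * s * pull (\<lambda>q. ?v q * (R q * h q)) x" for x
  have split: "pull (\<lambda>q. ?v q * (R q * h q)) x = pull (\<lambda>q. ?v q * (L f q * h q)) x
      - pull (\<lambda>q. ?v q * (frame_laplacian f q * h q)) x" for x
    by (simp add: pull_def R_def algebra_simps)
  have Gi: "integrable lborel G" unfolding G_def split using i1 i2 by simp
  have "(\<integral>x. pull (\<lambda>q. ?v q * (R q * h q)) x \<partial>lborel) = 0"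
    using I1 I2 i1 i2 i3 by (simp add: split)
  then have "(\<integral>x. G x \<partial>lborel) = 0" by (simp add: G_def)
  have Gpos: "G x \<ge> 0" "x \<in> ball (snd c p0) r \<Longrightarrow> G x > 0" for x
  proof -
    have *: "G x = (\<epsilon> * ?v (chart_inv c x)) * (s * R (chart_inv c x)) * h (chart_inv c x)" if "x \<in> snd c ` W"
      using that by (simp add: G_def pull_def algebra_simps)
    have **: "\<epsilon> * ?v q > 0" "s * R q > 0" if "q \<in> W1" for q using that by (simp_all add: W1_def)
    show "G x \<ge> 0"
    proof (cases "x \<in> snd c ` W \<and> chart_inv c x \<in> W1")
      case True
      then show ?thesis using * **[of "chart_inv c x"] b(2)
        by (simp add: h_def mult_nonneg_nonneg less_imp_le)
    next
      case False
      then show ?thesis using * by (cases "x \<in> snd c ` W") (simp_all add: h_def G_def pull_def)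
    qed
    assume x: "x \<in> ball (snd c p0) r"
    then have "x \<in> snd c ` W1" using r(2) ball_subset_cball by blast
    then obtain q where q: "q \<in> W1" "x = snd c q" by blast
    then have cq: "chart_inv c x = q" using chart_inv_left[OF chart] W1c by auto
    have "x \<in> snd c ` W" using q W1W by blast
    then show "G x > 0" using * **[OF q(1)] b(3)[of x] x q cq by (simp add: h_def)
  qed
  have "AE x in lborel. G x = 0"
    using integral_nonneg_eq_0_iff_AE[OF Gi] Gpos(1) \<open>(\<integral>x. G x \<partial>lborel) = 0\<close> by simp
  then have "AE x in lborel. x \<notin> ball (snd c p0) r"
    by eventually_elim (use Gpos(2) in force)
  then have "ball (snd c p0) r \<in> null_sets lborel"
    by (subst AE_iff_null_sets) simp_all
  then have "negligible (ball (snd c p0) r)"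
    unfolding negligible_iff_null_sets by (rule null_sets_completionI)
  then show False using open_not_negligible[of "ball (snd c p0) r"] r(1) by simp
qed

end

lemma (in horizontal_frame) sub_laplacian_frame:
  assumes "contact_measure A n \<theta> \<mu>" "sub_laplacian A \<theta> g \<mu> L" "smooth_fun_on A UNIV f" "p \<in> U"
  shows "L f p = frame_laplacian f p"
proof -
  obtain c where c: "c \<in> A" "p \<in> fst c" by (rule chart_exists)
  obtain e where "bij_betw e {0..<card (Basis :: 'e set)} (Basis :: 'e set)"
    using ex_bij_betw_nat_finite[OF finite_Basis] by blast
  \<comment> \<open>The dimension \<open>2 * n + 1\<close> matches the enumeration from 0 to
    \<open>2 * n\<close>.\<close>
  moreover have "{0..<card (Basis :: 'e set)} = {0..2 * n}" using dim by auto
  ultimately have "bij_betw e {0..2 * n} (Basis :: 'e set)" by simp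
  then interpret frame_chart A n \<theta> Z g J U X w \<gamma> \<delta> c e
    using c(1) by unfold_locales
  show ?thesis using sub_laplacian_chart[OF assms(1-3)] assms(4) c(2) by blast
qed

section \<open>Square and commutator identities, and the formula for \<open>Gamma2_Z\<close>\<close>

context horizontal_frame
begin

lemma X_tangent: "i \<in> {1..2 * n} \<Longrightarrow> p \<in> U \<Longrightarrow> X i p \<in> tangent_space A p"
  using X_horizontal by blast

lemma X_Z_commute:
  assumes i: "i \<in> {1..2 * n}" and p: "p \<in> U" and h: "smooth_near A p h"
  shows "X i p (\<lambda>q. Z q h) = Z p (\<lambda>q. X i q h) + (\<Sum>j = 1..2 * n. \<delta> i j p * X j p h)"
proof -
  have "lie_bracket A (X i) Z p h = (\<Sum>j = 1..2 * n. \<delta> i j p * X j p h)"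
    by (rule fun_cong[OF bracket_Z[OF i p]])
  then show ?thesis using h by (simp add: lie_bracket_def vapp_def)
qed

text \<open>The first-order terms obey the product rule and enter only \<open>2 u L u\<close>; the
  squares come from applying \<open>X i\<close> twice.\<close>

lemma frame_laplacian_square:
  assumes u: "smooth_fun_on A U u" and p: "p \<in> U"
  shows "frame_laplacian (\<lambda>q. u q * u q) p =
    2 * u p * frame_laplacian u p + 2 * (\<Sum>i = 1..2 * n. (X i p u)\<^sup>2)"
proof -
  have us: "smooth_near A q u" if "q \<in> U" for q by (rule smooth_nearI[OF u that])
  have X1: "X i q (\<lambda>q. u q * u q) = 2 * (u q * X i q u)" if "i \<in> {1..2 * n}" "q \<in> U" for i q
    using tangent_vector_mult[OF X_tangent[OF that] us[OF that(2)] us[OF that(2)]] by simp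
  have X2: "X i p (\<lambda>q. X i q (\<lambda>r. u r * u r)) = 2 * (u p * X i p (\<lambda>q. X i q u) + (X i p u)\<^sup>2)"
    if i: "i \<in> {1..2 * n}" for i
  proof -
    have Xs: "smooth_near A p (\<lambda>q. X i q u)"
      by (rule smooth_vfield_apply_near[OF X_smooth[OF i] p us[OF p]])
    have "X i p (\<lambda>q. X i q (\<lambda>r. u r * u r)) = X i p (\<lambda>q. 2 * (u q * X i q u))"
      by (rule tangent_vector_cong[OF X_tangent[OF i p] frame_open p X1[OF i]])
    also have "\<dots> = 2 * X i p (\<lambda>q. u q * X i q u)"
      by (rule tangent_vector_cmult[OF X_tangent[OF i p] smooth_near_mult[OF us[OF p] Xs]])
    also have "X i p (\<lambda>q. u q * X i q u) = u p * X i p (\<lambda>q. X i q u) + X i p u * X i p u"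
      by (rule tangent_vector_mult[OF X_tangent[OF i p] us[OF p] Xs])
    finally show ?thesis by (simp add: power2_eq_square)
  qed
  have "frame_laplacian (\<lambda>q. u q * u q) p = (\<Sum>i = 1..2 * n.
      2 * u p * (X i p (\<lambda>q. X i q u) - (\<Sum>k = 1..2 * n. w i k k p) * X i p u) + 2 * (X i p u)\<^sup>2)"
    unfolding frame_laplacian_def
    by (rule sum.cong[OF refl]) (simp only: X1[OF _ p] X2, simp add: algebra_simps)
  then show ?thesis
    unfolding frame_laplacian_def by (simp only: sum.distrib sum_distrib_left[symmetric])
qed

text \<open>Moving \<open>Z\<close> out of \<open>X i X i Z f\<close> uses the bracket twice:
  inside, where the outer \<open>X i\<close> also differentiates \<open>\<delta>\<close>, and
  outside. In the first-order part the bracket gives the product of \<open>w\<close> and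
  \<open>\<delta>\<close>, and \<open>Z\<close> acting on the coefficient gives the derivative of
  \<open>w\<close>.\<close>

lemma frame_laplacian_Z_commutator:
  assumes f: "smooth_fun_on A U f" and p: "p \<in> U"
  shows "frame_laplacian (\<lambda>q. Z q f) p - Z p (frame_laplacian f) =
    (\<Sum>i = 1..2 * n. \<Sum>j = 1..2 * n.
       \<delta> i j p * (X i p (\<lambda>q. X j q f) + X j p (\<lambda>q. X i q f)) + X i p (\<delta> i j) * X j p f
       - (\<Sum>k = 1..2 * n. w i k k p) * (\<delta> i j p * X j p f))
    + (\<Sum>i = 1..2 * n. (\<Sum>k = 1..2 * n. Z p (w i k k)) * X i p f)"
proof -
  let ?w = "\<lambda>i p. \<Sum>k = 1..2 * n. w i k k p"
  have fs: "smooth_near A q f" if "q \<in> U" for q by (rule smooth_nearI[OF f that])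
  have Xs: "smooth_near A p (\<lambda>q. X i q f)" if "i \<in> {1..2 * n}" for i
    by (rule smooth_vfield_apply_near[OF X_smooth[OF that] p fs[OF p]])
  have XXs: "smooth_near A p (\<lambda>q. X i q (\<lambda>r. X i r f))" if "i \<in> {1..2 * n}" for i
    by (rule smooth_vfield_apply_near[OF X_smooth[OF that] p Xs[OF that]])
  have ZXs: "smooth_near A p (\<lambda>q. Z q (\<lambda>r. X i r f))" if "i \<in> {1..2 * n}" for i
    by (rule smooth_vfield_apply_near[OF reeb_smooth UNIV_I Xs[OF that]])
  have ds: "smooth_near A p (\<delta> i j)" if "i \<in> {1..2 * n}" "j \<in> {1..2 * n}" for i j
    by (rule smooth_nearI[OF \<delta>_smooth[OF that] p])
  have wks: "smooth_near A p (w i k k)" if "i \<in> {1..2 * n}" "k \<in> {1..2 * n}" for i k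
    by (rule smooth_nearI[OF w_smooth[OF that that(2)] p])
  have ws: "smooth_near A p (?w i)" if "i \<in> {1..2 * n}" for i
    by (rule smooth_near_sum[OF wks[OF that]])
  have 1: "X i p (\<lambda>q. X i q (\<lambda>r. Z r f)) = Z p (\<lambda>q. X i q (\<lambda>r. X i r f))
      + (\<Sum>j = 1..2 * n. \<delta> i j p * X j p (\<lambda>q. X i q f))
      + (\<Sum>j = 1..2 * n. \<delta> i j p * X i p (\<lambda>q. X j q f) + X i p (\<delta> i j) * X j p f)"
    if i: "i \<in> {1..2 * n}" for i
  proof -
    note XT = X_tangent[OF i p]
    have dX: "smooth_near A p (\<lambda>q. \<delta> i j q * X j q f)" if "j \<in> {1..2 * n}" for j
      by (rule smooth_near_mult[OF ds[OF i that] Xs[OF that]])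
    have "X i p (\<lambda>q. X i q (\<lambda>r. Z r f)) =
        X i p (\<lambda>q. Z q (\<lambda>r. X i r f) + (\<Sum>j = 1..2 * n. \<delta> i j q * X j q f))"
      by (rule tangent_vector_cong[OF XT frame_open p X_Z_commute[OF i _ fs]])
    also have "\<dots> = X i p (\<lambda>q. Z q (\<lambda>r. X i r f)) + X i p (\<lambda>q. \<Sum>j = 1..2 * n. \<delta> i j q * X j q f)"
      by (rule tangent_vector_add[OF XT ZXs[OF i] smooth_near_sum[OF dX]])
    also have "X i p (\<lambda>q. \<Sum>j = 1..2 * n. \<delta> i j q * X j q f) =
        (\<Sum>j = 1..2 * n. X i p (\<lambda>q. \<delta> i j q * X j q f))"
      by (rule tangent_vector_sum[OF XT dX])
    also have "\<dots> = (\<Sum>j = 1..2 * n. \<delta> i j p * X i p (\<lambda>q. X j q f) + X i p (\<delta> i j) * X j p f)"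
      by (rule sum.cong[OF refl], rule tangent_vector_mult[OF XT ds[OF i] Xs])
    also have "X i p (\<lambda>q. Z q (\<lambda>r. X i r f)) = Z p (\<lambda>q. X i q (\<lambda>r. X i r f))
        + (\<Sum>j = 1..2 * n. \<delta> i j p * X j p (\<lambda>q. X i q f))"
      by (rule X_Z_commute[OF i p Xs[OF i]])
    finally show ?thesis .
  qed
  have 2: "Z p (frame_laplacian f) = (\<Sum>i = 1..2 * n. Z p (\<lambda>q. X i q (\<lambda>r. X i r f))
      - (?w i p * Z p (\<lambda>q. X i q f) + (\<Sum>k = 1..2 * n. Z p (w i k k)) * X i p f))"
  proof -
    have "Z p (frame_laplacian f) = (\<Sum>i = 1..2 * n. Z p (\<lambda>q. X i q (\<lambda>r. X i r f) - ?w i q * X i q f))"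
      unfolding frame_laplacian_def[abs_def]
      by (rule tangent_vector_sum[OF reeb_tangent])
        (use smooth_near_add[OF XXs smooth_near_mult[OF smooth_near_const[of p "-1"]
              smooth_near_mult[OF ws Xs]]] in simp)
    also have "\<dots> = (\<Sum>i = 1..2 * n. Z p (\<lambda>q. X i q (\<lambda>r. X i r f))
      - (?w i p * Z p (\<lambda>q. X i q f) + (\<Sum>k = 1..2 * n. Z p (w i k k)) * X i p f))"
    proof (rule sum.cong[OF refl])
      fix i assume i: "i \<in> {1..2 * n}"
      have zw: "Z p (?w i) = (\<Sum>k = 1..2 * n. Z p (w i k k))"
        by (rule tangent_vector_sum[OF reeb_tangent wks[OF i]])
      show "Z p (\<lambda>q. X i q (\<lambda>r. X i r f) - ?w i q * X i q f) = Z p (\<lambda>q. X i q (\<lambda>r. X i r f))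
        - (?w i p * Z p (\<lambda>q. X i q f) + (\<Sum>k = 1..2 * n. Z p (w i k k)) * X i p f)"
        unfolding tangent_vector_diff[OF reeb_tangent XXs[OF i] smooth_near_mult[OF ws[OF i] Xs[OF i]]]
          tangent_vector_mult[OF reeb_tangent ws[OF i] Xs[OF i]]
          zw by (rule refl)
    qed
    finally show ?thesis .
  qed
  have "frame_laplacian (\<lambda>q. Z q f) p - Z p (frame_laplacian f) = (\<Sum>i = 1..2 * n.
      (\<Sum>j = 1..2 * n. \<delta> i j p * X j p (\<lambda>q. X i q f))
      + (\<Sum>j = 1..2 * n. \<delta> i j p * X i p (\<lambda>q. X j q f) + X i p (\<delta> i j) * X j p f)
      - ?w i p * (\<Sum>j = 1..2 * n. \<delta> i j p * X j p f)
      + (\<Sum>k = 1..2 * n. Z p (w i k k)) * X i p f)"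
    unfolding 2 frame_laplacian_def[of "\<lambda>q. Z q f"] sum_subtractf[symmetric]
    by (rule sum.cong[OF refl]) (simp only: 1 X_Z_commute[OF _ p fs[OF p]], simp add: algebra_simps)
  also have "\<dots> = (\<Sum>i = 1..2 * n. (\<Sum>j = 1..2 * n.
       \<delta> i j p * (X i p (\<lambda>q. X j q f) + X j p (\<lambda>q. X i q f)) + X i p (\<delta> i j) * X j p f
       - ?w i p * (\<delta> i j p * X j p f))
    + (\<Sum>k = 1..2 * n. Z p (w i k k)) * X i p f)"
    by (simp only: sum_distrib_left sum.distrib[symmetric] sum_subtractf[symmetric],
        rule sum.cong[OF refl], rule arg_cong2[where f="(+)"], rule sum.cong[OF refl])
      (simp_all add: algebra_simps)
  finally show ?thesis by (simp only: sum.distrib)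
qed

end

theorem theorem3p4:
  fixes A :: "('m::{t2_space, second_countable_topology}, 'e::euclidean_space) chart set"
    and n :: nat
    and \<theta> :: "'m \<Rightarrow> 'm tvec \<Rightarrow> real"
    and Z :: "'m vfield"
    and g :: "'m \<Rightarrow> 'm tvec \<Rightarrow> 'm tvec \<Rightarrow> real"
    and J :: "'m \<Rightarrow> 'm tvec \<Rightarrow> 'm tvec"
    and \<mu> :: "'m measure"
    and L :: "('m \<Rightarrow> real) \<Rightarrow> 'm \<Rightarrow> real"
    and f :: "'m \<Rightarrow> real"
    and U :: "'m set"
    and X :: "nat \<Rightarrow> 'm vfield"
    and w :: "nat \<Rightarrow> nat \<Rightarrow> nat \<Rightarrow> 'm \<Rightarrow> real"
    and \<gamma> \<delta> :: "nat \<Rightarrow> nat \<Rightarrow> 'm \<Rightarrow> real"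
  assumes "contact_riemannian_manifold A n \<theta> Z g J"
    and "complete_riemannian A g"
    and "contact_measure A n \<theta> \<mu>"
    and "sub_laplacian A \<theta> g \<mu> L"
    and "smooth_fun_on A UNIV f"
    and "horizontal_orthonormal_frame A n \<theta> g U X"
    and "\<And>i j p. i \<in> {1..2 * n} \<Longrightarrow> j \<in> {1..2 * n} \<Longrightarrow> p \<in> U \<Longrightarrow>
           lie_bracket A (X i) (X j) p =
             (\<lambda>h. (\<Sum>k = 1..2 * n. w i j k p * X k p h) + \<gamma> i j p * Z p h)"
    and "\<And>i p. i \<in> {1..2 * n} \<Longrightarrow> p \<in> U \<Longrightarrow>
           lie_bracket A (X i) Z p = (\<lambda>h. \<Sum>j = 1..2 * n. \<delta> i j p * X j p h)"
    and "\<And>i p. i \<in> {1..2 * n} \<Longrightarrow> p \<in> U \<Longrightarrow> \<delta> i i p = 0"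
  shows "\<forall>p\<in>U. Gamma2_Z L Z f p =
     (\<Sum>i = 1..2 * n. (vapp (X i) (vapp Z f) p)\<^sup>2)
     + 1 / 2 * (\<Sum>i = 1..2 * n. \<Sum>l = 1..2 * n.
         (\<delta> i l p + \<delta> l i p) *
         (vapp (X i) (vapp (X l) f) p + vapp (X l) (vapp (X i) f) p) * vapp Z f p)
     + (\<Sum>l = 1..2 * n.
         ((\<Sum>i = 1..2 * n. vapp (X i) (\<delta> i l) p)
          - (\<Sum>i = 1..2 * n. \<Sum>k = 1..2 * n. w i k k p * \<delta> i l p)
          + (\<Sum>k = 1..2 * n. vapp Z (w l k k) p))
         * vapp (X l) f p * vapp Z f p)"
proof
  fix p assume p: "p \<in> U"
  interpret horizontal_frame A n \<theta> Z g J U X w \<gamma> \<delta>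
    by unfold_locales (use assms in blast)+
  let ?I = "{1..2 * n}"
  define z where "z = (\<lambda>q. Z q f)"
  have fU: "smooth_fun_on A U f" by (rule smooth_fun_on_subset[OF assms(5) frame_open subset_UNIV])
  \<comment> \<open>The identity for \<open>L\<close> concerns globally smooth arguments;
    \<open>Z f\<close> is one, since the Reeb field is global.\<close>
  have z: "smooth_fun_on A UNIV z"
    unfolding z_def by (rule smooth_vfield_apply[OF reeb_smooth assms(5) subset_UNIV])
  have zU: "smooth_fun_on A U z" by (rule smooth_fun_on_subset[OF z frame_open subset_UNIV])
  note lap = sub_laplacian_frame[OF assms(3,4)]
  have L1: "L (\<lambda>q. z q * z q) p = 2 * z p * frame_laplacian z p + 2 * (\<Sum>i\<in>?I. (X i p z)\<^sup>2)"
    using lap[OF smooth_fun_on_mult[OF z z] p] frame_laplacian_square[OF zU p] by simp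
  \<comment> \<open>The frame formula for \<open>L f\<close> holds on \<open>U\<close> only, but
    \<open>Z p\<close> depends only on the germ at \<open>p\<close>.\<close>
  have L2: "Z p (L f) = Z p (frame_laplacian f)"
    by (rule tangent_vector_cong[OF reeb_tangent frame_open p lap[OF assms(5)]])
  have \<Gamma>: "Gamma2_Z L Z f p =
      (\<Sum>i\<in>?I. (X i p z)\<^sup>2) + z p * (frame_laplacian z p - Z p (frame_laplacian f))"
    using L1 L2 by (simp add: Gamma2_Z_def Gamma_Z_def vapp_def z_def algebra_simps)
  let ?a = "\<lambda>i j. X i p (\<lambda>q. X j q f)"
  \<comment> \<open>The second-order factor is symmetric in \<open>i\<close> and \<open>j\<close>,
    so \<open>\<delta>\<close> may be replaced by its symmetric part; this produces the factor one
    half.\<close>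
  have sym: "(\<Sum>i\<in>?I. \<Sum>j\<in>?I. \<delta> i j p * (?a i j + ?a j i)) =
      1 / 2 * (\<Sum>i\<in>?I. \<Sum>j\<in>?I. (\<delta> i j p + \<delta> j i p) * (?a i j + ?a j i))"
  proof -
    have "(\<Sum>i\<in>?I. \<Sum>j\<in>?I. \<delta> j i p * (?a i j + ?a j i)) =
        (\<Sum>i\<in>?I. \<Sum>j\<in>?I. \<delta> i j p * (?a i j + ?a j i))"
      by (subst sum.swap) (simp add: add.commute)
    then show ?thesis by (simp add: distrib_right sum.distrib)
  qed
  have X\<delta>: "(\<Sum>i\<in>?I. \<Sum>j\<in>?I. X i p (\<delta> i j) * X j p f) = (\<Sum>l\<in>?I. (\<Sum>i\<in>?I. X i p (\<delta> i l)) * X l p f)"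
    by (subst sum.swap) (simp add: sum_distrib_right)
  have w\<delta>: "(\<Sum>i\<in>?I. \<Sum>j\<in>?I. (\<Sum>k\<in>?I. w i k k p) * (\<delta> i j p * X j p f)) =
      (\<Sum>l\<in>?I. (\<Sum>i\<in>?I. \<Sum>k\<in>?I. w i k k p * \<delta> i l p) * X l p f)"
    by (subst sum.swap) (simp add: sum_distrib_right mult.assoc)
  have coeffs: "(\<Sum>l\<in>?I. (r l - s l + t l) * X l p f) =
      (\<Sum>l\<in>?I. r l * X l p f) - (\<Sum>l\<in>?I. s l * X l p f) + (\<Sum>l\<in>?I. t l * X l p f)" for r s t
    by (simp only: distrib_right left_diff_distrib sum.distrib sum_subtractf)
  have comm: "frame_laplacian z p - Z p (frame_laplacian f) =
      1 / 2 * (\<Sum>i\<in>?I. \<Sum>j\<in>?I. (\<delta> i j p + \<delta> j i p) * (?a i j + ?a j i))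
      + (\<Sum>l\<in>?I. ((\<Sum>i\<in>?I. X i p (\<delta> i l)) - (\<Sum>i\<in>?I. \<Sum>k\<in>?I. w i k k p * \<delta> i l p)
          + (\<Sum>k\<in>?I. Z p (w l k k))) * X l p f)"
    unfolding z_def frame_laplacian_Z_commutator[OF fU p] coeffs
    by (simp only: sum.distrib sum_subtractf sym X\<delta> w\<delta>)
  have factor: "s + z p * (1 / 2 * s1 + s2) = s + 1 / 2 * (s1 * z p) + s2 * z p" for s s1 s2
    by (simp add: algebra_simps)
  show "Gamma2_Z L Z f p =
     (\<Sum>i = 1..2 * n. (vapp (X i) (vapp Z f) p)\<^sup>2)
     + 1 / 2 * (\<Sum>i = 1..2 * n. \<Sum>l = 1..2 * n.
         (\<delta> i l p + \<delta> l i p) *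
         (vapp (X i) (vapp (X l) f) p + vapp (X l) (vapp (X i) f) p) * vapp Z f p)
     + (\<Sum>l = 1..2 * n.
         ((\<Sum>i = 1..2 * n. vapp (X i) (\<delta> i l) p)
          - (\<Sum>i = 1..2 * n. \<Sum>k = 1..2 * n. w i k k p * \<delta> i l p)
          + (\<Sum>k = 1..2 * n. vapp Z (w l k k) p))
         * vapp (X l) f p * vapp Z f p)"
    unfolding \<Gamma> comm factor by (simp only: vapp_def z_def sum_distrib_right)
qed

end
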